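(* For every integer $n\geq 2$ there exists a minimal embedding of the product manifold $S^{n-1}\times S^{n-1}\times S^1$ into the round sphere $\mathbb{S}^{2n}$.
   Context: $\mathbb{S}^{2n}$ denotes the standard round unit sphere in $\mathbb{R}^{2n+1}$. $S^k$ denotes the $k$-dimensional sphere as a smooth manifold, and $S^{n-1}\times S^{n-1}\times S^1$ is the product smooth manifold (of dimension $2n-1$, so the embedding has codimension one). A minimal embedding is a smooth embedding whose image has vanishing mean curvature. *)

theory Defs
  imports "HOL-Analysis.Analysis"
begin

text \<open>Manifolds are represented as subsets of Euclidean spaces. The smooth structure and the
  Riemannian metric are the ones induced by the ambient space; for a product of round
  spheres, sitting in the product of the ambient spaces, this is the product smooth structure.\<close>

text \<open>\<open>Ck_on k U f\<close> is meant for open \<open>U\<close>.\<close>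

fun Ck_on :: "nat \<Rightarrow> 'a::real_normed_vector set \<Rightarrow> ('a \<Rightarrow> 'b::real_normed_vector) \<Rightarrow> bool" where
  "Ck_on 0 U f \<longleftrightarrow> continuous_on U f"
| "Ck_on (Suc k) U f \<longleftrightarrow>
     (\<forall>x\<in>U. f differentiable (at x)) \<and>
     (\<forall>v. Ck_on k U (\<lambda>x. frechet_derivative f (at x) v))"

definition smooth_on :: "'a::real_normed_vector set \<Rightarrow> ('a \<Rightarrow> 'b::real_normed_vector) \<Rightarrow> bool" where
  "smooth_on U f \<longleftrightarrow> (\<forall>k. Ck_on k U f)"

text \<open>A map on an arbitrary subset of a Euclidean space is smooth if it locally extends to a
  smooth map on an open set. On embedded submanifolds this agrees with smoothness in charts.\<close>

definition smooth_map_on :: "'a::euclidean_space set \<Rightarrow> ('a \<Rightarrow> 'b::euclidean_space) \<Rightarrow> bool" where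
  "smooth_map_on M f \<longleftrightarrow>
     (\<forall>p\<in>M. \<exists>U g. open U \<and> p \<in> U \<and> smooth_on U g \<and> (\<forall>x\<in>M \<inter> U. g x = f x))"

text \<open>Velocities of smooth curves through \<open>p\<close> lying in \<open>M\<close>.\<close>

definition tangent_space :: "'a::euclidean_space set \<Rightarrow> 'a \<Rightarrow> 'a set" where
  "tangent_space M p =
     {v. \<exists>c e. 0 < (e::real) \<and> smooth_on {-e<..<e} c \<and> c ` {-e<..<e} \<subseteq> M \<and>
               c 0 = p \<and> (c has_vector_derivative v) (at 0)}"

text \<open>A derivative within a submanifold \<open>M\<close> is a linear map on the whole ambient space; only its
  restriction to the tangent space of \<open>M\<close> is determined by \<open>f\<close>, and that restriction is the
  differential of \<open>f\<close>. Every use of such a derivative below is on tangent vectors only.\<close>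

definition immersion_on :: "'a::euclidean_space set \<Rightarrow> ('a \<Rightarrow> 'b::euclidean_space) \<Rightarrow> bool" where
  "immersion_on M f \<longleftrightarrow>
     smooth_map_on M f \<and>
     (\<forall>p\<in>M. \<exists>f'. (f has_derivative f') (at p within M) \<and> inj_on f' (tangent_space M p))"

definition smooth_embedding ::
    "'a::euclidean_space set \<Rightarrow> 'b::euclidean_space set \<Rightarrow> ('a \<Rightarrow> 'b) \<Rightarrow> bool" where
  "smooth_embedding M N f \<longleftrightarrow>
     f ` M \<subseteq> N \<and> immersion_on M f \<and> (\<exists>g. homeomorphism M (f ` M) f g)"

definition unit_normal_field ::
    "'a::euclidean_space set \<Rightarrow> 'a set \<Rightarrow> 'a set \<Rightarrow> ('a \<Rightarrow> 'a) \<Rightarrow> bool" where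
  "unit_normal_field N S U \<nu> \<longleftrightarrow>
     smooth_map_on (S \<inter> U) \<nu> \<and>
     (\<forall>q\<in>S \<inter> U. \<nu> q \<in> tangent_space N q \<and> norm (\<nu> q) = 1 \<and>
                 (\<forall>v\<in>tangent_space S q. \<nu> q \<bullet> v = 0))"

text \<open>Mean curvature at \<open>p\<close> of a hypersurface \<open>S\<close> of \<open>N\<close> with respect to a unit normal field \<open>\<nu>\<close>: the
  trace of the shape operator, which sends a tangent vector \<open>v\<close> of \<open>S\<close> to minus the covariant
  derivative of \<open>\<nu>\<close> along \<open>v\<close>. The Levi-Civita connection of \<open>N\<close> is the projection to the tangent
  spaces of \<open>N\<close> of the ambient derivative \<open>D\<close>. The projection does not appear, since the
  result is paired with vectors tangent to \<open>S\<close>, hence to \<open>N\<close>. The value does not depend on the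
  orthonormal basis \<open>B\<close> of the tangent space of \<open>S\<close>.\<close>

definition has_mean_curvature ::
    "'a::euclidean_space set \<Rightarrow> ('a \<Rightarrow> 'a) \<Rightarrow> 'a \<Rightarrow> real \<Rightarrow> bool" where
  "has_mean_curvature S \<nu> p H \<longleftrightarrow>
     (\<exists>D B. (\<nu> has_derivative D) (at p within S) \<and>
            pairwise orthogonal B \<and> (\<forall>b\<in>B. norm b = 1) \<and> span B = tangent_space S p \<and>
            H = (\<Sum>b\<in>B. - D b \<bullet> b))"

text \<open>Changing the sign of \<open>\<nu>\<close> changes the sign of the mean curvature, so its vanishing does not
  depend on the choice of the local unit normal field. This notion is intended for
  hypersurfaces \<open>S\<close> of \<open>N\<close> only.\<close>

definition vanishing_mean_curvature ::
    "'a::euclidean_space set \<Rightarrow> 'a set \<Rightarrow> bool" where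
  "vanishing_mean_curvature N S \<longleftrightarrow>
     (\<forall>p\<in>S. \<exists>U \<nu>. open U \<and> p \<in> U \<and> unit_normal_field N S U \<nu> \<and> has_mean_curvature S \<nu> p 0)"

definition minimal_embedding ::
    "'a::euclidean_space set \<Rightarrow> 'b::euclidean_space set \<Rightarrow> ('a \<Rightarrow> 'b) \<Rightarrow> bool" where
  "minimal_embedding M N f \<longleftrightarrow>
     smooth_embedding M N f \<and> vanishing_mean_curvature N (f ` M)"

end

theory Submission
  imports Defs
begin

text \<open>We look for a hypersurface invariant under \<open>O(n) \<times> O(n)\<close>. Its profile curve lies in the part
  \<open>x, y > 0\<close> of the unit 2-sphere, and minimality means that this curve is a geodesic for the metric
  weighted by \<open>(x y)\<^sup>m\<close>, where \<open>m = n - 1\<close>. We want a simple closed geodesic that is symmetric under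
  \<open>z \<mapsto> - z\<close> and \<open>x \<leftrightarrow> y\<close>, hence a geodesic that leaves \<open>z = 0\<close> orthogonally and first meets
  \<open>x = y\<close> orthogonally, with both angular coordinates monotone in between.

  Shoot orthogonally from \<open>z = 0\<close>. Because \<open>x - y\<close> and \<open>z\<close> are eigenfunctions of linear equations
  along the geodesic, a Sturm comparison keeps \<open>z\<close> away from the pole, and the geodesic either meets
  \<open>x = y\<close> while still ascending or becomes horizontal before, and both are open conditions on the
  starting point. A start close to \<open>x = y\<close> has no time to turn. A start at distance \<open>\<epsilon>\<close>
  from the boundary turns before \<open>x = y\<close>: otherwise its height would grow to order
  \<open>\<epsilon>\<^sup>m ln (1 / \<epsilon>)\<close>, while the flux identity \<open>(W z')' = - (2 m + 1) W z\<close> with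
  \<open>W = (x y)\<^sup>m\<close> allows only the order \<open>\<epsilon>\<^sup>m\<close>. So some starting point does both at once.\<close>

section \<open>Calculus of smooth maps\<close>

text \<open>The weight \<open>(x y)^m\<close> is, up to a constant factor, the volume of an orbit
  \<open>S^m \<times> S^m\<close>. Staying in \<open>x, y > 0\<close> keeps every orbit of this
  type, which together with a simple closed profile gives the required product. Compared with the
  equation for \<open>z\<close>, the one for the orbit radius \<open>x\<close> has the additional
  term \<open>m W / x\<close>, and similarly for \<open>y\<close>. In the difference these terms
  combine to \<open>- m W (x - y) / (x y)\<close>; this is why \<open>x - y\<close> still satisfies
  a linear equation, with a coefficient of at least \<open>4 m + 1\<close> because
  \<open>x y \<le> 1 / 2\<close>. The obstacle is that the profile equation is singular at the pole
  and where \<open>x y = 0\<close>. Its right-hand side is therefore cut off to a bounded Lipschitz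
  field, which has global solutions depending continuously on the start; that the relevant arc stays
  below the cut-offs is what the comparison and the monotonicity provide. The cut-offs are
  symmetric, so the two reflections still act on solutions and complete the arc, a quarter of the
  curve, to a closed curve.\<close>

lemma Ck_on_cong:
  assumes "open U" "\<And>x. x \<in> U \<Longrightarrow> f x = g x" "Ck_on k U f"
  shows "Ck_on k U g"
  using assms(2,3)
proof (induction k arbitrary: f g)
  case 0
  then show ?case by (simp cong: continuous_on_cong)
next
  case (Suc k)
  have diff: "g differentiable (at x)" if "x \<in> U" for x
    using Suc.prems that assms(1)
    by (meson Ck_on.simps(2) differentiable_def has_derivative_transform_within_open)
  have "frechet_derivative f (at x) = frechet_derivative g (at x)" if "x \<in> U" for x
    by (rule frechet_derivative_transform_within_open[where X=U]) (use Suc.prems that assms(1) in auto)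
  then have "Ck_on k U (\<lambda>x. frechet_derivative g (at x) v)" for v
    using Suc.IH[of "\<lambda>x. frechet_derivative f (at x) v"] Suc.prems by auto
  with diff show ?case by auto
qed

lemma Ck_on_subset: "Ck_on k U f \<Longrightarrow> V \<subseteq> U \<Longrightarrow> Ck_on k V f"
  by (induction k arbitrary: f) (auto intro: continuous_on_subset)

lemma Ck_on_SucI:
  assumes "open U" "\<And>x. x \<in> U \<Longrightarrow> (f has_derivative f' x) (at x)"
    and "\<And>v. Ck_on k U (\<lambda>x. f' x v)"
  shows "Ck_on (Suc k) U f"
proof -
  have "frechet_derivative f (at x) = f' x" if "x \<in> U" for x
    using assms(2)[OF that] by (metis frechet_derivative_at)
  then have "Ck_on k U (\<lambda>x. frechet_derivative f (at x) v)" for v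
    using Ck_on_cong[OF assms(1) _ assms(3)] by auto
  then show ?thesis using assms(2) by (auto simp: differentiable_def)
qed

lemma Ck_on_Suc_has_derivative:
  "Ck_on (Suc k) U f \<Longrightarrow> x \<in> U \<Longrightarrow> (f has_derivative frechet_derivative f (at x)) (at x)"
  by (simp add: frechet_derivative_works)

lemma Ck_on_imp_continuous_on: "Ck_on k U f \<Longrightarrow> continuous_on U f"
  by (cases k) (auto intro!: differentiable_imp_continuous_on
      simp: differentiable_on_def differentiable_at_withinI)

lemma Ck_on_SucD: "Ck_on (Suc k) U f \<Longrightarrow> Ck_on k U f"
proof (induction k arbitrary: f)
  case 0
  then show ?case using Ck_on_imp_continuous_on by (metis Ck_on.simps(1))
next
  case (Suc k)
  show ?case
    unfolding Ck_on.simps(2)[of k]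
    using Suc.prems Suc.IH by (metis Ck_on.simps(2))
qed

lemma Ck_on_const: "Ck_on k U (\<lambda>x. c)"
  by (induction k arbitrary: c) auto

lemma Ck_on_bounded_linear_comp:
  assumes "open U" "bounded_linear L" "Ck_on k U f"
  shows "Ck_on k U (\<lambda>x. L (f x))"
  using assms(3)
proof (induction k arbitrary: f)
  case 0
  then show ?case using assms(2) by (simp add: bounded_linear.continuous_on)
next
  case (Suc k)
  show ?case
    by (rule Ck_on_SucI[OF assms(1) bounded_linear.has_derivative[OF assms(2) Ck_on_Suc_has_derivative[OF Suc.prems]]])
      (use Suc in auto)
qed

lemma Ck_on_id: "open U \<Longrightarrow> Ck_on k U (\<lambda>x. x)"
proof (cases k)
  case (Suc j)
  assume "open U"
  then show ?thesis unfolding Suc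
    by (rule Ck_on_SucI[where f' = "\<lambda>x v. v"]) (auto simp: Ck_on_const)
qed auto

lemma Ck_on_add:
  assumes "open U" "Ck_on k U f" "Ck_on k U g"
  shows "Ck_on k U (\<lambda>x. f x + g x)"
  using assms(2,3)
proof (induction k arbitrary: f g)
  case 0
  then show ?case by (auto intro: continuous_intros)
next
  case (Suc k)
  show ?case
    by (rule Ck_on_SucI[OF assms(1) has_derivative_add[OF Ck_on_Suc_has_derivative[OF Suc.prems(1)]
          Ck_on_Suc_has_derivative[OF Suc.prems(2)]]])
      (use Suc in auto)
qed

lemma Ck_on_sum:
  assumes "open U" "finite I" "\<And>i. i \<in> I \<Longrightarrow> Ck_on k U (f i)"
  shows "Ck_on k U (\<lambda>x. \<Sum>i\<in>I. f i x)"
  using assms(2,3) by (induction I) (auto intro: Ck_on_const Ck_on_add[OF assms(1)])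

lemma Ck_on_bounded_bilinear:
  assumes "open U" "bounded_bilinear h" "Ck_on k U f" "Ck_on k U g"
  shows "Ck_on k U (\<lambda>x. h (f x) (g x))"
  using assms(3,4)
proof (induction k arbitrary: f g)
  case 0
  then show ?case using assms(2) by (simp add: bounded_bilinear.continuous_on)
next
  case (Suc k)
  show ?case
    by (rule Ck_on_SucI[OF assms(1) bounded_bilinear.FDERIV[OF assms(2) Ck_on_Suc_has_derivative[OF Suc.prems(1)]
          Ck_on_Suc_has_derivative[OF Suc.prems(2)]]])
      (use Suc Ck_on_SucD[OF Suc.prems(1)] Ck_on_SucD[OF Suc.prems(2)] in
        \<open>auto intro!: Ck_on_add[OF assms(1)]\<close>)
qed

lemma Ck_on_compose:
  fixes g :: "'b::euclidean_space \<Rightarrow> 'c::real_normed_vector"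
  assumes "open U" "open V" "f ` U \<subseteq> V" "Ck_on k U f" "Ck_on k V g"
  shows "Ck_on k U (\<lambda>x. g (f x))"
  using assms(4,5)
proof (induction k arbitrary: g)
  case 0
  then show ?case using assms(3) by (auto intro: continuous_on_compose2)
next
  case (Suc k)
  let ?Df = "\<lambda>x. frechet_derivative f (at x)" and ?Dg = "\<lambda>y. frechet_derivative g (at y)"
  have D: "((\<lambda>x. g (f x)) has_derivative (\<lambda>v. ?Dg (f x) (?Df x v))) (at x)" if "x \<in> U" for x
    by (rule has_derivative_compose[OF Ck_on_Suc_has_derivative[OF Suc.prems(1) that]
          Ck_on_Suc_has_derivative[OF Suc.prems(2)]]) (use assms(3) that in auto)
  \<comment> \<open>\<open>Ck_on\<close> controls derivatives in fixed directions, whereas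
    \<open>?Df x v\<close> varies with \<open>x\<close>. Expanding it in the basis turns the chain
    rule into a finite sum of products to which the induction applies.\<close>
  have eq: "?Dg (f x) (?Df x v) = (\<Sum>b\<in>Basis. (?Df x v \<bullet> b) *\<^sub>R ?Dg (f x) b)" if "x \<in> U" for x v
  proof -
    have l: "linear (?Dg (f x))"
      using Suc.prems(2) assms(3) that
      by (intro has_derivative_linear[OF Ck_on_Suc_has_derivative[OF Suc.prems(2)]]) auto
    have "?Dg (f x) (\<Sum>b\<in>Basis. (?Df x v \<bullet> b) *\<^sub>R b) = (\<Sum>b\<in>Basis. (?Df x v \<bullet> b) *\<^sub>R ?Dg (f x) b)"
      using l by (simp add: linear_sum linear_cmul)
    then show ?thesis by (simp only: euclidean_representation)
  qed
  have "Ck_on k U (\<lambda>x. \<Sum>b\<in>Basis. (?Df x v \<bullet> b) *\<^sub>R ?Dg (f x) b)" for v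
  proof (intro Ck_on_sum assms(1) finite_Basis Ck_on_bounded_bilinear[OF _ bounded_bilinear_scaleR])
    fix b :: 'b
    show "Ck_on k U (\<lambda>x. ?Df x v \<bullet> b)"
      by (rule Ck_on_bounded_linear_comp[OF assms(1) bounded_linear_inner_left]) (use Suc.prems in auto)
    show "Ck_on k U (\<lambda>x. ?Dg (f x) b)"
      by (rule Suc.IH[OF Ck_on_SucD[OF Suc.prems(1)]]) (use Suc.prems in auto)
  qed
  then have k: "Ck_on k U (\<lambda>x. ?Dg (f x) (?Df x v))" for v
    by (rule Ck_on_cong[OF assms(1), rotated]) (simp add: eq)
  show ?case by (rule Ck_on_SucI[OF assms(1) D k])
qed

lemma Ck_on_real_SucI:
  fixes f :: "real \<Rightarrow> real"
  assumes "open U" "\<And>x. x \<in> U \<Longrightarrow> (f has_real_derivative f' x) (at x)" "Ck_on k U f'"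
  shows "Ck_on (Suc k) U f"
  by (rule Ck_on_SucI[OF assms(1) has_field_derivative_imp_has_derivative[OF assms(2)]])
    (auto intro!: Ck_on_bounded_bilinear[OF assms(1) bounded_bilinear_mult] Ck_on_const assms(3))

lemma smooth_on_cong: "open U \<Longrightarrow> (\<And>x. x \<in> U \<Longrightarrow> f x = g x) \<Longrightarrow> smooth_on U f \<Longrightarrow> smooth_on U g"
  unfolding smooth_on_def by (metis Ck_on_cong)

lemma smooth_on_subset: "smooth_on U f \<Longrightarrow> V \<subseteq> U \<Longrightarrow> smooth_on V f"
  unfolding smooth_on_def by (metis Ck_on_subset)

lemma smooth_on_differentiable: "smooth_on U f \<Longrightarrow> x \<in> U \<Longrightarrow> f differentiable (at x)"
  unfolding smooth_on_def by (metis Ck_on.simps(2))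

lemma smooth_on_imp_continuous_on: "smooth_on U f \<Longrightarrow> continuous_on U f"
  unfolding smooth_on_def by (metis Ck_on.simps(1))

lemma smooth_on_const [simp]: "smooth_on U (\<lambda>x. c)"
  by (simp add: smooth_on_def Ck_on_const)

lemma smooth_on_id: "open U \<Longrightarrow> smooth_on U (\<lambda>x. x)"
  by (simp add: smooth_on_def Ck_on_id)

lemma smooth_on_bounded_linear:
  "open U \<Longrightarrow> bounded_linear L \<Longrightarrow> smooth_on U f \<Longrightarrow> smooth_on U (\<lambda>x. L (f x))"
  by (simp add: smooth_on_def Ck_on_bounded_linear_comp)

lemma smooth_on_bounded_bilinear:
  "open U \<Longrightarrow> bounded_bilinear h \<Longrightarrow> smooth_on U f \<Longrightarrow> smooth_on U g \<Longrightarrow>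
    smooth_on U (\<lambda>x. h (f x) (g x))"
  by (simp add: smooth_on_def Ck_on_bounded_bilinear)

lemma smooth_on_add:
  "open U \<Longrightarrow> smooth_on U f \<Longrightarrow> smooth_on U g \<Longrightarrow> smooth_on U (\<lambda>x. f x + g x)"
  by (simp add: smooth_on_def Ck_on_add)

lemma smooth_on_minus: "open U \<Longrightarrow> smooth_on U f \<Longrightarrow> smooth_on U (\<lambda>x. - f x)"
  using smooth_on_bounded_linear[OF _ bounded_linear_minus[OF bounded_linear_ident]] .

lemma smooth_on_diff:
  "open U \<Longrightarrow> smooth_on U f \<Longrightarrow> smooth_on U g \<Longrightarrow> smooth_on U (\<lambda>x. f x - g x)"
  using smooth_on_add[OF _ _ smooth_on_minus, of U f g] by simp

lemmas smooth_on_scaleR = smooth_on_bounded_bilinear[OF _ bounded_bilinear_scaleR]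
lemmas smooth_on_inner = smooth_on_bounded_bilinear[OF _ bounded_bilinear_inner]

lemma smooth_on_mult:
  fixes f g :: "'a::real_normed_vector \<Rightarrow> real"
  shows "open U \<Longrightarrow> smooth_on U f \<Longrightarrow> smooth_on U g \<Longrightarrow> smooth_on U (\<lambda>x. f x * g x)"
  using smooth_on_bounded_bilinear[OF _ bounded_bilinear_mult] .

lemmas smooth_on_fst = smooth_on_bounded_linear[OF _ bounded_linear_fst]
lemmas smooth_on_snd = smooth_on_bounded_linear[OF _ bounded_linear_snd]

lemma smooth_on_Pair:
  assumes "open U" "smooth_on U f" "smooth_on U g"
  shows "smooth_on U (\<lambda>x. (f x, g x))"
proof -
  have "bounded_linear (\<lambda>x::'b. (x, 0::'c))" "bounded_linear (\<lambda>x::'c. (0::'b, x))"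
    by (intro bounded_linear_Pair bounded_linear_ident bounded_linear_zero)+
  then have "smooth_on U (\<lambda>x. (f x, 0) + (0, g x))"
    using assms by (intro smooth_on_add smooth_on_bounded_linear[where L="\<lambda>x. (x, 0)"]
        smooth_on_bounded_linear[where L="\<lambda>x. (0, x)"]) auto
  then show ?thesis by simp
qed

lemma smooth_on_compose:
  fixes g :: "'b::euclidean_space \<Rightarrow> 'c::real_normed_vector"
  assumes "open U" "open V" "f ` U \<subseteq> V" "smooth_on U f" "smooth_on V g"
  shows "smooth_on U (\<lambda>x. g (f x))"
  using assms unfolding smooth_on_def by (metis Ck_on_compose)

lemma smooth_on_realI:
  fixes f :: "real \<Rightarrow> real"
  assumes "open U" "\<And>x. x \<in> U \<Longrightarrow> (f has_real_derivative f' x) (at x)" "smooth_on U f'"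
  shows "smooth_on U f"
  using assms Ck_on_real_SucI Ck_on_SucD unfolding smooth_on_def by metis

lemma Ck_on_sin_cos: "Ck_on k UNIV (sin :: real \<Rightarrow> real) \<and> Ck_on k UNIV (cos :: real \<Rightarrow> real)"
proof (induction k)
  case 0
  then show ?case by (auto intro: continuous_intros)
next
  case (Suc k)
  have "Ck_on k UNIV (\<lambda>x::real. - sin x)"
    using Ck_on_bounded_linear_comp[OF open_UNIV bounded_linear_minus[OF bounded_linear_ident]] Suc by blast
  then show ?case
    using Suc by (intro conjI Ck_on_real_SucI[of _ sin cos] Ck_on_real_SucI[of _ cos "\<lambda>x. - sin x"])
      (auto intro!: derivative_eq_intros)
qed

lemma smooth_on_sin: "smooth_on UNIV (sin :: real \<Rightarrow> real)"
  and smooth_on_cos: "smooth_on UNIV (cos :: real \<Rightarrow> real)"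
  using Ck_on_sin_cos by (auto simp: smooth_on_def)

lemma Ck_on_inverse: "Ck_on k (- {0}) (inverse :: real \<Rightarrow> real)"
proof (induction k)
  case 0
  then show ?case by (auto intro!: continuous_intros)
next
  case (Suc k)
  show ?case
  proof (rule Ck_on_real_SucI)
    show "Ck_on k (- {0}) (\<lambda>x::real. - (inverse x * inverse x))"
      by (intro Ck_on_bounded_linear_comp[OF _ bounded_linear_minus[OF bounded_linear_ident]]
          Ck_on_bounded_bilinear[OF _ bounded_bilinear_mult] Suc open_delete[of UNIV, folded Compl_eq_Diff_UNIV]) auto
  qed (auto intro!: derivative_eq_intros simp: open_delete Compl_eq_Diff_UNIV)
qed

lemma smooth_on_inverse:
  fixes f :: "'a::real_normed_vector \<Rightarrow> real"
  assumes "open U" "smooth_on U f" "\<And>x. x \<in> U \<Longrightarrow> f x \<noteq> 0"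
  shows "smooth_on U (\<lambda>x. inverse (f x))"
  by (rule smooth_on_compose[where V="- {0}" and g=inverse])
    (use assms Ck_on_inverse in \<open>auto simp: smooth_on_def open_delete Compl_eq_Diff_UNIV\<close>)

lemma smooth_on_divide:
  fixes f g :: "'a::real_normed_vector \<Rightarrow> real"
  assumes "open U" "smooth_on U f" "smooth_on U g" "\<And>x. x \<in> U \<Longrightarrow> g x \<noteq> 0"
  shows "smooth_on U (\<lambda>x. f x / g x)"
  unfolding divide_inverse by (intro smooth_on_mult smooth_on_inverse assms)

text \<open>If the derivative of \<open>f\<close> is a smooth function of \<open>f\<close>, then each derivative gained
  for \<open>f\<close> yields the next one.\<close>

lemma smooth_on_autonomous:
  fixes f :: "real \<Rightarrow> real"
  assumes "open U" "open V" "f ` U \<subseteq> V" "smooth_on V G"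
    and D: "\<And>x. x \<in> U \<Longrightarrow> (f has_real_derivative G (f x)) (at x)"
  shows "smooth_on U f"
proof -
  have "Ck_on k U f" for k
  proof (induction k)
    case 0
    have "continuous_on U f"
      by (meson D DERIV_isCont continuous_at_imp_continuous_on)
    then show ?case by simp
  next
    case (Suc k)
    have k: "Ck_on k U (\<lambda>x. G (f x))"
      using Ck_on_compose[OF assms(1,2,3) Suc] assms(4) unfolding smooth_on_def by blast
    show ?case by (rule Ck_on_real_SucI[OF assms(1) D k])
  qed
  then show ?thesis by (simp add: smooth_on_def)
qed

lemma smooth_on_sqrt:
  fixes f :: "'a::real_normed_vector \<Rightarrow> real"
  assumes "open U" "smooth_on U f" "\<And>x. x \<in> U \<Longrightarrow> f x > 0"
  shows "smooth_on U (\<lambda>x. sqrt (f x))"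
proof (rule smooth_on_compose[where V="{0<..}" and g=sqrt])
  \<comment> \<open>The square root solves \<open>y' = 1 / (2 y)\<close> with values in the positive
    half line, so its smoothness follows by bootstrapping.\<close>
  have "smooth_on {0<..} (\<lambda>y::real. inverse y * (1 / 2))"
    by (intro smooth_on_mult smooth_on_inverse smooth_on_id) auto
  then show "smooth_on {0<..} sqrt"
    by (rule smooth_on_autonomous[where V="{0<..}", rotated 3])
      (auto intro!: derivative_eq_intros simp: field_simps)
qed (use assms in auto)

lemma smooth_on_norm:
  fixes f :: "'a::real_normed_vector \<Rightarrow> 'b::euclidean_space"
  assumes "open U" "smooth_on U f" "\<And>x. x \<in> U \<Longrightarrow> f x \<noteq> 0"
  shows "smooth_on U (\<lambda>x. norm (f x))"
  unfolding norm_eq_sqrt_inner using assms by (intro smooth_on_sqrt smooth_on_inner) auto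

lemma smooth_on_arctan: "smooth_on UNIV arctan"
proof (rule smooth_on_realI[OF open_UNIV DERIV_arctan])
  show "smooth_on UNIV (\<lambda>x::real. inverse (1 + x\<^sup>2))"
    unfolding power2_eq_square
    by (intro smooth_on_inverse smooth_on_add smooth_on_mult smooth_on_id)
      (auto, metis add_cancel_right_right add_nonneg_eq_0_iff zero_le_square zero_neq_one zero_le_one)
qed

lemmas smooth_intros = smooth_on_const smooth_on_id smooth_on_add smooth_on_minus smooth_on_diff
  smooth_on_mult smooth_on_divide smooth_on_inverse smooth_on_Pair smooth_on_fst smooth_on_snd smooth_on_inner
  smooth_on_scaleR smooth_on_norm

section \<open>Ordinary differential equations with a bounded Lipschitz right-hand side\<close>

lemma integral_has_vector_derivative_atLeast:
  fixes g :: "real \<Rightarrow> 'a::euclidean_space"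
  assumes "continuous_on UNIV g" "0 \<le> t"
  shows "((\<lambda>t. integral {0..t} g) has_vector_derivative g t) (at t within {0..})"
proof -
  have "((\<lambda>t. integral {0..t} g) has_vector_derivative g t) (at t within {0..t+1})"
    using assms by (intro integral_has_vector_derivative continuous_on_subset[OF assms(1)]) auto
  moreover have "at t within {0..t+1} = at t within {0..}"
    by (rule at_within_nhd[where S="{..<t+1}"]) (use assms(2) in auto)
  ultimately show ?thesis by simp
qed

text \<open>Picard iteration is a contraction of factor one half for the supremum norm weighted by
  \<open>exp (- 2 * K * t)\<close>, on the whole half line at once.\<close>

lemma ode_forward_solution:
  fixes f :: "'a::euclidean_space \<Rightarrow> 'a"
  assumes lip: "\<And>x y. norm (f x - f y) \<le> K * norm (x - y)" and bdd: "\<And>x. norm (f x) \<le> M"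
    and K: "K > 0"
  shows "\<exists>X. X 0 = x0 \<and> (\<forall>t\<ge>0. (X has_vector_derivative f (X t)) (at t within {0..}))"
proof -
  have contf: "continuous_on UNIV f"
    by (rule lipschitz_on_continuous_on[where L=K]) (use lip K in \<open>auto intro!: lipschitz_onI simp: dist_norm\<close>)
  \<comment> \<open>The unknown \<open>u\<close> of the fixed point problem is \<open>X - x0\<close>
    scaled by \<open>exp (- 2 * K * t)\<close>, so that the weighted norm becomes the ordinary
    supremum norm. The \<open>max 0 t\<close> in \<open>R\<close> extends it constantly to negative
    times, since bounded continuous functions live on the whole line.\<close>
  define g where "g u s = f (x0 + exp (2 * K * s) *\<^sub>R apply_bcontfun u s)" for u s
  define J where "J u t = integral {0..t} (g u)" for u t
  define R where "R u t = exp (- (2 * K * max 0 t)) *\<^sub>R J u (max 0 t)" for u t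
  have contg: "continuous_on S (g u)" for S u
    unfolding g_def by (intro continuous_on_compose2[OF contf] continuous_intros) auto
  have intg: "(\<lambda>s. g u s) integrable_on {0..t}" for u t
    by (rule integrable_continuous_real[OF contg])
  have J': "(J u has_vector_derivative g u t) (at t within {0..})" if "0 \<le> t" for u t
    unfolding J_def by (rule integral_has_vector_derivative_atLeast[OF contg that])
  have contJ: "continuous_on {0..} (J u)" for u
    by (auto simp: continuous_on_eq_continuous_within intro!: has_vector_derivative_continuous J')
  have contR: "continuous_on UNIV (R u)" for u
    unfolding R_def by (intro continuous_intros continuous_on_compose2[OF contJ]) auto
  have normJ: "norm (J u t) \<le> M * t" if "0 \<le> t" for u t
  proof -
    have "norm (J u t) \<le> integral {0..t} (\<lambda>s. M)"
      unfolding J_def by (rule integral_norm_bound_integral[OF intg]) (auto simp: g_def bdd)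
    then show ?thesis using that by (simp add: mult.commute)
  qed
  have M0: "0 \<le> M" using norm_ge_zero bdd order_trans by blast
  have normR: "norm (R u t) \<le> M / (2 * K)" for u t
  proof -
    let ?s = "max 0 t"
    have "2 * K * ?s \<le> exp (2 * K * ?s)"
      using exp_ge_add_one_self[of "2 * K * ?s"] by linarith
    then have le1: "exp (- (2 * K * ?s)) * (2 * K * ?s) \<le> 1"
      by (simp add: exp_minus field_simps)
    have "norm (R u t) \<le> exp (- (2 * K * ?s)) * (M * ?s)"
      unfolding R_def using normJ[of ?s u] by simp
    also have "\<dots> = M / (2 * K) * (exp (- (2 * K * ?s)) * (2 * K * ?s))"
      using K by (simp add: field_simps)
    also have "\<dots> \<le> M / (2 * K) * 1"
      by (rule mult_left_mono[OF le1]) (use K M0 in auto)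
    finally show ?thesis by simp
  qed
  have inR: "R u \<in> bcontfun" for u
    by (rule bcontfun_normI[OF contR normR])
  have diffR: "norm (R u t - R v t) \<le> (1 / 2) * dist u v" for u v t
  proof -
    let ?s = "max 0 t" and ?d = "dist u v"
    \<comment> \<open>Integrating the weight produces a factor \<open>1 / (2 * K)\<close>, which
      turns the Lipschitz constant \<open>K\<close> into the contraction factor one half.\<close>
    have I: "((\<lambda>s. K * exp (2 * K * s) * ?d) has_integral
        (exp (2 * K * ?s) / 2 * ?d - exp (2 * K * 0) / 2 * ?d)) {0..?s}"
      by (rule fundamental_theorem_of_calculus)
        (auto intro!: derivative_eq_intros simp: has_real_derivative_iff_has_vector_derivative[symmetric])
    have "norm (J u ?s - J v ?s) = norm (integral {0..?s} (\<lambda>s. g u s - g v s))"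
      unfolding J_def by (simp add: integral_diff[OF intg intg])
    also have "\<dots> \<le> integral {0..?s} (\<lambda>s. K * exp (2 * K * s) * ?d)"
    proof (rule integral_norm_bound_integral)
      fix s
      have "norm (g u s - g v s) \<le> K * norm (exp (2 * K * s) *\<^sub>R (apply_bcontfun u s - apply_bcontfun v s))"
        unfolding g_def using lip[of "x0 + exp (2 * K * s) *\<^sub>R apply_bcontfun u s"
            "x0 + exp (2 * K * s) *\<^sub>R apply_bcontfun v s"] by (simp add: algebra_simps)
      also have "\<dots> \<le> K * exp (2 * K * s) * ?d"
        using K dist_bounded[of u s v] by (simp add: dist_norm)
      finally show "norm (g u s - g v s) \<le> K * exp (2 * K * s) * ?d" .
    qed (auto intro: integrable_diff intg has_integral_integrable[OF I])
    also have "\<dots> \<le> exp (2 * K * ?s) * (1 / 2 * ?d)"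
      unfolding integral_unique[OF I] by simp
    finally have le: "norm (J u ?s - J v ?s) \<le> exp (2 * K * ?s) * (1 / 2 * ?d)" .
    have "norm (R u t - R v t) = exp (- (2 * K * ?s)) * norm (J u ?s - J v ?s)"
      unfolding R_def by (simp flip: scaleR_diff_right)
    also have "\<dots> \<le> exp (- (2 * K * ?s)) * (exp (2 * K * ?s) * (1 / 2 * ?d))"
      by (rule mult_left_mono[OF le]) simp
    also have "\<dots> = 1 / 2 * ?d" by (simp add: exp_minus)
    finally show ?thesis .
  qed
  have "\<exists>!u. Bcontfun (R u) = u"
  proof (rule banach_fix_type[where c="1/2"])
    show "\<forall>u v. dist (Bcontfun (R u)) (Bcontfun (R v)) \<le> 1 / 2 * dist u v"
      using diffR by (intro allI dist_bound) (simp add: Bcontfun_inverse[OF inR] dist_norm[of "R _ _"])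
  qed auto
  then obtain u where "Bcontfun (R u) = u" by blast
  then have u: "apply_bcontfun u = R u" using Bcontfun_inverse[OF inR] by metis
  define X where "X t = x0 + J u t" for t
  have g: "g u t = f (X t)" if "0 \<le> t" for t
    using that by (simp add: g_def u R_def X_def exp_minus)
  have "(X has_vector_derivative f (X t)) (at t within {0..})" if "0 \<le> t" for t
    unfolding X_def[abs_def] using J'[OF that, of u] g[OF that]
    by (auto intro!: derivative_eq_intros simp: X_def)
  moreover have "X 0 = x0" by (simp add: X_def J_def)
  ultimately show ?thesis by blast
qed

text \<open>Backward solutions are forward solutions for \<open>- f\<close> run in reverse. The two
  halves have the same value and the same derivative at \<open>0\<close>, so the glued function
  solves the equation there too.\<close>

lemma ode_global_solution:
  fixes f :: "'a::euclidean_space \<Rightarrow> 'a"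
  assumes lip: "\<And>x y. norm (f x - f y) \<le> K * norm (x - y)" and bdd: "\<And>x. norm (f x) \<le> M"
    and K: "K > 0"
  shows "\<exists>X. X 0 = x0 \<and> (\<forall>t. (X has_vector_derivative f (X t)) (at t))"
proof -
  obtain X1 where X1: "X1 0 = x0" "\<And>t. 0 \<le> t \<Longrightarrow> (X1 has_vector_derivative f (X1 t)) (at t within {0..})"
    using ode_forward_solution[of f, OF assms] by blast
  obtain X2 where X2: "X2 0 = x0" "\<And>t. 0 \<le> t \<Longrightarrow> (X2 has_vector_derivative - f (X2 t)) (at t within {0..})"
    using ode_forward_solution[of "\<lambda>x. - f x" K M x0] lip bdd K
    by (auto simp: norm_minus_commute)
  have X2m: "((\<lambda>t. X2 (- t)) has_vector_derivative f (X2 (- t))) (at t within {..0})" if "t \<le> 0" for t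
  proof -
    have "(X2 \<circ> (\<lambda>t. - t) has_vector_derivative (- 1) *\<^sub>R (- f (X2 (- t)))) (at t within {..0})"
      by (rule vector_diff_chain_within)
        (use X2(2)[of "- t"] that in \<open>auto intro!: derivative_eq_intros\<close>)
    then show ?thesis by (simp add: o_def)
  qed
  define X where "X t = (if t \<in> {0..} then X1 t else X2 (- t))" for t
  have "(X has_vector_derivative (if t \<in> {0..} then f (X1 t) else f (X2 (- t)))) (at t within UNIV)" for t
    unfolding X_def[abs_def]
  proof (rule has_vector_derivative_If_within_closures[where T="{..<0}"])
    have eq: "{0..} \<union> closure {0..} \<inter> closure {..<0} = {0::real..}"
      "{..<0} \<union> closure {0..} \<inter> closure {..<0} = {..0::real}" by auto
    show "t \<in> {0..} \<union> closure {0..} \<inter> closure {..<0} \<Longrightarrow>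
        (X1 has_vector_derivative f (X1 t)) (at t within {0..} \<union> closure {0..} \<inter> closure {..<0})"
      unfolding eq using X1 by auto
    show "t \<in> {..<0} \<union> closure {0..} \<inter> closure {..<0} \<Longrightarrow>
        ((\<lambda>t. X2 (- t)) has_vector_derivative f (X2 (- t))) (at t within {..<0} \<union> closure {0..} \<inter> closure {..<0})"
      unfolding eq using X2m by auto
  qed (auto simp: X1 X2)
  moreover have "(if t \<in> {0..} then f (X1 t) else f (X2 (- t))) = f (X t)" for t
    by (simp add: X_def)
  ultimately have "(X has_vector_derivative f (X t)) (at t)" for t by simp
  then show ?thesis using X1(1) by (intro exI[of _ X]) (auto simp: X_def)
qed

text \<open>The Lipschitz bound makes \<open>exp (- (2 * K * t))\<close> times the squared distance
  of the solutions nonincreasing. Squaring avoids differentiating the norm at zero.\<close>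

lemma ode_gronwall:
  fixes f :: "'a::euclidean_space \<Rightarrow> 'a"
  assumes lip: "\<And>x y. norm (f x - f y) \<le> K * norm (x - y)"
    and X: "\<And>t. (X has_vector_derivative f (X t)) (at t)"
    and Y: "\<And>t. (Y has_vector_derivative f (Y t)) (at t)"
    and t: "0 \<le> t"
  shows "norm (X t - Y t) \<le> exp (K * t) * norm (X 0 - Y 0)"
proof -
  define Z where "Z s = X s - Y s" for s
  define g where "g s = exp (- (2 * K * s)) * (Z s \<bullet> Z s)" for s
  define g' where "g' s = exp (- (2 * K * s)) * (2 * (Z s \<bullet> (f (X s) - f (Y s))) - 2 * K * (Z s \<bullet> Z s))" for s
  have Z': "(Z has_derivative (\<lambda>h. h *\<^sub>R (f (X s) - f (Y s)))) (at s)" for s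
    unfolding Z_def[abs_def] using has_vector_derivative_diff[OF X Y] by (simp add: has_vector_derivative_def)
  have "(g has_real_derivative g' s) (at s)" for s
    unfolding g_def[abs_def] g'_def has_field_derivative_def
    by (rule derivative_eq_intros Z' refl)+ (auto simp: fun_eq_iff algebra_simps inner_commute)
  moreover have "g' s \<le> 0" for s
  proof -
    have "Z s \<bullet> (f (X s) - f (Y s)) \<le> norm (Z s) * norm (f (X s) - f (Y s))"
      by (rule norm_cauchy_schwarz)
    also have "\<dots> \<le> norm (Z s) * (K * norm (Z s))"
      unfolding Z_def by (rule mult_left_mono[OF lip]) simp
    also have "\<dots> = K * (Z s \<bullet> Z s)"
      by (simp add: dot_square_norm power2_eq_square)
    finally show ?thesis unfolding g'_def by (simp add: mult_le_0_iff)
  qed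
  ultimately have "g t \<le> g 0"
    using DERIV_nonpos_imp_nonincreasing[OF t, of g] by blast
  then have "Z t \<bullet> Z t \<le> exp (2 * K * t) * (Z 0 \<bullet> Z 0)"
    by (simp add: g_def exp_minus field_simps)
  also have "\<dots> = (exp (K * t) * norm (Z 0))\<^sup>2"
    by (simp add: power_mult_distrib dot_square_norm flip: exp_double mult.assoc)
  finally have "(norm (Z t))\<^sup>2 \<le> (exp (K * t) * norm (Z 0))\<^sup>2"
    by (simp add: dot_square_norm)
  then show ?thesis unfolding Z_def by (rule power2_le_imp_le) auto
qed

lemma has_vector_derivative_reflect:
  assumes "\<And>t. (X has_vector_derivative X' t) (at t)"
  shows "((\<lambda>t. X (c - t)) has_vector_derivative - X' (c - t)) (at t)"
proof -
  have "(X \<circ> (\<lambda>t. c - t) has_vector_derivative (- 1) *\<^sub>R X' (c - t)) (at t)"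
    by (rule vector_diff_chain_at) (auto intro!: derivative_eq_intros assms)
  then show ?thesis by (simp add: o_def)
qed

text \<open>Gronwall's bound with initial distance zero, after moving the time origin to
  \<open>t0\<close>; earlier times are covered by the reversed solutions of the equation for
  \<open>- f\<close>.\<close>

lemma ode_unique:
  fixes f :: "'a::euclidean_space \<Rightarrow> 'a"
  assumes lip: "\<And>x y. norm (f x - f y) \<le> K * norm (x - y)"
    and X: "\<And>t. (X has_vector_derivative f (X t)) (at t)"
    and Y: "\<And>t. (Y has_vector_derivative f (Y t)) (at t)"
    and eq: "X t0 = Y t0"
  shows "X = Y"
proof
  fix t
  have *: "X (t0 + s) = Y (t0 + s)" if "0 \<le> s" for s
  proof -
    have "((\<lambda>s. Z (t0 + s)) has_vector_derivative f (Z (t0 + s))) (at s)"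
      if "\<And>t. (Z has_vector_derivative f (Z t)) (at t)" for Z :: "real \<Rightarrow> 'a" and s
    proof -
      have "((\<lambda>s. t0 + s) has_vector_derivative 1) (at s)"
        by (auto intro!: derivative_eq_intros)
      from vector_diff_chain_at[OF this that[of "t0 + s"]] show ?thesis by (simp add: o_def)
    qed
    from ode_gronwall[OF lip this[OF X] this[OF Y] that] eq show ?thesis by simp
  qed
  have **: "X (t0 - s) = Y (t0 - s)" if "0 \<le> s" for s
  proof -
    have "norm (- f x - - f y) \<le> K * norm (x - y)" for x y
      using lip[of x y] by (simp add: norm_minus_commute)
    from ode_gronwall[where f="\<lambda>x. - f x", OF this has_vector_derivative_reflect[where c=t0, OF X]
        has_vector_derivative_reflect[where c=t0, OF Y] that] eq
    show ?thesis by simp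
  qed
  show "X t = Y t"
    using *[of "t - t0"] **[of "t0 - t"] by (cases "t0 \<le> t") auto
qed

section \<open>Bounded Lipschitz functions and symmetric cut-offs\<close>

definition bounded_lipschitz :: "('a::real_normed_vector \<Rightarrow> 'b::real_normed_vector) \<Rightarrow> bool" where
  "bounded_lipschitz f \<longleftrightarrow>
     (\<exists>B\<ge>0. (\<forall>x. norm (f x) \<le> B) \<and> (\<forall>x y. norm (f x - f y) \<le> B * norm (x - y)))"

lemma bounded_lipschitzI:
  assumes "\<And>x. norm (f x) \<le> B" "\<And>x y. norm (f x - f y) \<le> C * norm (x - y)"
  shows "bounded_lipschitz f"
proof -
  have "B \<ge> 0" using assms(1) norm_ge_zero order_trans by blast
  moreover have "norm (f x - f y) \<le> max B C * norm (x - y)" for x y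
    using assms(2)[of x y] mult_right_mono[of C "max B C" "norm (x - y)"] by auto
  ultimately show ?thesis
    unfolding bounded_lipschitz_def using assms(1)
    by (intro exI[of _ "max B C"]) (auto simp: le_max_iff_disj)
qed

lemma bounded_lipschitz_const: "bounded_lipschitz (\<lambda>x. c)"
  by (rule bounded_lipschitzI[where B="norm c" and C=0]) auto

lemma bounded_lipschitz_add:
  assumes "bounded_lipschitz f" "bounded_lipschitz g"
  shows "bounded_lipschitz (\<lambda>x. f x + g x)"
proof -
  obtain B C where B: "\<And>x. norm (f x) \<le> B" "\<And>x y. norm (f x - f y) \<le> B * norm (x - y)"
    and C: "\<And>x. norm (g x) \<le> C" "\<And>x y. norm (g x - g y) \<le> C * norm (x - y)"
    using assms unfolding bounded_lipschitz_def by metis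
  show ?thesis
  proof (rule bounded_lipschitzI[where B="B + C" and C="B + C"])
    show "norm (f x + g x) \<le> B + C" for x using B C by (metis add_mono norm_triangle_le)
    have "norm (f x + g x - (f y + g y)) \<le> norm (f x - f y) + norm (g x - g y)" for x y
      by (rule norm_diff_triangle_ineq)
    then show "norm (f x + g x - (f y + g y)) \<le> (B + C) * norm (x - y)" for x y
      using B(2)[of x y] C(2)[of x y] by (smt (verit) distrib_right)
  qed
qed

text \<open>A product is Lipschitz because each factor is bounded as well; this is why the two
  properties are carried together.\<close>

lemma bounded_lipschitz_mult:
  fixes f g :: "'a::real_normed_vector \<Rightarrow> real"
  assumes "bounded_lipschitz f" "bounded_lipschitz g"
  shows "bounded_lipschitz (\<lambda>x. f x * g x)"
proof -
  obtain B C where B: "B \<ge> 0" "\<And>x. \<bar>f x\<bar> \<le> B" "\<And>x y. \<bar>f x - f y\<bar> \<le> B * norm (x - y)"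
    and C: "C \<ge> 0" "\<And>x. \<bar>g x\<bar> \<le> C" "\<And>x y. \<bar>g x - g y\<bar> \<le> C * norm (x - y)"
    using assms unfolding bounded_lipschitz_def by (metis real_norm_def)
  show ?thesis
  proof (rule bounded_lipschitzI[where B="B * C" and C="B * C + B * C"])
    show "norm (f x * g x) \<le> B * C" for x
      using B C by (auto simp: abs_mult intro!: mult_mono)
    show "norm (f x * g x - f y * g y) \<le> (B * C + B * C) * norm (x - y)" for x y
    proof -
      have "f x * g x - f y * g y = f x * (g x - g y) + g y * (f x - f y)" by (simp add: algebra_simps)
      then have "\<bar>f x * g x - f y * g y\<bar> \<le> \<bar>f x\<bar> * \<bar>g x - g y\<bar> + \<bar>g y\<bar> * \<bar>f x - f y\<bar>"
        by (metis abs_mult abs_triangle_ineq)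
      also have "\<dots> \<le> B * (C * norm (x - y)) + C * (B * norm (x - y))"
        by (intro add_mono mult_mono B C) (auto simp: B C)
      finally show ?thesis by (simp add: algebra_simps)
    qed
  qed
qed

lemma bounded_lipschitz_Pair:
  assumes "bounded_lipschitz f" "bounded_lipschitz g"
  shows "bounded_lipschitz (\<lambda>x. (f x, g x))"
proof -
  obtain B C where B: "\<And>x. norm (f x) \<le> B" "\<And>x y. norm (f x - f y) \<le> B * norm (x - y)"
    and C: "\<And>x. norm (g x) \<le> C" "\<And>x y. norm (g x - g y) \<le> C * norm (x - y)"
    using assms unfolding bounded_lipschitz_def by metis
  show ?thesis
  proof (rule bounded_lipschitzI[where B="B + C" and C="B + C"])
    have le: "norm (u, v) \<le> norm u + norm v" for u :: 'b and v :: 'c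
      unfolding norm_Pair by (rule sqrt_sum_squares_le_sum) auto
    show "norm (f x, g x) \<le> B + C" for x using B C le[of "f x" "g x"] by (smt (verit))
    show "norm ((f x, g x) - (f y, g y)) \<le> (B + C) * norm (x - y)" for x y
      using B(2)[of x y] C(2)[of x y] le[of "f x - f y" "g x - g y"] by (auto simp: algebra_simps)
  qed
qed

lemma bounded_lipschitz_compose:
  assumes "bounded_lipschitz f" "\<And>x y. norm (p x - p y) \<le> norm (x - y)"
  shows "bounded_lipschitz (\<lambda>x. f (p x))"
proof -
  obtain B where B: "B \<ge> 0" "\<And>x. norm (f x) \<le> B" "\<And>x y. norm (f x - f y) \<le> B * norm (x - y)"
    using assms unfolding bounded_lipschitz_def by metis
  show ?thesis
    by (rule bounded_lipschitzI[where B=B and C=B])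
      (use B assms(2) in \<open>auto intro: order_trans[OF B(3) mult_left_mono]\<close>)
qed

text \<open>The interval is symmetric so that the cut-off is odd and commutes with the reflections
  of the profile equation.\<close>

definition clamp_abs :: "real \<Rightarrow> real \<Rightarrow> real" where
  "clamp_abs c x = max (- c) (min c x)"

lemma clamp_abs_eq: "\<bar>x\<bar> \<le> c \<Longrightarrow> clamp_abs c x = x"
  by (auto simp: clamp_abs_def)

lemma clamp_abs_minus: "0 \<le> c \<Longrightarrow> clamp_abs c (- x) = - clamp_abs c x"
  by (auto simp: clamp_abs_def max_def min_def)

lemma abs_clamp_abs_le: "0 \<le> c \<Longrightarrow> \<bar>clamp_abs c x\<bar> \<le> c"
  by (auto simp: clamp_abs_def)

lemma bounded_lipschitz_clamp:
  fixes g g' :: "real \<Rightarrow> real"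
  assumes c: "0 \<le> c" and D: "\<And>x. \<bar>x\<bar> \<le> c \<Longrightarrow> (g has_real_derivative g' x) (at x)"
    and cont: "continuous_on {-c..c} g'"
  shows "bounded_lipschitz (\<lambda>x. g (clamp_abs c x))"
proof -
  have "continuous_on {-c..c} g"
    by (rule DERIV_continuous_on[where D=g']) (auto intro!: has_field_derivative_at_within D)
  then have "bounded (g' ` {-c..c})" "bounded (g ` {-c..c})"
    using cont by (auto intro!: compact_imp_bounded compact_continuous_image)
  then obtain B C where B: "\<And>x. x \<in> {-c..c} \<Longrightarrow> norm (g' x) \<le> B" and C: "\<And>x. x \<in> {-c..c} \<Longrightarrow> norm (g x) \<le> C"
    unfolding bounded_iff by (metis imageI)
  have mem: "clamp_abs c x \<in> {-c..c}" for x using abs_clamp_abs_le[OF c, of x] by auto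
  have "B \<ge> 0" using B[of 0] c by auto
  show ?thesis
  proof (rule bounded_lipschitzI)
    show "norm (g (clamp_abs c x)) \<le> C" for x using C mem by blast
    fix x y
    have "norm (g (clamp_abs c x) - g (clamp_abs c y)) \<le> B * norm (clamp_abs c x - clamp_abs c y)"
      by (rule field_differentiable_bound[where S="{-c..c}" and f'=g'])
        (use B D mem in \<open>auto intro: has_field_derivative_at_within\<close>)
    also have "\<dots> \<le> B * norm (x - y)"
      by (rule mult_left_mono) (use \<open>B \<ge> 0\<close> in \<open>auto simp: clamp_abs_def\<close>)
    finally show "norm (g (clamp_abs c x) - g (clamp_abs c y)) \<le> B * norm (x - y)" .
  qed
qed

section \<open>Trajectories of the profile equation\<close>

lemma nonneg_deriv_mono_on:
  fixes f :: "real \<Rightarrow> real"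
  assumes "a \<le> b" "\<And>x. a \<le> x \<Longrightarrow> x \<le> b \<Longrightarrow> (f has_real_derivative f' x) (at x)"
    and "\<And>x. a \<le> x \<Longrightarrow> x \<le> b \<Longrightarrow> 0 \<le> f' x"
  shows "f a \<le> f b"
  by (rule DERIV_nonneg_imp_nondecreasing[OF assms(1)]) (meson assms(2,3))

lemma pos_deriv_strict_mono_on:
  fixes f :: "real \<Rightarrow> real"
  assumes "a < b" "\<And>x. a \<le> x \<Longrightarrow> x \<le> b \<Longrightarrow> (f has_real_derivative f' x) (at x)"
    and "\<And>x. a < x \<Longrightarrow> x < b \<Longrightarrow> 0 < f' x"
  shows "f a < f b"
proof (rule DERIV_pos_imp_increasing_open[OF assms(1)])
  show "continuous_on {a..b} f"
    by (rule DERIV_continuous_on[where D=f'], rule has_field_derivative_at_within, rule assms(2)) auto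
  show "\<exists>y. (f has_real_derivative y) (at x) \<and> 0 < y" if "a < x" "x < b" for x
    using assms(2)[of x] assms(3)[OF that] that by auto
qed

lemma cos_pos_of_abs_less: "\<bar>x\<bar> < pi / 2 \<Longrightarrow> 0 < cos x"
  by (intro cos_gt_zero_pi) auto

lemma abs_le_pi_quarter:
  assumes "\<bar>x\<bar> \<le> pi / 4"
  shows "1 / 2 \<le> (cos x)\<^sup>2" "0 < cos x" "1 / 2 \<le> cos x"
proof -
  have "cos (pi / 4) \<le> cos \<bar>x\<bar>"
    using assms by (intro cos_monotone_0_pi_le) auto
  then have c: "sqrt 2 / 2 \<le> cos x" by (simp add: cos_45)
  then have "(sqrt 2 / 2)\<^sup>2 \<le> (cos x)\<^sup>2" by (intro power_mono) auto
  then show "1 / 2 \<le> (cos x)\<^sup>2" by (simp add: power_divide)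
  have "1 \<le> sqrt 2" by simp
  with c show "0 < cos x" "1 / 2 \<le> cos x" by linarith+
qed

text \<open>Here \<open>c\<close>, \<open>z\<close> stand for cosine and sine of
  \<open>\<phi>\<close>, \<open>s\<close>, \<open>t\<close> for sine and cosine of
  \<open>\<alpha>\<close>, and \<open>T\<close> for \<open>tan \<psi>\<close>. The first summand
  comes from differentiating the weight, the second from differentiating
  \<open>cos \<phi> cos \<alpha>\<close> along the profile equation.\<close>

lemma flux_height_algebra:
  fixes c s t :: real
  assumes "c \<noteq> 0" "s\<^sup>2 + t\<^sup>2 = 1"
  shows "2 * M * (T * s - z * t) / c * (c * t)
    + (- z * t * t - c * s * ((2 * M + 1) * (z / c) * s + 2 * M * T * t / c)) = - (2 * M + 1) * z"
proof -
  have "2 * M * (T * s - z * t) / c * (c * t)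
      + (- z * t * t - c * s * ((2 * M + 1) * (z / c) * s + 2 * M * T * t / c)) =
    - (2 * M + 1) * z * (s\<^sup>2 + t\<^sup>2)"
    using assms(1) by (simp add: field_simps power2_eq_square)
  with assms(2) show ?thesis by simp
qed

lemma flux_angular_algebra:
  fixes c s t :: real
  assumes "c \<noteq> 0" "s\<^sup>2 + t\<^sup>2 = 1"
  shows "2 * M * (T * s - z * t) / c * (c * s)
    + (- z * t * s + c * t * ((2 * M + 1) * (z / c) * s + 2 * M * T * t / c)) = 2 * M * T"
proof -
  have "2 * M * (T * s - z * t) / c * (c * s)
      + (- z * t * s + c * t * ((2 * M + 1) * (z / c) * s + 2 * M * T * t / c)) =
    2 * M * T * (s\<^sup>2 + t\<^sup>2)"
    using assms(1) by (simp add: field_simps power2_eq_square)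
  with assms(2) show ?thesis by simp
qed

text \<open>Here \<open>A\<close> stands for \<open>\<alpha>'\<close>, \<open>k\<close> for \<open>(ln W)'\<close>, \<open>p, q\<close> for sine and cosine of \<open>\<psi> / 2\<close>, and the
  two bracketed terms of the conclusion are \<open>D''\<close> and \<open>f''\<close> for \<open>D = cos \<phi> sin (\<psi> / 2)\<close> and
  \<open>f = 1 - C sin\<^sup>2 \<phi>\<close>.\<close>

lemma sturm_algebra:
  fixes M c z s t p q :: real
  assumes M: "0 \<le> M" and c: "0 < c" and cz: "c\<^sup>2 + z\<^sup>2 = 1" and st: "s\<^sup>2 + t\<^sup>2 = 1"
    and pq: "p\<^sup>2 + q\<^sup>2 = 1" and p: "0 \<le> p" and X: "X = q\<^sup>2 - p\<^sup>2" "0 < X"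
    and T: "T = 2 * p * q / X" and C: "C = (4 * M + 1) / 2"
    and f: "f = 1 - C * z\<^sup>2" "0 \<le> f"
    and A: "A = (2 * M + 1) * (z / c) * s + 2 * M * T * t / c"
    and k: "k = 2 * M * (T * s - z * t) / c"
  shows "k * ((- z * t * p - q * s) * f - c * p * (- 2 * C * z * (c * t))) +
    ((- (c * t * t * p) + z * s * A * p + z * t * q * (s / c) - p * s * (s / c) - q * t * A) * f
      - c * p * (- 2 * C * ((c * t)\<^sup>2 + z * (- z * t * t - c * s * A)))) \<le> 0" (is "?L \<le> 0")
proof -
  let ?D1 = "- z * t * p - q * s"
  let ?D2 = "- (c * t * t * p) + z * s * A * p + z * t * q * (s / c) - p * s * (s / c) - q * t * A"
  have X1: "1 - X = 2 * p\<^sup>2" using X pq by simp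
  have q: "q\<^sup>2 = 1 - p\<^sup>2" using pq by simp
  \<comment> \<open>With \<open>T = tan \<psi>\<close> written in half angles, this is where the
    singular coefficient \<open>2 m / (cos\<^sup>2 \<phi> cos \<psi>)\<close> in the equation for
    \<open>D\<close> arises.\<close>
  have zT: "z * z * p - T * q = - p / X - c\<^sup>2 * p"
  proof -
    have "(z * z * p - T * q) * X = (1 - c\<^sup>2) * p * X - 2 * p * q\<^sup>2"
    proof -
      have zz: "z * z = 1 - c\<^sup>2" using cz by (simp add: power2_eq_square)
      show ?thesis using X(2) unfolding T zz by (simp add: field_simps power2_eq_square)
    qed
    also have "\<dots> = - p - c\<^sup>2 * p * X"
      unfolding X(1) q by (simp add: algebra_simps power2_eq_square)
    finally show ?thesis using X(2) by (simp add: field_simps)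
  qed
  have TX: "(z * z * p - T * q) / c = - (c * p) * (1 / (c\<^sup>2 * X) + 1)"
    unfolding zT using c X(2) by (simp add: field_simps power2_eq_square)
  have "?D2 + k * ?D1 = - (c * p) * t\<^sup>2 - s\<^sup>2 * p * (1 - z\<^sup>2) / c
      + 2 * M * ((z * z * p - T * q) / c) * (s\<^sup>2 + t\<^sup>2)"
    using c unfolding A k by (simp add: field_simps power2_eq_square)
  also have "1 - z\<^sup>2 = c\<^sup>2" using cz by simp
  also have "- (c * p) * t\<^sup>2 - s\<^sup>2 * p * c\<^sup>2 / c = - (c * p) * (s\<^sup>2 + t\<^sup>2)"
    using c by (simp add: field_simps power2_eq_square)
  finally have D2: "?D2 + k * ?D1 = - (c * p) * (2 * M * (1 / (c\<^sup>2 * X) + 1) + 1)"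
    unfolding TX st by (simp add: algebra_simps)
  have z2: "- z * t * t - c * s * A + k * (c * t) = - (2 * M + 1) * z"
    using flux_height_algebra[of c s t M T z] c st unfolding A k by (simp add: algebra_simps)
  have "?L = (?D2 + k * ?D1) * f + 2 * C * (c * p) * ((c * t)\<^sup>2 + z * (- z * t * t - c * s * A + k * (c * t)))"
    by (simp add: algebra_simps power2_eq_square)
  also have "\<dots> = - (c * p) * ((2 * M * (1 / (c\<^sup>2 * X) + 1) + 1) * f - 2 * C * (c * t)\<^sup>2 + 2 * C * (2 * M + 1) * z\<^sup>2)"
    unfolding D2 z2 by (simp add: algebra_simps power2_eq_square)
  finally have L: "?L = - (c * p) * ((2 * M * (1 / (c\<^sup>2 * X) + 1) + 1) * f - 2 * C * (c * t)\<^sup>2 + 2 * C * (2 * M + 1) * z\<^sup>2)" .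
  have "c\<^sup>2 * X \<le> 1 * 1"
    by (rule mult_mono) (use cz X1 X in \<open>auto simp: sum_power2_le_zero_iff intro: order_trans[of _ "c\<^sup>2 + z\<^sup>2"]\<close>, (smt (verit) zero_le_power2)+)
  then have "1 \<le> 1 / (c\<^sup>2 * X)" using c X by simp
  then have "2 * M * (1 + 1) \<le> 2 * M * (1 / (c\<^sup>2 * X) + 1)" by (intro mult_left_mono) (use M in auto)
  then have "(4 * M + 1) * f \<le> (2 * M * (1 / (c\<^sup>2 * X) + 1) + 1) * f"
    by (intro mult_right_mono f(2)) simp
  moreover have "2 * C * (c * t)\<^sup>2 \<le> 2 * C * (1 - z\<^sup>2)"
  proof -
    have "t\<^sup>2 \<le> 1" using st by (smt (verit) zero_le_power2)
    then have "(c * t)\<^sup>2 \<le> c\<^sup>2" by (simp add: power_mult_distrib mult_left_le)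
    then show ?thesis using cz M C by (intro mult_left_mono) auto
  qed
  \<comment> \<open>\<open>C\<close> is chosen with \<open>2 * C = 4 * M + 1\<close>, so that the
    constant terms cancel. There remains \<open>(4 * M + 1) * (2 * M + 2 - C) * z\<^sup>2\<close>,
    and \<open>2 * M + 2 - C = 3 / 2\<close>.\<close>
  moreover have "(4 * M + 1) * f - 2 * C * (1 - z\<^sup>2) + 2 * C * (2 * M + 1) * z\<^sup>2 = (4 * M + 1) * (3 / 2) * z\<^sup>2"
    unfolding f C by (simp add: field_simps power2_eq_square)
  moreover have "0 \<le> (4 * M + 1) * (3 / 2) * z\<^sup>2" using M by simp
  ultimately have "0 \<le> (2 * M * (1 / (c\<^sup>2 * X) + 1) + 1) * f - 2 * C * (c * t)\<^sup>2 + 2 * C * (2 * M + 1) * z\<^sup>2"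
    by linarith
  then show ?thesis unfolding L using c p by (simp add: mult_nonneg_nonneg)
qed

text \<open>The profile curve is \<open>(cos \<phi> cos \<theta>, cos \<phi> sin \<theta>, sin \<phi>)\<close> with \<open>\<theta> = pi / 4 - \<psi> / 2\<close>,
  parametrized by arc length, and \<open>\<alpha>\<close> is the angle from the meridian direction to its velocity.
  The equation for \<open>\<alpha>\<close> says that the hypersurface swept out by \<open>O(m+1) \<times> O(m+1)\<close> is minimal.
  The functions solve this system only as long as \<open>\<phi>\<close> and \<open>\<psi>\<close> stay below the cut-offs.\<close>

locale trajectory =
  fixes m :: nat and \<Psi> a :: real and \<phi> \<psi> \<alpha> :: "real \<Rightarrow> real"
  assumes m: "1 \<le> m" and \<Psi>: "\<Psi> < pi / 2" and a: "0 < a" "a < \<Psi>"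
    and init: "\<phi> 0 = 0" "\<psi> 0 = a" "\<alpha> 0 = 0"
    and cont: "continuous_on UNIV \<phi>" "continuous_on UNIV \<psi>" "continuous_on UNIV \<alpha>"
    and \<phi>': "(\<phi> has_real_derivative cos (\<alpha> t)) (at t)"
    and \<psi>': "\<bar>\<phi> t\<bar> \<le> pi / 4 \<Longrightarrow> (\<psi> has_real_derivative - 2 * sin (\<alpha> t) / cos (\<phi> t)) (at t)"
    and \<alpha>': "\<bar>\<phi> t\<bar> \<le> pi / 4 \<Longrightarrow> \<bar>\<psi> t\<bar> \<le> \<Psi> \<Longrightarrow>
      (\<alpha> has_real_derivative (2 * real m + 1) * tan (\<phi> t) * sin (\<alpha> t)
         + 2 * real m * tan (\<psi> t) * cos (\<alpha> t) / cos (\<phi> t)) (at t)"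
begin

definition inside :: "real \<Rightarrow> bool" where
  "inside t \<longleftrightarrow> \<bar>\<phi> t\<bar> < pi / 4 \<and> 0 < \<psi> t \<and> \<psi> t < \<Psi> \<and> \<bar>\<alpha> t\<bar> < pi / 2"

definition inside_until :: "real \<Rightarrow> bool" where
  "inside_until s \<longleftrightarrow> 0 \<le> s \<and> (\<forall>u. 0 \<le> u \<and> u < s \<longrightarrow> inside u)"

text \<open>The weight \<open>(x y)^m\<close> scaled by \<open>2^m\<close>, since
  \<open>2 x y = cos\<^sup>2 \<phi> cos \<psi>\<close> on the profile curve; the scaling makes its
  maximum \<open>1\<close>.\<close>

definition W :: "real \<Rightarrow> real" where
  "W t = ((cos (\<phi> t))\<^sup>2 * cos (\<psi> t)) ^ m"

definition logW' :: "real \<Rightarrow> real" where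
  "logW' u = 2 * real m * (tan (\<psi> u) * sin (\<alpha> u) - sin (\<phi> u) * cos (\<alpha> u)) / cos (\<phi> u)"

definition C :: real where "C = (4 * real m + 1) / 2"

definition f :: "real \<Rightarrow> real" where "f t = 1 - C * (sin (\<phi> t))\<^sup>2"

definition D :: "real \<Rightarrow> real" where "D t = cos (\<phi> t) * sin (\<psi> t / 2)"

definition D' :: "real \<Rightarrow> real" where
  "D' t = - sin (\<phi> t) * cos (\<alpha> t) * sin (\<psi> t / 2) - cos (\<psi> t / 2) * sin (\<alpha> t)"

definition f' :: "real \<Rightarrow> real" where "f' t = - 2 * C * sin (\<phi> t) * (cos (\<phi> t) * cos (\<alpha> t))"

lemma f_deriv: "(f has_real_derivative f' u) (at u)"
  unfolding f_def[abs_def] f'_def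
  by (rule derivative_eq_intros \<phi>' refl)+ (simp add: algebra_simps)

lemma inside_0: "inside 0"
  using a by (auto simp: inside_def init)

lemma open_inside: "open {t. inside t}"
  unfolding inside_def using cont
  by (intro open_Collect_conj open_Collect_less continuous_intros) auto

lemma closed_region:
  assumes "inside_until s" "0 \<le> u" "u \<le> s"
  shows "\<bar>\<phi> u\<bar> \<le> pi / 4" "0 \<le> \<psi> u" "\<psi> u \<le> \<Psi>" "\<bar>\<alpha> u\<bar> \<le> pi / 2"
proof -
  define R where "R = {t. \<bar>\<phi> t\<bar> \<le> pi / 4 \<and> 0 \<le> \<psi> t \<and> \<psi> t \<le> \<Psi> \<and> \<bar>\<alpha> t\<bar> \<le> pi / 2}"
  have "closed R"
    unfolding R_def using cont by (intro closed_Collect_conj closed_Collect_le continuous_intros) auto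
  moreover have "{0..<s} \<subseteq> R"
    using assms(1) unfolding R_def inside_until_def inside_def by force
  ultimately have "closure {0..<s} \<subseteq> R" by (simp add: closure_minimal)
  moreover have "0 \<in> R" using inside_0 by (auto simp: R_def inside_def)
  \<comment> \<open>For \<open>s = 0\<close> the half-open interval is empty and so is its closure,
    hence the separate case \<open>u = 0\<close>.\<close>
  moreover have "u \<in> closure {0..<s} \<or> u = 0" using assms by (cases "s = 0") auto
  ultimately have "u \<in> R" by blast
  then show "\<bar>\<phi> u\<bar> \<le> pi / 4" "0 \<le> \<psi> u" "\<psi> u \<le> \<Psi>" "\<bar>\<alpha> u\<bar> \<le> pi / 2" by (auto simp: R_def)
qed

context
  fixes s :: real
  assumes s: "inside_until s"
begin

lemma cos_region:
  assumes "0 \<le> u" "u \<le> s"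
  shows "0 < cos (\<phi> u)" "0 < cos (\<psi> u)" "0 \<le> cos (\<alpha> u)" "0 \<le> sin (\<psi> u)"
proof -
  note c = closed_region[OF s assms]
  show "0 < cos (\<phi> u)" "0 < cos (\<psi> u)" using c \<Psi> by (auto intro!: cos_pos_of_abs_less)
  show "0 \<le> cos (\<alpha> u)" using c by (intro cos_ge_zero) auto
  show "0 \<le> sin (\<psi> u)" using c \<Psi> by (intro sin_ge_zero) auto
qed

lemma tan_eq: "tan (\<phi> u) = sin (\<phi> u) / cos (\<phi> u)"
  by (simp add: tan_def)

lemma W_pos: "0 \<le> u \<Longrightarrow> u \<le> s \<Longrightarrow> 0 < W u"
  unfolding W_def using cos_region[of u] by simp

lemma W_le_1: "0 \<le> u \<Longrightarrow> u \<le> s \<Longrightarrow> W u \<le> 1"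
  unfolding W_def using cos_region[of u]
  by (intro power_le_one mult_le_one) (auto simp: power2_eq_square intro: mult_le_one)

lemma W_le_cos: 
  assumes "0 \<le> u" "u \<le> s" shows "W u \<le> cos (\<psi> u)"
proof -
  have le: "(cos (\<phi> u))\<^sup>2 * cos (\<psi> u) \<le> 1 * cos (\<psi> u)"
    using cos_region[OF assms] by (intro mult_right_mono) (auto simp: power2_eq_square intro: mult_le_one)
  have "W u \<le> ((cos (\<phi> u))\<^sup>2 * cos (\<psi> u)) ^ 1"
    unfolding W_def using cos_region[OF assms] le m
    by (intro power_decreasing) (auto intro: order_trans[OF le])
  with le show ?thesis by simp
qed

lemma \<psi>_deriv: "0 \<le> u \<Longrightarrow> u \<le> s \<Longrightarrow> (\<psi> has_real_derivative - 2 * sin (\<alpha> u) / cos (\<phi> u)) (at u)"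
  using \<psi>' closed_region[OF s] by auto

lemma \<alpha>_deriv: "0 \<le> u \<Longrightarrow> u \<le> s \<Longrightarrow>
      (\<alpha> has_real_derivative (2 * real m + 1) * tan (\<phi> u) * sin (\<alpha> u)
         + 2 * real m * tan (\<psi> u) * cos (\<alpha> u) / cos (\<phi> u)) (at u)"
  using \<alpha>' closed_region[OF s] by auto

lemma W_deriv:
  assumes "0 \<le> u" "u \<le> s"
  shows "(W has_real_derivative W u * logW' u) (at u)"
proof -
  define w where "w t = (cos (\<phi> t))\<^sup>2 * cos (\<psi> t)" for t
  note c = cos_region[OF assms]
  have w: "(w has_real_derivative w u * (2 * (tan (\<psi> u) * sin (\<alpha> u) - sin (\<phi> u) * cos (\<alpha> u)) / cos (\<phi> u))) (at u)"
    unfolding w_def[abs_def] using c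
    by - ((rule derivative_eq_intros \<phi>' \<psi>_deriv assms refl)+, simp add: tan_def field_simps power2_eq_square)
  have "((\<lambda>t. w t ^ m) has_real_derivative w u ^ m * logW' u) (at u)"
    unfolding logW'_def using m by (intro DERIV_cong[OF DERIV_power[OF w]]) (cases m; simp add: algebra_simps)
  then show ?thesis unfolding W_def[abs_def] w_def .
qed

text \<open>The coordinate \<open>sin \<phi>\<close> is an eigenfunction of the Laplacian of a minimal hypersurface.\<close>

lemma flux_height:
  assumes "0 \<le> u" "u \<le> s"
  shows "((\<lambda>t. W t * (cos (\<phi> t) * cos (\<alpha> t))) has_real_derivative - (2 * real m + 1) * W u * sin (\<phi> u)) (at u)"
proof -
  note c = cos_region[OF assms]
  define A where "A = (2 * real m + 1) * tan (\<phi> u) * sin (\<alpha> u) + 2 * real m * tan (\<psi> u) * cos (\<alpha> u) / cos (\<phi> u)"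
  have D: "((\<lambda>t. W t * (cos (\<phi> t) * cos (\<alpha> t))) has_real_derivative
      W u * (logW' u * (cos (\<phi> u) * cos (\<alpha> u))
        + (- sin (\<phi> u) * cos (\<alpha> u) * cos (\<alpha> u) - cos (\<phi> u) * sin (\<alpha> u) * A))) (at u)"
    by (rule derivative_eq_intros W_deriv \<phi>' \<alpha>_deriv[folded A_def] assms refl)+ (simp add: A_def algebra_simps)
  have e: "logW' u * (cos (\<phi> u) * cos (\<alpha> u))
      + (- sin (\<phi> u) * cos (\<alpha> u) * cos (\<alpha> u) - cos (\<phi> u) * sin (\<alpha> u) * A) = - (2 * real m + 1) * sin (\<phi> u)"
    using flux_height_algebra[of "cos (\<phi> u)" "sin (\<alpha> u)" "cos (\<alpha> u)"] c
    by (simp add: logW'_def A_def tan_eq)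
  show ?thesis by (rule DERIV_cong[OF D], unfold e) (simp add: algebra_simps)
qed

text \<open>\<open>cos \<phi> sin \<alpha>\<close> is the angular momentum of the profile curve about the third axis.\<close>

lemma flux_angular:
  assumes "0 \<le> u" "u \<le> s"
  shows "((\<lambda>t. W t * (cos (\<phi> t) * sin (\<alpha> t))) has_real_derivative 2 * real m * W u * tan (\<psi> u)) (at u)"
proof -
  note c = cos_region[OF assms]
  define A where "A = (2 * real m + 1) * tan (\<phi> u) * sin (\<alpha> u) + 2 * real m * tan (\<psi> u) * cos (\<alpha> u) / cos (\<phi> u)"
  have D: "((\<lambda>t. W t * (cos (\<phi> t) * sin (\<alpha> t))) has_real_derivative
      W u * (logW' u * (cos (\<phi> u) * sin (\<alpha> u))
        + (- sin (\<phi> u) * cos (\<alpha> u) * sin (\<alpha> u) + cos (\<phi> u) * cos (\<alpha> u) * A))) (at u)"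
    by (rule derivative_eq_intros W_deriv \<phi>' \<alpha>_deriv[folded A_def] assms refl)+ (simp add: A_def algebra_simps)
  have e: "logW' u * (cos (\<phi> u) * sin (\<alpha> u))
      + (- sin (\<phi> u) * cos (\<alpha> u) * sin (\<alpha> u) + cos (\<phi> u) * cos (\<alpha> u) * A) = 2 * real m * tan (\<psi> u)"
    using flux_angular_algebra[of "cos (\<phi> u)" "sin (\<alpha> u)" "cos (\<alpha> u)"] c
    by (simp add: logW'_def A_def tan_eq)
  show ?thesis by (rule DERIV_cong[OF D], unfold e) (simp add: algebra_simps)
qed

lemma \<phi>_mono: "0 \<le> u \<Longrightarrow> u \<le> v \<Longrightarrow> v \<le> s \<Longrightarrow> \<phi> u \<le> \<phi> v"
  by (rule nonneg_deriv_mono_on[OF _ \<phi>']) (use cos_region in auto)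

lemma \<phi>_strict_mono:
  assumes "0 \<le> u" "u < v" "v \<le> s" shows "\<phi> u < \<phi> v"
proof (rule pos_deriv_strict_mono_on[OF assms(2) \<phi>'])
  fix x assume "u < x" "x < v"
  then have "inside x" using s assms by (auto simp: inside_until_def)
  then show "0 < cos (\<alpha> x)" by (intro cos_pos_of_abs_less) (simp add: inside_def)
qed

lemma \<phi>_nonneg: "0 \<le> u \<Longrightarrow> u \<le> s \<Longrightarrow> 0 \<le> \<phi> u"
  using \<phi>_mono[of 0 u] by (simp add: init)

lemma \<phi>_pos: "0 < u \<Longrightarrow> u \<le> s \<Longrightarrow> 0 < \<phi> u"
  using \<phi>_strict_mono[of 0 u] by (simp add: init)

text \<open>The angular flux starts at zero and grows as long as \<open>\<psi> > 0\<close>, so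
  \<open>sin \<alpha>\<close> becomes positive at once. The known range of \<open>\<alpha>\<close>
  then gives its sign.\<close>

lemma \<alpha>_pos:
  assumes "0 < u" "u \<le> s" shows "0 < \<alpha> u"
proof -
  have "W 0 * (cos (\<phi> 0) * sin (\<alpha> 0)) < W u * (cos (\<phi> u) * sin (\<alpha> u))"
  proof (rule pos_deriv_strict_mono_on[OF assms(1) flux_angular])
    fix x assume x: "0 < x" "x < u"
    then have "inside x" using s assms by (auto simp: inside_until_def)
    then have "0 < tan (\<psi> x)" using \<Psi> by (intro tan_gt_zero) (auto simp: inside_def)
    then show "0 < 2 * real m * W x * tan (\<psi> x)" using m x assms W_pos[of x] by simp
  qed (use assms in auto)
  then have "0 < sin (\<alpha> u)"
    using W_pos[of u] cos_region[of u] assms by (simp add: init zero_less_mult_iff)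
  show ?thesis
  proof (rule ccontr)
    assume "\<not> 0 < \<alpha> u"
    then have "0 \<le> sin (- \<alpha> u)"
      using closed_region(4)[OF s, of u] assms by (intro sin_ge_zero) auto
    with \<open>0 < sin (\<alpha> u)\<close> show False by simp
  qed
qed

lemma \<alpha>_nonneg: "0 \<le> u \<Longrightarrow> u \<le> s \<Longrightarrow> 0 \<le> \<alpha> u"
  using \<alpha>_pos[of u] by (cases "u = 0") (auto simp: init)

lemma sin_\<alpha>_nonneg: "0 \<le> u \<Longrightarrow> u \<le> s \<Longrightarrow> 0 \<le> sin (\<alpha> u)"
  using \<alpha>_nonneg[of u] closed_region(4)[OF s, of u] by (intro sin_ge_zero) auto

lemma sin_\<alpha>_pos: "0 < u \<Longrightarrow> u \<le> s \<Longrightarrow> 0 < sin (\<alpha> u)"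
  using \<alpha>_pos[of u] closed_region(4)[OF s, of u] by (intro sin_gt_zero) auto

lemma \<psi>_strict_anti:
  assumes "0 \<le> u" "u < v" "v \<le> s" shows "\<psi> v < \<psi> u"
proof -
  have "- \<psi> u < - \<psi> v"
  proof (rule pos_deriv_strict_mono_on[OF assms(2) DERIV_minus[OF \<psi>_deriv]])
    fix x assume "u < x" "x < v"
    then show "0 < - (- 2 * sin (\<alpha> x) / cos (\<phi> x))"
      using assms sin_\<alpha>_pos[of x] cos_region[of x] by simp
  qed (use assms in auto)
  then show ?thesis by simp
qed

lemma \<psi>_le: "0 \<le> u \<Longrightarrow> u \<le> s \<Longrightarrow> \<psi> u \<le> a"
  using \<psi>_strict_anti[of 0 u] by (cases "u = 0") (auto simp: init)

text \<open>While \<open>\<alpha>\<close> lies between \<open>0\<close> and a right angle,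
  \<open>\<phi> - \<psi>\<close> grows at least at unit rate because
  \<open>cos \<alpha> + sin \<alpha> \<ge> 1\<close>. It can grow by at most
  \<open>pi / 2 + pi / 4\<close>, which is at most \<open>3\<close> since
  \<open>pi < 4\<close>.\<close>

lemma time_le: "s \<le> 3"
proof -
  have s0: "0 \<le> s" using s by (simp add: inside_until_def)
  have "\<phi> 0 - \<psi> 0 - 0 \<le> \<phi> s - \<psi> s - s"
  proof (rule nonneg_deriv_mono_on[OF s0])
    fix x assume x: "0 \<le> x" "x \<le> s"
    show "((\<lambda>t. \<phi> t - \<psi> t - t) has_real_derivative
        cos (\<alpha> x) - - 2 * sin (\<alpha> x) / cos (\<phi> x) - 1) (at x)"
      by (intro derivative_intros \<phi>' \<psi>_deriv x)
    have "1 \<le> (cos (\<alpha> x) + sin (\<alpha> x))\<^sup>2"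
      using cos_region[OF x] sin_\<alpha>_nonneg[OF x] sin_cos_squared_add[of "\<alpha> x"]
      unfolding power2_sum by simp
    then have "1 \<le> cos (\<alpha> x) + sin (\<alpha> x)"
      using cos_region[OF x] sin_\<alpha>_nonneg[OF x] by (intro power2_le_imp_le[of 1]) auto
    moreover have "sin (\<alpha> x) \<le> sin (\<alpha> x) / cos (\<phi> x)"
      using cos_region[OF x] sin_\<alpha>_nonneg[OF x] by (simp add: le_divide_eq mult_left_le)
    ultimately show "0 \<le> cos (\<alpha> x) - - 2 * sin (\<alpha> x) / cos (\<phi> x) - 1"
      using sin_\<alpha>_nonneg[OF x] by simp
  qed
  then have "s \<le> a + \<phi> s - \<psi> s" by (simp add: init)
  also have "\<dots> \<le> pi / 2 + pi / 4"
    using a \<Psi> closed_region[OF s, of s] s0 by auto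
  also have "\<dots> \<le> 3" using pi_less_4 by simp
  finally show ?thesis .
qed

lemma half_\<psi>_deriv:
  "0 \<le> u \<Longrightarrow> u \<le> s \<Longrightarrow> ((\<lambda>t. \<psi> t / 2) has_real_derivative - sin (\<alpha> u) / cos (\<phi> u)) (at u)"
  using DERIV_cdivide[OF \<psi>_deriv, of u 2] by simp

lemma D_deriv:
  assumes "0 \<le> u" "u \<le> s" shows "(D has_real_derivative D' u) (at u)"
  unfolding D_def[abs_def] D'_def using cos_region[OF assms]
  by - ((rule half_\<psi>_deriv derivative_eq_intros \<phi>' assms refl)+, simp add: field_simps)

text \<open>Sturm comparison: the linear function \<open>D\<close> (the difference of the first two coordinates of the
  profile curve, up to a factor) satisfies \<open>(W D')' = - W D (2 m / (cos\<^sup>2 \<phi> cos \<psi>) + 2 m + 1)\<close>.\<close>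

lemma wronskian_nonpos:
  assumes u: "0 \<le> u" "u \<le> s" and f: "\<And>x. 0 \<le> x \<Longrightarrow> x \<le> u \<Longrightarrow> 0 \<le> f x"
  shows "D' u * f u - D u * f' u \<le> 0"
proof -
  \<comment> \<open>The weight absorbs the first-order terms: the derivative of \<open>K\<close> is
    minus \<open>W\<close> times the expression estimated in \<open>sturm_algebra\<close>. At time
    \<open>0\<close> both \<open>D'\<close> and \<open>f'\<close> vanish, and so does
    \<open>K\<close>.\<close>
  define K where "K t = - (W t * (D' t * f t - D t * f' t))" for t
  define A where "A x = (2 * real m + 1) * tan (\<phi> x) * sin (\<alpha> x) + 2 * real m * tan (\<psi> x) * cos (\<alpha> x) / cos (\<phi> x)" for x
  let ?D2 = "\<lambda>x. - (cos (\<phi> x) * cos (\<alpha> x) * cos (\<alpha> x) * sin (\<psi> x / 2)) + sin (\<phi> x) * sin (\<alpha> x) * A x * sin (\<psi> x / 2)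
      + sin (\<phi> x) * cos (\<alpha> x) * cos (\<psi> x / 2) * (sin (\<alpha> x) / cos (\<phi> x))
      - sin (\<psi> x / 2) * sin (\<alpha> x) * (sin (\<alpha> x) / cos (\<phi> x)) - cos (\<psi> x / 2) * cos (\<alpha> x) * A x"
  let ?f2 = "\<lambda>x. - 2 * C * ((cos (\<phi> x) * cos (\<alpha> x))\<^sup>2
          + sin (\<phi> x) * (- sin (\<phi> x) * cos (\<alpha> x) * cos (\<alpha> x) - cos (\<phi> x) * sin (\<alpha> x) * A x))"
  define K' where "K' x = - (W x * (logW' x * (D' x * f x - D x * f' x) +
    (?D2 x * f x - D x * ?f2 x)))" for x
  have "K 0 \<le> K u"
  proof (rule nonneg_deriv_mono_on[OF u(1)])
    fix x assume "0 \<le> x" "x \<le> u"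
    then have x: "0 \<le> x" "x \<le> s" using u by auto
    note c = cos_region[OF x]
    have 1: "(D' has_real_derivative ?D2 x) (at x)"
      unfolding D'_def[abs_def] using c
      by - ((rule half_\<psi>_deriv derivative_eq_intros \<phi>' \<alpha>_deriv[folded A_def] x refl)+, simp add: A_def field_simps)
    have 2: "(f' has_real_derivative ?f2 x) (at x)"
      unfolding f'_def[abs_def]
      by (rule derivative_eq_intros \<phi>' \<alpha>_deriv[folded A_def] x refl)+ (simp add: A_def algebra_simps power2_eq_square)
    show "(K has_real_derivative K' x) (at x)"
      unfolding K_def[abs_def] K'_def
      by (rule derivative_eq_intros W_deriv f_deriv D_deriv 1 2 x refl)+ (simp add: algebra_simps)
    have "cos (\<psi> x) = (cos (\<psi> x / 2))\<^sup>2 - (sin (\<psi> x / 2))\<^sup>2" "sin (\<psi> x) = 2 * sin (\<psi> x / 2) * cos (\<psi> x / 2)"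
      using cos_double[of "\<psi> x / 2"] sin_double[of "\<psi> x / 2"] by simp_all
    moreover have "0 \<le> sin (\<psi> x / 2)"
      using closed_region[OF s x] \<Psi> by (intro sin_ge_zero) auto
    ultimately have "logW' x * (D' x * f x - D x * f' x) +
    (?D2 x * f x - D x * ?f2 x) \<le> 0"
      unfolding D'_def D_def f'_def logW'_def A_def tan_eq
      by (intro sturm_algebra[where X="cos (\<psi> x)" and M="real m" and T="tan (\<psi> x)"])
        (use c f[OF \<open>0 \<le> x\<close> \<open>x \<le> u\<close>] in \<open>auto simp: C_def f_def tan_def\<close>)
    then show "0 \<le> K' x"
      unfolding K'_def using W_pos[OF x] by (simp add: mult_le_0_iff)
  qed
  moreover have "K 0 = 0" by (simp add: K_def D'_def f'_def init)
  ultimately have "0 \<le> K u" by simp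
  then show ?thesis using W_pos[OF u] by (simp add: K_def mult_le_0_iff)
qed

end

section \<open>Height bound from the Sturm comparison\<close>

lemma f_strict_anti:
  assumes s: "inside_until s" and u: "0 \<le> u" "u < v" "v \<le> s"
  shows "f v < f u"
proof -
  have "sin (\<phi> u) < sin (\<phi> v)"
    using \<phi>_strict_mono[OF s u] \<phi>_nonneg[OF s, of u] closed_region(1)[OF s, of v] u
    by (intro sin_monotone_2pi) auto
  moreover have "0 \<le> sin (\<phi> u)"
    using \<phi>_nonneg[OF s, of u] closed_region(1)[OF s, of u] u by (intro sin_ge_zero) auto
  ultimately have "(sin (\<phi> u))\<^sup>2 < (sin (\<phi> v))\<^sup>2" by (intro power_strict_mono) auto
  then show ?thesis by (simp add: f_def C_def)
qed

text \<open>By Sturm comparison \<open>D \<le> D 0 * f\<close>, and \<open>D\<close> is positive.\<close>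

lemma f_nonneg:
  assumes s: "inside_until s" and u: "0 \<le> u" "u \<le> s"
  shows "0 \<le> f u"
proof (rule ccontr)
  assume "\<not> 0 \<le> f u"
  moreover have f0: "f 0 = 1" by (simp add: f_def init)
  moreover have contf: "continuous_on S f" for S
    by (meson f_deriv DERIV_isCont continuous_at_imp_continuous_on)
  ultimately obtain v where v: "0 \<le> v" "v \<le> u" "f v = 0"
    using IVT2'[of f u 0 0] u by auto
  \<comment> \<open>Since \<open>v\<close> lies strictly before \<open>s\<close>,
    \<open>inside v\<close> supplies the strict inequality \<open>0 < \<psi> v\<close> that makes
    \<open>D v\<close> positive.\<close>
  have "v \<noteq> u" "v \<noteq> 0" using v \<open>\<not> 0 \<le> f u\<close> f0 by auto
  then have v': "0 < v" "v < u" using v by auto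
  then have "inside v" using s u by (auto simp: inside_until_def)
  then have "0 < cos (\<phi> v)" "0 < sin (\<psi> v / 2)"
    using \<Psi> by (auto simp: inside_def intro!: cos_pos_of_abs_less sin_gt_zero)
  then have Dv: "0 < D v" by (simp add: D_def)
  have fpos: "0 < f x" if "0 \<le> x" "x < v" for x
    using f_strict_anti[OF s that(1,2)] v u by simp
  have "D x \<le> D 0 * f x" if x: "0 \<le> x" "x < v" for x
  proof -
    have "- (D 0 / f 0) \<le> - (D x / f x)"
    proof (rule nonneg_deriv_mono_on[OF x(1)])
      fix y assume "0 \<le> y" "y \<le> x"
      then have y: "0 \<le> y" "y < v" using x by auto
      show "((\<lambda>x. - (D x / f x)) has_real_derivative - ((D' y * f y - D y * f' y) / (f y * f y))) (at y)"
        using fpos[OF y] y v' u by (intro DERIV_minus DERIV_divide f_deriv D_deriv[OF s]) auto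
      have "D' y * f y - D y * f' y \<le> 0"
        using y v' u by (intro wronskian_nonpos[OF s]) (auto intro!: less_imp_le fpos)
      then show "0 \<le> - ((D' y * f y - D y * f' y) / (f y * f y))"
        using fpos[OF y] by (simp add: divide_nonpos_pos)
    qed
    then show ?thesis using fpos[OF x] by (simp add: f0 divide_le_eq)
  qed
  \<comment> \<open>The quotient \<open>D / f\<close> is controlled only before \<open>v\<close>.
    The inequality passes to \<open>v\<close> by closedness, where \<open>f v = 0\<close>
    contradicts \<open>D v > 0\<close>.\<close>
  then have "{0..<v} \<subseteq> {x. D x \<le> D 0 * f x}" by auto
  moreover have "closed {x. D x \<le> D 0 * f x}"
    unfolding D_def using cont by (intro closed_Collect_le continuous_intros contf) auto
  ultimately have "closure {0..<v} \<subseteq> {x. D x \<le> D 0 * f x}" by (rule closure_minimal)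
  moreover have "v \<in> closure {0..<v}" using v' by auto
  ultimately show False using Dv v(3) by auto
qed

text \<open>\<open>C \<ge> 5 / 2\<close> because \<open>m \<ge> 1\<close>. The resulting bound is
  below \<open>1 / 2\<close>, the squared sine of \<open>pi / 4\<close>, so the cut-off in
  \<open>\<phi>\<close> is never reached.\<close>

lemma sin_sq_\<phi>_le:
  assumes s: "inside_until s" and u: "0 \<le> u" "u \<le> s"
  shows "(sin (\<phi> u))\<^sup>2 \<le> 2 / 5"
proof -
  have "5 / 2 * (sin (\<phi> u))\<^sup>2 \<le> C * (sin (\<phi> u))\<^sup>2"
    using m by (intro mult_right_mono) (auto simp: C_def)
  also have "\<dots> \<le> 1" using f_nonneg[OF assms] by (simp add: f_def)
  finally show ?thesis by simp
qed

section \<open>Exit of a trajectory from the region\<close>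

lemma exit_time:
  obtains S where "0 < S" "S \<le> 3" "inside_until S" "\<not> inside S"
proof -
  let ?N = "{t. 0 \<le> t \<and> \<not> inside t}"
  have "\<not> inside_until 4" using time_le[of 4] by auto
  then have ne: "?N \<noteq> {}" by (auto simp: inside_until_def)
  have "closed ({0..} \<inter> - {t. inside t})" using open_inside by (intro closed_Int) auto
  moreover have "?N = {0..} \<inter> - {t. inside t}" by auto
  ultimately have cl: "closed ?N" by simp
  have bdd: "bdd_below ?N" by (rule bdd_belowI[of _ 0]) auto
  have S: "Inf ?N \<in> ?N" by (rule closed_contains_Inf[OF ne bdd cl])
  have "inside_until (Inf ?N)"
    using S cInf_lower[OF _ bdd] unfolding inside_until_def by (auto simp: not_le[symmetric])
  moreover have "Inf ?N \<noteq> 0" using S inside_0 by auto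
  ultimately show ?thesis using S time_le by (intro that[of "Inf ?N"]) auto
qed

text \<open>The other walls are excluded: that for \<open>\<phi>\<close> by the height bound, the
  upper one for \<open>\<psi>\<close> because \<open>\<psi>\<close> stays below
  \<open>a < \<Psi>\<close>, and \<open>\<alpha> = - pi / 2\<close> because \<open>\<alpha>\<close>
  is nonnegative.\<close>

lemma exit_cases:
  assumes s: "inside_until S" "0 < S" and n: "\<not> inside S"
  shows "\<psi> S = 0 \<or> \<alpha> S = pi / 2"
proof -
  have u: "0 \<le> S" "S \<le> S" using s by auto
  have "\<bar>\<phi> S\<bar> \<noteq> pi / 4"
  proof
    assume "\<bar>\<phi> S\<bar> = pi / 4"
    then have "\<phi> S = pi / 4" using \<phi>_nonneg[OF s(1) u] by simp
    then have "(sin (\<phi> S))\<^sup>2 = 1 / 2" by (simp only: sin_45 power_divide) simp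
    then show False using sin_sq_\<phi>_le[OF s(1) u] by simp
  qed
  then show ?thesis
    using n closed_region[OF s(1) u] \<psi>_le[OF s(1) u] a \<alpha>_nonneg[OF s(1) u] unfolding inside_def by auto
qed

text \<open>This treats a start near the diagonal. The angular flux begins at zero and grows at a
  rate of at most \<open>2 m tan a\<close>, hence to at most \<open>6 m tan a\<close> within time
  \<open>3\<close>. At \<open>\<alpha> = pi / 2\<close> it would equal \<open>W cos \<phi>\<close>,
  which is at least \<open>(cos a / 2) ^ m / 2\<close>.\<close>

lemma exit_\<alpha>_less:
  assumes s: "inside_until S" and small: "6 * real m * tan a < (cos a / 2) ^ m / 2"
  shows "\<alpha> S < pi / 2"
proof (rule ccontr)
  assume "\<not> \<alpha> S < pi / 2"
  have u: "0 \<le> S" "S \<le> S" using s by (auto simp: inside_until_def)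
  have \<alpha>: "\<alpha> S = pi / 2" using closed_region(4)[OF s u] \<open>\<not> \<alpha> S < pi / 2\<close> by simp
  have tana: "0 < tan a" using a \<Psi> by (intro tan_gt_zero) auto
  have "2 * real m * tan a * 0 - W 0 * (cos (\<phi> 0) * sin (\<alpha> 0)) \<le> 2 * real m * tan a * S - W S * (cos (\<phi> S) * sin (\<alpha> S))"
  proof (rule nonneg_deriv_mono_on[OF u(1)])
    fix x assume x: "0 \<le> x" "x \<le> S"
    show "((\<lambda>t. 2 * real m * tan a * t - W t * (cos (\<phi> t) * sin (\<alpha> t))) has_real_derivative
        2 * real m * tan a - 2 * real m * W x * tan (\<psi> x)) (at x)"
      by (intro DERIV_diff flux_angular[OF s] x) (auto intro!: derivative_eq_intros)
    have "tan (\<psi> x) \<le> tan a"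
      using closed_region[OF s x] \<psi>_le[OF s x] a \<Psi> by (intro tan_mono_le) auto
    moreover have "0 \<le> tan (\<psi> x)"
      using cos_region[OF s x] by (simp add: tan_def)
    ultimately have "W x * tan (\<psi> x) \<le> 1 * tan a"
      using W_le_1[OF s x] by (intro mult_mono) auto
    then show "0 \<le> 2 * real m * tan a - 2 * real m * W x * tan (\<psi> x)"
      by (simp add: mult.assoc mult_left_mono)
  qed
  then have "W S * cos (\<phi> S) \<le> 2 * real m * tan a * S" by (simp add: init \<alpha>)
  also have "\<dots> \<le> 2 * real m * tan a * 3"
    using time_le[OF s] tana by (intro mult_left_mono) auto
  finally have le: "W S * cos (\<phi> S) \<le> 6 * real m * tan a" by simp
  have ca: "0 < cos a" using a \<Psi> by (intro cos_pos_of_abs_less) auto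
  have "cos a \<le> cos (\<psi> S)"
    using \<psi>_le[OF s u] closed_region[OF s u] a \<Psi> by (intro cos_monotone_0_pi_le) auto
  then have "1 / 2 * cos a \<le> (cos (\<phi> S))\<^sup>2 * cos (\<psi> S)"
    using abs_le_pi_quarter[OF closed_region(1)[OF s u]] ca by (intro mult_mono) auto
  then have "(cos a / 2) ^ m * (1 / 2) \<le> W S * cos (\<phi> S)"
    unfolding W_def using ca abs_le_pi_quarter[OF closed_region(1)[OF s u]]
    by (intro mult_mono power_mono) auto
  then show False using le small by simp
qed

text \<open>This treats a start near the boundary. If \<open>\<psi>\<close> reached
  \<open>0\<close>, the height flux \<open>P\<close> would lose at least
  \<open>(2 m + 1) c z(r)\<close> during the last time span \<open>1 / 8\<close>, where
  \<open>W\<close> is bounded below; so \<open>(2 m + 1) c z(r) \<le> P 0\<close>. This in turn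
  limits the loss up to time \<open>r = c / 2\<close> to half of \<open>P 0\<close>. Hence
  \<open>W z' \<ge> P 0 / 2\<close> up to \<open>r\<close>, while \<open>W \<le> cos a + 4 t\<close>
  there, and integration makes \<open>z(r)\<close> logarithmically large, contradicting
  \<open>c z(r) \<le> P 0\<close>.\<close>

lemma exit_\<psi>_pos:
  assumes s: "inside_until S" and a32: "3 / 2 \<le> a"
    and c: "c = (1 / 4) ^ m / 8" and large: "8 / c < ln (cos a + 2 * c) - ln (cos a)"
  shows "0 < \<psi> S"
proof (rule ccontr)
  assume "\<not> 0 < \<psi> S"
  have u: "0 \<le> S" "S \<le> S" using s by (auto simp: inside_until_def)
  have \<psi>S: "\<psi> S = 0" using closed_region[OF s u] \<open>\<not> 0 < \<psi> S\<close> by simp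
  have ca: "0 < cos a" using a \<Psi> by (intro cos_pos_of_abs_less) auto
  have c0: "0 < c" "c \<le> 1 / 8" unfolding c by (auto intro: power_le_one)
  have slope: "sin (\<alpha> x) / cos (\<phi> x) \<le> 2" if "0 \<le> x" "x \<le> S" for x
    using abs_le_pi_quarter(2,3)[OF closed_region(1)[OF s that]] sin_le_one[of "\<alpha> x"]
    by (simp add: divide_le_eq del: sin_le_one)
  have \<psi>_lip: "\<psi> x \<le> \<psi> y + 4 * (y - x)" if "0 \<le> x" "x \<le> y" "y \<le> S" for x y
  proof -
    have "\<psi> x + 4 * x \<le> \<psi> y + 4 * y"
    proof (rule nonneg_deriv_mono_on[OF that(2)])
      fix v assume "x \<le> v" "v \<le> y"
      then have v: "0 \<le> v" "v \<le> S" using that by auto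
      show "((\<lambda>t. \<psi> t + 4 * t) has_real_derivative - 2 * sin (\<alpha> v) / cos (\<phi> v) + 4) (at v)"
        by (rule derivative_eq_intros \<psi>_deriv[OF s] v refl)+ simp
      show "0 \<le> - 2 * sin (\<alpha> v) / cos (\<phi> v) + 4" using slope[OF v] by simp
    qed
    then show ?thesis by simp
  qed
  \<comment> \<open>\<open>\<psi>\<close> falls from at least \<open>3 / 2\<close> to
    \<open>0\<close> at a rate of at most \<open>4\<close>. This separates the early interval up to
    \<open>r\<close> from the late one starting at \<open>S - 1 / 8\<close>.\<close>
  have S: "3 / 8 \<le> S" using \<psi>_lip[of 0 S] u a32 by (simp add: init \<psi>S)
  define P where "P t = W t * (cos (\<phi> t) * cos (\<alpha> t))" for t
  define z where "z t = sin (\<phi> t)" for t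
  have P': "(P has_real_derivative - (2 * real m + 1) * W x * z x) (at x)" if "0 \<le> x" "x \<le> S" for x
    unfolding P_def[abs_def] z_def by (rule flux_height[OF s that])
  have z_mono: "z x \<le> z y" if "0 \<le> x" "x \<le> y" "y \<le> S" for x y
    unfolding z_def
    using \<phi>_mono[OF s that] \<phi>_nonneg[OF s, of x] closed_region(1)[OF s, of y] that
    by (intro sin_monotone_2pi_le) auto
  have z_nonneg: "0 \<le> z x" if "0 \<le> x" "x \<le> S" for x
    using z_mono[of 0 x] that by (simp add: z_def init)
  have P0: "P 0 = cos a ^ m" by (simp add: P_def W_def init)
  have P_anti: "P y \<le> P 0" if "0 \<le> y" "y \<le> S" for y
  proof -
    have "- P 0 \<le> - P y"
    proof (rule nonneg_deriv_mono_on[OF that(1) DERIV_minus[OF P']])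
      fix x assume "0 \<le> x" "x \<le> y"
      then have "0 \<le> (2 * real m + 1) * W x * z x"
        using z_nonneg[of x] W_pos[OF s, of x] that by simp
      then show "0 \<le> - (- (2 * real m + 1) * W x * z x)"
        by (simp only: mult_minus_left minus_minus)
    qed (use that in auto)
    then show ?thesis by simp
  qed
  have W_late: "(1 / 4) ^ m \<le> W x" if "S - 1 / 8 \<le> x" "x \<le> S" for x
  proof -
    have x: "0 \<le> x" "x \<le> S" using that S by auto
    have "\<psi> x \<le> 1 / 2" using \<psi>_lip[of x S] x that \<psi>S by simp
    then have "1 / 2 \<le> cos (\<psi> x)"
      using closed_region[OF s x] pi_gt3 by (intro abs_le_pi_quarter) auto
    then have "1 / 2 * (1 / 2) \<le> (cos (\<phi> x))\<^sup>2 * cos (\<psi> x)"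
      using abs_le_pi_quarter[OF closed_region(1)[OF s x]] by (intro mult_mono) auto
    then show ?thesis unfolding W_def by (intro power_mono) auto
  qed
  define r where "r = c / 2"
  have r: "0 < r" "r \<le> 1 / 4" "r \<le> S" "r \<le> S - 1 / 8" using c0 S by (auto simp: r_def)
  have zr: "(2 * real m + 1) * c * z r \<le> P 0"
  proof -
    let ?k = "(2 * real m + 1) * (1 / 4) ^ m * z r"
    have "- P (S - 1 / 8) - ?k * (S - 1 / 8) \<le> - P S - ?k * S"
    proof (rule nonneg_deriv_mono_on[where f="\<lambda>t. - P t - ?k * t"])
      fix x assume x: "S - 1 / 8 \<le> x" "x \<le> S"
      show "((\<lambda>t. - P t - ?k * t) has_real_derivative - (- (2 * real m + 1) * W x * z x) - ?k) (at x)"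
        by (intro DERIV_diff DERIV_minus P') (use x S in \<open>auto intro!: derivative_eq_intros\<close>)
      have "(1 / 4) ^ m * z r \<le> W x * z x"
        using W_late[OF x] z_mono[of r x] z_nonneg[of r] r x S W_pos[OF s, of x] by (intro mult_mono) auto
      then have "(2 * real m + 1) * ((1 / 4) ^ m * z r) \<le> (2 * real m + 1) * (W x * z x)"
        by (intro mult_left_mono) auto
      then show "0 \<le> - (- (2 * real m + 1) * W x * z x) - ?k"
        by (simp only: mult_minus_left minus_minus mult.assoc diff_ge_0_iff_ge)
    qed simp
    moreover have "0 \<le> P S" unfolding P_def using W_pos[OF s u] cos_region[OF s u] by simp
    moreover have "P (S - 1 / 8) \<le> P 0" using S by (intro P_anti) auto
    ultimately have "?k * (1 / 8) \<le> P 0" by (simp add: algebra_simps)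
    then show ?thesis by (simp add: c)
  qed
  have P_early: "P 0 / 2 \<le> P y" if y: "0 \<le> y" "y \<le> r" for y
  proof -
    let ?k = "(2 * real m + 1) * z r"
    have "P 0 + ?k * 0 \<le> P y + ?k * y"
    proof (rule nonneg_deriv_mono_on[OF y(1)])
      fix x assume x: "0 \<le> x" "x \<le> y"
      show "((\<lambda>t. P t + ?k * t) has_real_derivative - (2 * real m + 1) * W x * z x + ?k) (at x)"
        by (intro DERIV_add P') (use x y r in \<open>auto intro!: derivative_eq_intros\<close>)
      have "W x * z x \<le> 1 * z r"
        using W_le_1[OF s, of x] z_mono[of x r] z_nonneg[of x] r x y by (intro mult_mono) auto
      then have "(2 * real m + 1) * (W x * z x) \<le> (2 * real m + 1) * z r"
        by (intro mult_left_mono) auto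
      then show "0 \<le> - (2 * real m + 1) * W x * z x + ?k"
        by (simp only: mult_minus_left mult.assoc)
    qed
    moreover have "?k * y \<le> ?k * r"
      using z_nonneg[of r] r y by (intro mult_left_mono) auto
    moreover have "?k * r = (2 * real m + 1) * c * z r / 2" by (simp add: r_def)
    ultimately show ?thesis using zr by linarith
  qed
  \<comment> \<open>The subtracted logarithm is an antiderivative of
    \<open>P 0 / (2 (cos a + 4 t))\<close>, the lower bound for \<open>z'\<close>.\<close>
  have "z 0 - P 0 / 8 * ln (cos a + 4 * 0) \<le> z r - P 0 / 8 * ln (cos a + 4 * r)"
  proof (rule nonneg_deriv_mono_on[where f="\<lambda>t. z t - P 0 / 8 * ln (cos a + 4 * t)"
        and f'="\<lambda>x. cos (\<phi> x) * cos (\<alpha> x) - P 0 / 2 / (cos a + 4 * x)"])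
    fix x assume x: "0 \<le> x" "x \<le> r"
    then have xS: "0 \<le> x" "x \<le> S" using r by auto
    have pos: "0 < cos a + 4 * x" using ca x by simp
    show "((\<lambda>t. z t - P 0 / 8 * ln (cos a + 4 * t)) has_real_derivative
        cos (\<phi> x) * cos (\<alpha> x) - P 0 / 2 / (cos a + 4 * x)) (at x)"
      unfolding z_def[abs_def] using pos
      by - ((rule derivative_eq_intros \<phi>' refl | assumption)+, simp add: field_simps)
    have "- cos (\<psi> 0) + 4 * 0 \<le> - cos (\<psi> x) + 4 * x"
    proof (rule nonneg_deriv_mono_on[OF x(1)])
      fix y assume "0 \<le> y" "y \<le> x"
      then have y: "0 \<le> y" "y \<le> S" using xS by auto
      show "((\<lambda>t. - cos (\<psi> t) + 4 * t) has_real_derivative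
          - (- sin (\<psi> y) * (- 2 * sin (\<alpha> y) / cos (\<phi> y))) + 4) (at y)"
        by (rule derivative_eq_intros \<psi>_deriv[OF s] y refl)+ simp
      have "sin (\<psi> y) * (sin (\<alpha> y) / cos (\<phi> y)) \<le> 1 * 2"
        using slope[OF y] sin_\<alpha>_nonneg[OF s y] cos_region[OF s y] by (intro mult_mono) auto
      moreover have "- (- sin (\<psi> y) * (- 2 * sin (\<alpha> y) / cos (\<phi> y))) + 4
          = 4 - 2 * (sin (\<psi> y) * (sin (\<alpha> y) / cos (\<phi> y)))" by simp
      ultimately show "0 \<le> - (- sin (\<psi> y) * (- 2 * sin (\<alpha> y) / cos (\<phi> y))) + 4" by linarith
    qed
    then have "W x \<le> cos a + 4 * x" using W_le_cos[OF s xS] by (simp add: init)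
    moreover have "0 \<le> cos (\<phi> x) * cos (\<alpha> x)" using cos_region[OF s xS] by simp
    ultimately have "P x \<le> (cos a + 4 * x) * (cos (\<phi> x) * cos (\<alpha> x))"
      unfolding P_def by (rule mult_right_mono)
    with P_early[OF x] have "P 0 / 2 \<le> (cos a + 4 * x) * (cos (\<phi> x) * cos (\<alpha> x))" by simp
    then show "0 \<le> cos (\<phi> x) * cos (\<alpha> x) - P 0 / 2 / (cos a + 4 * x)"
      using pos by (simp add: pos_divide_le_eq[OF pos] del: divide_divide_eq_left) (simp add: algebra_simps)
  qed (use r in auto)
  then have low: "P 0 / 8 * (ln (cos a + 2 * c) - ln (cos a)) \<le> z r"
    by (simp add: z_def init r_def algebra_simps)
  have P0_pos: "0 < P 0" using ca by (simp add: P0)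
  have "1 * (c * z r) \<le> (2 * real m + 1) * (c * z r)"
    using c0 z_nonneg[of r] r by (intro mult_right_mono) auto
  then have "c * z r \<le> P 0" using zr by (simp only: mult.assoc mult_1)
  then have "z r \<le> P 0 / c" using c0 by (simp add: le_divide_eq mult.commute)
  also have "\<dots> = P 0 / 8 * (8 / c)" by simp
  also have "\<dots> < P 0 / 8 * (ln (cos a + 2 * c) - ln (cos a))"
    using P0_pos large by (intro mult_strict_left_mono) auto
  finally show False using low by simp
qed

text \<open>The crossing is transversal: at a right angle the equation reduces to
  \<open>\<alpha>' = (2 m + 1) tan \<phi> > 0\<close>. Passing strictly beyond the right angle turns
  the event into an open condition on the start.\<close>

lemma \<alpha>_exceeds:
  assumes s: "inside_until S" "0 < S" and \<alpha>: "\<alpha> S = pi / 2" and \<psi>: "0 < \<psi> S"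
  shows "\<exists>t>0. \<alpha> t > pi / 2 \<and> (\<forall>u. 0 \<le> u \<and> u \<le> t \<longrightarrow> 0 < \<psi> u)"
proof -
  have u: "0 \<le> S" "S \<le> S" using s by auto
  have "0 < tan (\<phi> S)"
    using \<phi>_pos[OF s(1,2)] closed_region[OF s(1) u] by (intro tan_gt_zero) auto
  then have "0 < (2 * real m + 1) * tan (\<phi> S) * sin (\<alpha> S)
         + 2 * real m * tan (\<psi> S) * cos (\<alpha> S) / cos (\<phi> S)" by (simp add: \<alpha>)
  from DERIV_pos_inc_right[OF \<alpha>_deriv[OF s(1) u] this]
  obtain d where d: "d > 0" "\<And>h. 0 < h \<Longrightarrow> h < d \<Longrightarrow> \<alpha> S < \<alpha> (S + h)" by auto
  have "isCont \<psi> S" using cont by (simp add: continuous_on_eq_continuous_at)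
  then obtain e where e: "e > 0" "\<And>x. \<bar>x - S\<bar> < e \<Longrightarrow> \<bar>\<psi> x - \<psi> S\<bar> < \<psi> S"
    using \<psi> unfolding continuous_at_eps_delta by (metis dist_real_def)
  define h where "h = min d e / 2"
  have h: "0 < h" "h < d" "h < e" using d e by (auto simp: h_def)
  have "0 < \<psi> u" if "0 \<le> u" "u \<le> S + h" for u
  proof (cases "u < S")
    case True
    then show ?thesis using s that by (auto simp: inside_until_def inside_def)
  next
    case False
    then show ?thesis using e(2)[of u] that h by auto
  qed
  then show ?thesis using d(2)[OF h(1,2)] \<alpha> h s by (intro exI[of _ "S + h"]) auto
qed

text \<open>At the diagonal \<open>sin \<alpha>\<close> is positive, so \<open>\<psi>\<close> does
  not merely touch zero but becomes negative, and this persists under small changes of the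
  start.\<close>

lemma \<psi>_crosses:
  assumes s: "inside_until S" "0 < S" and \<psi>: "\<psi> S = 0" and \<alpha>: "\<alpha> S < pi / 2"
  shows "\<exists>t>0. \<psi> t < 0 \<and> (\<forall>u. 0 \<le> u \<and> u \<le> t \<longrightarrow> \<alpha> u < pi / 2)"
proof -
  have u: "0 \<le> S" "S \<le> S" using s by auto
  have "- 2 * sin (\<alpha> S) / cos (\<phi> S) < 0"
    using sin_\<alpha>_pos[OF s] cos_region[OF s(1) u] by (simp add: divide_neg_pos)
  from DERIV_neg_dec_right[OF \<psi>_deriv[OF s(1) u] this]
  obtain d where d: "d > 0" "\<And>h. 0 < h \<Longrightarrow> h < d \<Longrightarrow> \<psi> S > \<psi> (S + h)" by auto
  have "isCont \<alpha> S" using cont by (simp add: continuous_on_eq_continuous_at)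
  then obtain e where e: "e > 0" "\<And>x. \<bar>x - S\<bar> < e \<Longrightarrow> \<bar>\<alpha> x - \<alpha> S\<bar> < pi / 2 - \<alpha> S"
    using \<alpha> unfolding continuous_at_eps_delta by (metis dist_real_def diff_gt_0_iff_gt)
  define h where "h = min d e / 2"
  have h: "0 < h" "h < d" "h < e" using d e by (auto simp: h_def)
  have "\<alpha> u < pi / 2" if "0 \<le> u" "u \<le> S + h" for u
  proof (cases "u < S")
    case True
    then show ?thesis using s that by (auto simp: inside_until_def inside_def)
  next
    case False
    then show ?thesis using e(2)[of u] that h by auto
  qed
  then show ?thesis using d(2)[OF h(1,2)] \<psi> h s by (intro exI[of _ "S + h"]) auto
qed

end

section \<open>Shooting\<close>

lemma norm_fst_diff_le: "norm (fst x - fst y) \<le> norm (x - y)"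
  and norm_snd_diff_le: "norm (snd x - snd y) \<le> norm (x - y)"
  using norm_fst_le[of "fst (x - y)" "snd (x - y)"] norm_snd_le[of "snd (x - y)" "fst (x - y)"]
  unfolding prod.collapse by simp_all

lemma bounded_lipschitz_sin: "bounded_lipschitz (sin :: real \<Rightarrow> real)"
  and bounded_lipschitz_cos: "bounded_lipschitz (cos :: real \<Rightarrow> real)"
proof -
  have "norm (sin x - sin y) \<le> 1 * norm (x - y)" for x y :: real
    by (rule field_differentiable_bound[of UNIV _ cos]) (auto intro!: derivative_eq_intros)
  moreover have "norm (cos x - cos y) \<le> 1 * norm (x - y)" for x y :: real
    by (rule field_differentiable_bound[of UNIV _ "\<lambda>x. - sin x"]) (auto intro!: derivative_eq_intros)
  ultimately show "bounded_lipschitz (sin :: real \<Rightarrow> real)" "bounded_lipschitz (cos :: real \<Rightarrow> real)"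
    by (auto intro!: bounded_lipschitzI[where B=1 and C=1])
qed

text \<open>The right-hand side of the profile equation, with \<open>\<phi>\<close> and
  \<open>\<psi>\<close> cut off wherever they enter a singular coefficient. Quotients are written as
  products with inverses so that the Lipschitz property can be checked factor by factor.\<close>

definition profile_field :: "nat \<Rightarrow> real \<Rightarrow> real \<times> real \<times> real \<Rightarrow> real \<times> real \<times> real" where
  "profile_field m \<Psi> x =
    (cos (snd (snd x)),
     - 2 * sin (snd (snd x)) * inverse (cos (clamp_abs (pi / 4) (fst x))),
     (2 * real m + 1) * tan (clamp_abs (pi / 4) (fst x)) * sin (snd (snd x))
       + 2 * real m * tan (clamp_abs \<Psi> (fst (snd x))) * cos (snd (snd x)) * inverse (cos (clamp_abs (pi / 4) (fst x))))"

lemma profile_field_lipschitz: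
  assumes "0 \<le> \<Psi>" "\<Psi> < pi / 2"
  obtains K M where "K > 0" "\<And>x y. norm (profile_field m \<Psi> x - profile_field m \<Psi> y) \<le> K * norm (x - y)"
    "\<And>x. norm (profile_field m \<Psi> x) \<le> M"
proof -
  have tan: "bounded_lipschitz (\<lambda>x. tan (clamp_abs c x))"
    and inv: "bounded_lipschitz (\<lambda>x. inverse (cos (clamp_abs c x)))" if c: "0 \<le> c" "c < pi / 2" for c
  proof -
    have pos: "0 < cos x" if "\<bar>x\<bar> \<le> c" for x using that c by (intro cos_pos_of_abs_less) auto
    then have nz: "cos x \<noteq> 0" if "x \<in> {-c..c}" for x using that by (metis abs_le_iff atLeastAtMost_iff less_irrefl minus_le_iff)
    show "bounded_lipschitz (\<lambda>x. tan (clamp_abs c x))"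
      by (rule bounded_lipschitz_clamp[where g'="\<lambda>x. inverse ((cos x)\<^sup>2)"])
        (use c pos nz in \<open>force intro!: DERIV_tan continuous_intros\<close>)+
    show "bounded_lipschitz (\<lambda>x. inverse (cos (clamp_abs c x)))"
      by (rule bounded_lipschitz_clamp[where g="\<lambda>x. inverse (cos x)" and g'="\<lambda>x. - (inverse (cos x) * (- sin x) * inverse (cos x))"])
        (use c pos nz in \<open>force intro!: derivative_eq_intros continuous_intros\<close>)+
  qed
  have p1: "bounded_lipschitz (\<lambda>x. g (fst x))" and p2: "bounded_lipschitz (\<lambda>x. g (fst (snd x)))"
    and p3: "bounded_lipschitz (\<lambda>x. g (snd (snd x)))" if "bounded_lipschitz g"
    for g :: "real \<Rightarrow> real"
    by (rule bounded_lipschitz_compose[OF that], rule norm_fst_diff_le)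
      (rule bounded_lipschitz_compose[OF that], rule order_trans[OF norm_fst_diff_le norm_snd_diff_le],
       rule bounded_lipschitz_compose[OF that], rule order_trans[OF norm_snd_diff_le norm_snd_diff_le])
  have "bounded_lipschitz (profile_field m \<Psi>)"
    unfolding profile_field_def[abs_def]
    by (intro bounded_lipschitz_Pair bounded_lipschitz_add bounded_lipschitz_mult bounded_lipschitz_const
        p1 p2 p3
        tan inv bounded_lipschitz_sin bounded_lipschitz_cos) (use assms in auto)
  then obtain B where B: "B \<ge> 0" "\<And>x. norm (profile_field m \<Psi> x) \<le> B"
    "\<And>x y. norm (profile_field m \<Psi> x - profile_field m \<Psi> y) \<le> B * norm (x - y)"
    unfolding bounded_lipschitz_def by blast
  have "norm (profile_field m \<Psi> x - profile_field m \<Psi> y) \<le> (B + 1) * norm (x - y)" for x y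
    using B(3)[of x y] norm_ge_zero[of "x - y"] by (simp only: distrib_right)
  then show ?thesis using that[of "B + 1" B] B by simp
qed

lemma profile_field_components:
  assumes "\<And>t. (X has_vector_derivative profile_field m \<Psi> (X t)) (at t)"
  shows "((\<lambda>t. fst (X t)) has_real_derivative cos (snd (snd (X t)))) (at t)"
    and "\<bar>fst (X t)\<bar> \<le> pi / 4 \<Longrightarrow>
      ((\<lambda>t. fst (snd (X t))) has_real_derivative - 2 * sin (snd (snd (X t))) / cos (fst (X t))) (at t)"
    and "\<bar>fst (X t)\<bar> \<le> pi / 4 \<Longrightarrow> \<bar>fst (snd (X t))\<bar> \<le> \<Psi> \<Longrightarrow>
      ((\<lambda>t. snd (snd (X t))) has_real_derivative
        (2 * real m + 1) * tan (fst (X t)) * sin (snd (snd (X t)))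
         + 2 * real m * tan (fst (snd (X t))) * cos (snd (snd (X t))) / cos (fst (X t))) (at t)"
proof -
  note D = bounded_linear.has_vector_derivative[OF _ assms]
  show "((\<lambda>t. fst (X t)) has_real_derivative cos (snd (snd (X t)))) (at t)"
    using D[OF bounded_linear_fst, of t]
    by (simp add: has_real_derivative_iff_has_vector_derivative profile_field_def)
  show "((\<lambda>t. fst (snd (X t))) has_real_derivative - 2 * sin (snd (snd (X t))) / cos (fst (X t))) (at t)"
    if "\<bar>fst (X t)\<bar> \<le> pi / 4"
    using D[OF bounded_linear_compose[OF bounded_linear_fst bounded_linear_snd], of t] that
    by (simp add: has_real_derivative_iff_has_vector_derivative profile_field_def clamp_abs_eq field_simps)
  show "((\<lambda>t. snd (snd (X t))) has_real_derivative
        (2 * real m + 1) * tan (fst (X t)) * sin (snd (snd (X t)))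
         + 2 * real m * tan (fst (snd (X t))) * cos (snd (snd (X t))) / cos (fst (X t))) (at t)"
    if "\<bar>fst (X t)\<bar> \<le> pi / 4" "\<bar>fst (snd (X t))\<bar> \<le> \<Psi>"
    using D[OF bounded_linear_compose[OF bounded_linear_snd bounded_linear_snd], of t] that
    by (simp add: has_real_derivative_iff_has_vector_derivative profile_field_def clamp_abs_eq field_simps)
qed

lemma trajectoryI:
  assumes m: "1 \<le> m" and "\<Psi> < pi / 2" "0 < a" "a < \<Psi>" and X0: "X 0 = (0, a, 0)"
    and X: "\<And>t. (X has_vector_derivative profile_field m \<Psi> (X t)) (at t)"
  shows "trajectory m \<Psi> a (\<lambda>t. fst (X t)) (\<lambda>t. fst (snd (X t))) (\<lambda>t. snd (snd (X t)))"
proof -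
  have "continuous_on UNIV X"
    by (intro continuous_at_imp_continuous_on ballI has_vector_derivative_continuous[OF X])
  then show ?thesis
    by unfold_locales
      (use assms(1-4) X0 profile_field_components[OF X] in \<open>auto intro!: continuous_intros\<close>)
qed

text \<open>The strict inequalities hold with a margin \<open>e\<close>, uniformly on the compact
  time interval. By Gronwall's bound, solutions that start within \<open>e * exp (- (K * t))\<close>
  stay within this margin up to time \<open>t\<close>, and \<open>g\<close> and \<open>h\<close> do
  not enlarge distances.\<close>

lemma open_crossing_set:
  fixes F :: "'a::euclidean_space \<Rightarrow> 'a" and i :: "real \<Rightarrow> 'a" and g h :: "'a \<Rightarrow> real"
  assumes lip: "\<And>x y. norm (F x - F y) \<le> K * norm (x - y)" and K: "K > 0"
    and X: "\<And>a t. (X a has_vector_derivative F (X a t)) (at t)"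
    and X0: "\<And>a b. norm (X a 0 - X b 0) \<le> \<bar>a - b\<bar>"
    and g: "\<And>x y. \<bar>g x - g y\<bar> \<le> norm (x - y)" and h: "\<And>x y. \<bar>h x - h y\<bar> \<le> norm (x - y)"
  shows "open {a :: real. \<exists>t>0. g (X a t) < 0 \<and> (\<forall>u. 0 \<le> u \<and> u \<le> t \<longrightarrow> h (X a u) < 0)}" (is "open ?A")
  unfolding open_dist
proof
  fix a assume "a \<in> ?A"
  then obtain t where t: "t > 0" "g (X a t) < 0" "\<And>u. 0 \<le> u \<Longrightarrow> u \<le> t \<Longrightarrow> h (X a u) < 0" by auto
  have "continuous_on {0..t} (X a)"
    by (intro continuous_at_imp_continuous_on ballI has_vector_derivative_continuous[OF X])
  moreover have "continuous_on UNIV h"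
    by (rule lipschitz_on_continuous_on[where L=1]) (use h in \<open>auto intro!: lipschitz_onI simp: dist_norm\<close>)
  ultimately have "continuous_on {0..t} (\<lambda>u. h (X a u))"
    using continuous_on_compose2 by blast
  then obtain u0 where u0: "u0 \<in> {0..t}" "\<And>u. u \<in> {0..t} \<Longrightarrow> h (X a u) \<le> h (X a u0)"
    using continuous_attains_sup[of "{0..t}" "\<lambda>u. h (X a u)"] t(1) by auto
  define e where "e = min (- g (X a t)) (- h (X a u0))"
  have e: "e > 0" using t u0 by (auto simp: e_def)
  have "b \<in> ?A" if b: "dist b a < e * exp (- (K * t))" for b
  proof -
    have close: "norm (X b u - X a u) < e" if u: "0 \<le> u" "u \<le> t" for u
    proof -
      have "norm (X b u - X a u) \<le> exp (K * u) * norm (X b 0 - X a 0)"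
        by (rule ode_gronwall[OF lip X X u(1)])
      also have "\<dots> \<le> exp (K * t) * \<bar>b - a\<bar>"
        using u K X0 by (intro mult_mono) auto
      also have "\<dots> < exp (K * t) * (e * exp (- (K * t)))"
        using b by (intro mult_strict_left_mono) (auto simp: dist_real_def)
      finally show ?thesis by (simp add: exp_minus field_simps)
    qed
    have "g (X b t) < 0" using close[of t] g[of "X b t" "X a t"] t by (auto simp: e_def)
    moreover have "h (X b u) < 0" if u: "0 \<le> u" "u \<le> t" for u
      using close[OF u] h[of "X b u" "X a u"] u0(2)[of u] u by (auto simp: e_def)
    ultimately show ?thesis using t(1) by blast
  qed
  then show "\<exists>e>0. \<forall>y. dist y a < e \<longrightarrow> y \<in> ?A"
    using e by (intro exI[of _ "e * exp (- (K * t))"]) auto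
qed

section \<open>The two extreme starting values\<close>

lemma near_right_angle:
  fixes c :: real
  assumes "c > 0"
  obtains a where "3 / 2 \<le> a" "a < pi / 2" "8 / c < ln (cos a + 2 * c) - ln (cos a)"
proof -
  have c32: "0 < cos (3 / 2 :: real)" using pi_gt3 by (intro cos_gt_zero) auto
  \<comment> \<open>The angle will be \<open>arccos \<epsilon>\<close>. The bound
    \<open>cos (3 / 2)\<close> makes it at least \<open>3 / 2\<close>; the other one gives
    \<open>ln c - ln \<epsilon> \<ge> 8 / c\<close>, which becomes strict on replacing
    \<open>c\<close> by \<open>\<epsilon> + 2 * c\<close>.\<close>
  define \<epsilon> where "\<epsilon> = min (cos (3 / 2)) (c * exp (- (8 / c)))"
  have \<epsilon>: "0 < \<epsilon>" "\<epsilon> \<le> 1" using c32 assms by (auto simp: \<epsilon>_def min_le_iff_disj)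
  have "ln \<epsilon> \<le> ln (c * exp (- (8 / c)))" using \<epsilon> assms by (subst ln_le_cancel_iff) (auto simp: \<epsilon>_def)
  also have "\<dots> = ln c - 8 / c" using assms by (simp add: ln_mult)
  finally have "ln \<epsilon> \<le> ln c - 8 / c" .
  moreover have "ln c < ln (\<epsilon> + 2 * c)" using assms \<epsilon> by (subst ln_less_cancel_iff) auto
  moreover have "cos (arccos \<epsilon>) = \<epsilon>" using \<epsilon> by (intro cos_arccos) auto
  moreover have "arccos (cos (3 / 2)) \<le> arccos \<epsilon>" using \<epsilon> by (intro arccos_le_arccos) (auto simp: \<epsilon>_def)
  moreover have "arccos (cos (3 / 2)) = 3 / 2" using pi_gt3 by (intro arccos_cos) auto
  moreover have "arccos \<epsilon> < arccos 0" using \<epsilon> by (intro arccos_less_arccos) auto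
  ultimately show ?thesis by (intro that[of "arccos \<epsilon>"]) (auto simp: arccos_0)
qed

lemma near_zero_angle:
  assumes "(0::real) < b"
  obtains a where "0 < a" "a \<le> b" "6 * real m * tan a < (cos a / 2) ^ m / 2"
proof -
  have "((\<lambda>a. (cos a / 2) ^ m / 2 - 6 * real m * tan a) \<longlongrightarrow> (cos 0 / 2) ^ m / 2 - 6 * real m * tan (0::real)) (at_right 0)"
    by (intro tendsto_intros) auto
  then have "eventually (\<lambda>a. 0 < (cos a / 2) ^ m / 2 - 6 * real m * tan a) (at_right (0::real))"
    by (rule order_tendstoD(1)) simp
  moreover have "eventually (\<lambda>a. a \<in> {0<..<b}) (at_right 0)"
    using assms by (rule eventually_at_right_real)
  ultimately have "eventually (\<lambda>a. a \<in> {0<..<b} \<and> 0 < (cos a / 2) ^ m / 2 - 6 * real m * tan a) (at_right (0::real))"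
    by (rule eventually_conj[rotated])
  then obtain a where "a \<in> {0<..<b}" "0 < (cos a / 2) ^ m / 2 - 6 * real m * tan a"
    using eventually_happens'[OF trivial_limit_at_right_real] by blast
  then show ?thesis by (intro that[of a]) auto
qed

text \<open>The starting values for which \<open>\<psi>\<close> vanishes before \<open>\<alpha>\<close> reaches a right angle, and those for which
  it is the other way round, form two disjoint nonempty open sets; so they do not exhaust an interval.\<close>

theorem shooting:
  assumes m: "1 \<le> m"
  obtains \<Psi> a X S where "0 < \<Psi>" "\<Psi> < pi / 2" "0 < a" "a < \<Psi>" "X 0 = (0, a, 0)"
    "\<And>t. (X has_vector_derivative profile_field m \<Psi> (X t)) (at t)"
    "0 < S" "trajectory.inside_until \<Psi> (\<lambda>t. fst (X t)) (\<lambda>t. fst (snd (X t))) (\<lambda>t. snd (snd (X t))) S"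
    "fst (snd (X S)) = 0" "snd (snd (X S)) = pi / 2"
proof -
  define c :: real where "c = (1 / 4) ^ m / 8"
  obtain a1 where a1: "3 / 2 \<le> a1" "a1 < pi / 2" "8 / c < ln (cos a1 + 2 * c) - ln (cos a1)"
    using near_right_angle[of c] by (auto simp: c_def)
  obtain a0 where a0: "0 < a0" "a0 \<le> a1" "6 * real m * tan a0 < (cos a0 / 2) ^ m / 2"
    using near_zero_angle[of a1 m] a1 by auto
  \<comment> \<open>A single cut-off above \<open>a1\<close> serves all starting values up to
    \<open>a1\<close>, so all trajectories solve the same equation and Gronwall's bound can compare
    them.\<close>
  define \<Psi> where "\<Psi> = (a1 + pi / 2) / 2"
  have \<Psi>: "0 < \<Psi>" "\<Psi> < pi / 2" "a1 < \<Psi>" using a1 by (auto simp: \<Psi>_def field_simps)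
  obtain K M where K: "K > 0"
    and lip: "\<And>x y. norm (profile_field m \<Psi> x - profile_field m \<Psi> y) \<le> K * norm (x - y)"
    and bdd: "\<And>x. norm (profile_field m \<Psi> x) \<le> M"
    using profile_field_lipschitz[of \<Psi> m] \<Psi> by (metis less_imp_le)
  have "\<forall>a. \<exists>X. X 0 = (0, a, 0) \<and> (\<forall>t. (X has_vector_derivative profile_field m \<Psi> (X t)) (at t))"
    using ode_global_solution[OF lip bdd K] by blast
  then obtain X where X0: "\<And>a. X a 0 = (0, a, 0)"
    and X: "\<And>a t. (X a has_vector_derivative profile_field m \<Psi> (X a t)) (at t)"
    by metis
  define \<phi> \<psi> \<alpha> where "\<phi> a t = fst (X a t)" and "\<psi> a t = fst (snd (X a t))" and "\<alpha> a t = snd (snd (X a t))" for a t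
  have traj: "trajectory m \<Psi> a (\<phi> a) (\<psi> a) (\<alpha> a)" if "0 < a" "a < \<Psi>" for a
    using trajectoryI[of m \<Psi> a "X a", OF m \<Psi>(2) that X0 X] by (simp add: \<phi>_def[abs_def] \<psi>_def[abs_def] \<alpha>_def[abs_def])
  define A where "A = {a. \<exists>t>0. \<psi> a t < 0 \<and> (\<forall>u. 0 \<le> u \<and> u \<le> t \<longrightarrow> \<alpha> a u - pi / 2 < 0)}"
  define B where "B = {a. \<exists>t>0. pi / 2 - \<alpha> a t < 0 \<and> (\<forall>u. 0 \<le> u \<and> u \<le> t \<longrightarrow> - \<psi> a u < 0)}"
  have le2: "\<bar>fst (snd x) - fst (snd y)\<bar> \<le> norm (x - y)" and le3: "\<bar>snd (snd x) - snd (snd y)\<bar> \<le> norm (x - y)"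
    for x y :: "real \<times> real \<times> real"
    using order_trans[OF norm_fst_diff_le norm_snd_diff_le] order_trans[OF norm_snd_diff_le norm_snd_diff_le]
    by (metis real_norm_def)+
  have opA: "open A"
    unfolding A_def \<psi>_def \<alpha>_def
    by (rule open_crossing_set[OF lip K X, where g="\<lambda>x. fst (snd x)" and h="\<lambda>x. snd (snd x) - pi / 2"])
      (auto simp: X0 norm_Pair le2 le3)
  have opB: "open B"
    unfolding B_def \<psi>_def \<alpha>_def
    by (rule open_crossing_set[OF lip K X, where g="\<lambda>x. pi / 2 - snd (snd x)" and h="\<lambda>x. - fst (snd x)"])
      (use le2 le3 in \<open>auto simp: X0 norm_Pair abs_minus_commute\<close>)
  \<comment> \<open>If both events occurred, the side condition of the later one would fail at the
    time of the earlier one.\<close>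
  have disj: "A \<inter> B = {}"
  proof -
    have False if aA: "a \<in> A" and aB: "a \<in> B" for a
    proof -
      obtain t where t: "t > 0 \<and> \<psi> a t < 0 \<and> (\<forall>u. 0 \<le> u \<and> u \<le> t \<longrightarrow> \<alpha> a u - pi / 2 < 0)"
        using aA unfolding A_def by blast
      obtain r where r: "r > 0 \<and> pi / 2 - \<alpha> a r < 0 \<and> (\<forall>u. 0 \<le> u \<and> u \<le> r \<longrightarrow> - \<psi> a u < 0)"
        using aB unfolding B_def by blast
      have "t \<le> r \<Longrightarrow> - \<psi> a t < 0" "r \<le> t \<Longrightarrow> \<alpha> a r - pi / 2 < 0" using t r by simp_all
      then show False using t r by (cases "t \<le> r") auto
    qed
    then show ?thesis by blast
  qed
  have exit: "\<exists>S>0. trajectory.inside_until \<Psi> (\<phi> a) (\<psi> a) (\<alpha> a) S \<and> (\<psi> a S = 0 \<or> \<alpha> a S = pi / 2)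
      \<and> \<psi> a S \<ge> 0 \<and> \<alpha> a S \<le> pi / 2" if "0 < a" "a < \<Psi>" for a
  proof -
    interpret trajectory m \<Psi> a "\<phi> a" "\<psi> a" "\<alpha> a" by (rule traj[OF that])
    obtain S where S: "0 < S" "inside_until S" "\<not> inside S" using exit_time by blast
    then show ?thesis using exit_cases[OF S(2,1,3)] closed_region[OF S(2), of S] by auto
  qed
  have inA: "a \<in> A" if "0 < a" "a < \<Psi>" and S: "0 < S" "trajectory.inside_until \<Psi> (\<phi> a) (\<psi> a) (\<alpha> a) S"
    "\<psi> a S = 0" "\<alpha> a S < pi / 2" for a S
  proof -
    interpret trajectory m \<Psi> a "\<phi> a" "\<psi> a" "\<alpha> a" by (rule traj[OF that(1,2)])
    show ?thesis using \<psi>_crosses[OF S(2,1,3,4)] by (auto simp: A_def)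
  qed
  have inB: "a \<in> B" if "0 < a" "a < \<Psi>" and S: "0 < S" "trajectory.inside_until \<Psi> (\<phi> a) (\<psi> a) (\<alpha> a) S"
    "\<alpha> a S = pi / 2" "0 < \<psi> a S" for a S
  proof -
    interpret trajectory m \<Psi> a "\<phi> a" "\<psi> a" "\<alpha> a" by (rule traj[OF that(1,2)])
    show ?thesis using \<alpha>_exceeds[OF S(2,1,3,4)] by (auto simp: B_def)
  qed
  have "a0 \<in> A"
  proof -
    have a: "0 < a0" "a0 < \<Psi>" using a0 \<Psi> by auto
    interpret trajectory m \<Psi> a0 "\<phi> a0" "\<psi> a0" "\<alpha> a0" by (rule traj[OF a])
    obtain S where S: "S > 0" "inside_until S" "\<psi> a0 S = 0 \<or> \<alpha> a0 S = pi / 2" using exit[OF a] by blast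
    have "\<alpha> a0 S < pi / 2" by (rule exit_\<alpha>_less[OF S(2) a0(3)])
    with S show ?thesis by (intro inA[OF a S(1,2)]) auto
  qed
  moreover have "a1 \<in> B"
  proof -
    have a: "0 < a1" "a1 < \<Psi>" using a0 \<Psi> by auto
    interpret trajectory m \<Psi> a1 "\<phi> a1" "\<psi> a1" "\<alpha> a1" by (rule traj[OF a])
    obtain S where S: "S > 0" "inside_until S" "\<psi> a1 S = 0 \<or> \<alpha> a1 S = pi / 2" using exit[OF a] by blast
    have "0 < \<psi> a1 S" by (rule exit_\<psi>_pos[OF S(2) a1(1) c_def a1(3)])
    with S show ?thesis by (intro inB[OF a S(1,2)]) auto
  qed
  ultimately have "\<not> {a0..a1} \<subseteq> A \<union> B"
  proof -
    assume "a0 \<in> A" "a1 \<in> B"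
    moreover have "a0 \<in> {a0..a1}" "a1 \<in> {a0..a1}" using a0 by auto
    ultimately show ?thesis using connectedD[OF connected_Icc opA opB, of a0 a1] disj by blast
  qed
  then obtain a where a: "a0 \<le> a" "a \<le> a1" "a \<notin> A" "a \<notin> B"
    unfolding subset_iff Un_iff atLeastAtMost_iff by blast
  then have a': "0 < a" "a < \<Psi>" using a0 \<Psi> by auto
  obtain S where S: "S > 0" "trajectory.inside_until \<Psi> (\<phi> a) (\<psi> a) (\<alpha> a) S" "\<psi> a S = 0 \<or> \<alpha> a S = pi / 2"
    "\<psi> a S \<ge> 0" "\<alpha> a S \<le> pi / 2" using exit[OF a'] by blast
  \<comment> \<open>At the exit at least one of the equalities holds; if only one did,
    \<open>a\<close> would lie in \<open>A\<close> or in \<open>B\<close>.\<close>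
  have "\<psi> a S = 0" "\<alpha> a S = pi / 2"
    using S inA[OF a' S(1,2)] inB[OF a' S(1,2)] a(3,4) by force+
  then show ?thesis
    using S(1,2) that[of \<Psi> a "X a" S, OF \<Psi>(1,2) a' X0 X] unfolding \<phi>_def[abs_def] \<psi>_def[abs_def] \<alpha>_def[abs_def] by simp
qed

section \<open>The closed profile curve\<close>

lemma profile_field_reflect:
  "profile_field m \<Psi> (- p, q, - r) = (- fst (- profile_field m \<Psi> (p, q, r)),
     fst (snd (- profile_field m \<Psi> (p, q, r))), - snd (snd (- profile_field m \<Psi> (p, q, r))))"
  by (simp add: profile_field_def clamp_abs_minus)

lemma profile_field_reflect':
  assumes "0 \<le> \<Psi>"
  shows "profile_field m \<Psi> (p, - q, pi - r) = (fst (- profile_field m \<Psi> (p, q, r)),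
     - fst (snd (- profile_field m \<Psi> (p, q, r))), - snd (snd (- profile_field m \<Psi> (p, q, r))))"
  using assms by (simp add: profile_field_def clamp_abs_minus)

text \<open>Each reflection combined with time reversal preserves the equation. The first fixes
  \<open>X 0\<close> and the second fixes \<open>X S\<close>, which is the meaning of the two
  orthogonality conditions, so uniqueness identifies each reflected solution with
  \<open>X\<close>.\<close>

lemma profile_solution_symmetric:
  assumes \<Psi>: "0 \<le> \<Psi>" "\<Psi> < pi / 2"
    and X: "\<And>t. (X has_vector_derivative profile_field m \<Psi> (X t)) (at t)"
    and X0: "X 0 = (0, a, 0)" and XS: "fst (snd (X S)) = 0" "snd (snd (X S)) = pi / 2"
  shows "X (- t) = (- fst (X t), fst (snd (X t)), - snd (snd (X t)))"
    and "X (2 * S - t) = (fst (X t), - fst (snd (X t)), pi - snd (snd (X t)))"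
proof -
  obtain K M where lip: "\<And>x y. norm (profile_field m \<Psi> x - profile_field m \<Psi> y) \<le> K * norm (x - y)"
    using profile_field_lipschitz[OF \<Psi>] by metis
  have L1: "bounded_linear (\<lambda>p::real \<times> real \<times> real. (- fst p, fst (snd p), - snd (snd p)))"
    and L2: "bounded_linear (\<lambda>p::real \<times> real \<times> real. (fst p, - fst (snd p), - snd (snd p)))"
    by (intro bounded_linear_Pair bounded_linear_minus bounded_linear_fst bounded_linear_snd
        bounded_linear_compose[OF bounded_linear_fst bounded_linear_snd]
        bounded_linear_compose[OF bounded_linear_snd bounded_linear_snd])+
  define Y where "Y t = (- fst (X (0 - t)), fst (snd (X (0 - t))), - snd (snd (X (0 - t))))" for t
  have "(Y has_vector_derivative profile_field m \<Psi> (Y t)) (at t)" for t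
    unfolding Y_def[abs_def] profile_field_reflect
    using bounded_linear.has_vector_derivative[OF L1 has_vector_derivative_reflect[where c=0, OF X]]
    by simp
  then have "Y = X"
    using X by (intro ode_unique[OF lip, of Y X 0]) (auto simp: Y_def X0)
  then have "Y (- t) = X (- t)" by simp
  then show "X (- t) = (- fst (X t), fst (snd (X t)), - snd (snd (X t)))" by (simp add: Y_def)
  \<comment> \<open>The reflection \<open>\<alpha> \<mapsto> pi - \<alpha>\<close> is affine; its
    constant part is split off so that the rest is a bounded linear map.\<close>
  define Z where "Z t = (fst (X (2 * S - t)), - fst (snd (X (2 * S - t))), - snd (snd (X (2 * S - t)))) + (0, 0, pi)" for t
  have Z: "Z t = (fst (X (2 * S - t)), - fst (snd (X (2 * S - t))), pi - snd (snd (X (2 * S - t))))" for t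
    by (simp add: Z_def)
  have "(Z has_vector_derivative profile_field m \<Psi> (Z t)) (at t)" for t
  proof -
    have eq: "profile_field m \<Psi> (Z t) = (fst (- profile_field m \<Psi> (X (2 * S - t))),
        - fst (snd (- profile_field m \<Psi> (X (2 * S - t)))), - snd (snd (- profile_field m \<Psi> (X (2 * S - t)))))"
      unfolding Z profile_field_reflect'[OF \<Psi>(1)] prod.collapse ..
    show ?thesis
      unfolding eq unfolding Z_def[abs_def] has_vector_derivative_add_const
      by (rule bounded_linear.has_vector_derivative[OF L2 has_vector_derivative_reflect[where c="2 * S", OF X]])
  qed
  then have "Z = X"
    using X XS by (intro ode_unique[OF lip, of Z X S]) (auto simp: Z prod_eq_iff)
  then have "Z (2 * S - t) = X (2 * S - t)" by simp
  then show "X (2 * S - t) = (fst (X t), - fst (snd (X t)), pi - snd (snd (X t)))" by (simp add: Z)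
qed

text \<open>Meant for the property of staying below the cut-offs, which is invariant under this
  translation although the angles themselves are not. Subtracting the nearest multiple of
  \<open>c\<close> moves any time into the symmetric interval around \<open>0\<close>.\<close>

lemma shift_by_double_int:
  fixes P :: "real \<Rightarrow> bool"
  assumes shift: "\<And>t. P (t + c) \<longleftrightarrow> P t" and c: "c > 0" and P: "\<And>t. \<bar>t\<bar> \<le> c / 2 \<Longrightarrow> P t"
  shows "P t"
proof -
  have nat: "P (t + real n * c) \<longleftrightarrow> P t" for n t
    by (induction n) (use shift[of "t + real n * c" for n] in \<open>auto simp: algebra_simps\<close>)
  have int: "P (t + of_int k * c) \<longleftrightarrow> P t" for k t
    using nat[of t "nat k"] nat[of "t + of_int k * c" "nat (- k)"] by (cases "0 \<le> k") auto
  have "\<bar>of_int (round (t / c)) - t / c\<bar> \<le> 1 / 2" by (rule of_int_round_abs_le)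
  then have "c * \<bar>of_int (round (t / c)) - t / c\<bar> \<le> c * (1 / 2)"
    using c by (intro mult_left_mono) auto
  moreover have "t - of_int (round (t / c)) * c = - c * (of_int (round (t / c)) - t / c)"
    using c by (simp add: field_simps)
  ultimately have "\<bar>t - of_int (round (t / c)) * c\<bar> \<le> c / 2"
    using c by (simp add: abs_mult)
  then have "P (t - of_int (round (t / c)) * c)" by (rule P)
  then show ?thesis using int[of "t - of_int (round (t / c)) * c" "round (t / c)"] by simp
qed

section \<open>Periodic functions shaped like the sine\<close>

lemma periodic_eq_if_same_angle:
  fixes f :: "real \<Rightarrow> 'a"
  assumes per: "\<And>t. f (t + 2 * pi) = f t" and st: "cos s = cos t" "sin s = sin t"
  shows "f s = f t"
proof -
  have nat: "f (t + 2 * pi * real n) = f t" for n t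
    by (induction n) (use per[of "t + 2 * pi * real n" for n] in \<open>auto simp: algebra_simps\<close>)
  have int: "f (t + 2 * pi * of_int k) = f t" for k t
    using nat[of t "nat k"] nat[of "t + 2 * pi * of_int k" "nat (- k)"] by (cases "0 \<le> k") auto
  obtain k :: int where "s = t + 2 * pi * k" using sin_cos_eq_iff[of s t] st by auto
  then show ?thesis using int by simp
qed

text \<open>The symmetries give \<open>f (t + pi) = - f t\<close>, hence the period
  \<open>2 * pi\<close> and \<open>f t = f (arcsin (sin t))\<close>. By oddness \<open>f\<close> is
  strictly increasing from \<open>- pi / 2\<close> to \<open>pi / 2\<close>, an interval that
  contains all values of \<open>arcsin\<close>.\<close>

lemma sine_like_inj:
  fixes f :: "real \<Rightarrow> real"
  assumes odd: "\<And>t. f (- t) = - f t" and sym: "\<And>t. f (pi - t) = f t"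
    and mono: "\<And>s t. 0 \<le> s \<Longrightarrow> s < t \<Longrightarrow> t \<le> pi / 2 \<Longrightarrow> f s < f t"
    and eq: "f s = f t"
  shows "sin s = sin t"
proof -
  have per: "f (t + 2 * pi) = f t" for t
  proof -
    have h: "f (t + pi) = - f t" for t using sym[of "- t"] odd[of t] by (simp add: add.commute)
    show ?thesis using h[of "t + pi"] h[of t] by (simp add: add.assoc)
  qed
  have arc: "f (arcsin (sin t)) = f t" for t
  proof -
    let ?a = "arcsin (sin t)"
    have s: "sin ?a = sin t" by simp
    then have "(cos ?a)\<^sup>2 = (cos t)\<^sup>2" by (simp add: cos_squared_eq)
    then consider "cos ?a = cos t" | "cos ?a = cos (pi - t)" by (auto simp: power2_eq_iff)
    then show ?thesis
    proof cases
      case 1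
      then show ?thesis using periodic_eq_if_same_angle[of f, OF per] s by blast
    next
      case 2
      then have "f ?a = f (pi - t)" using periodic_eq_if_same_angle[of f, OF per] s by simp
      then show ?thesis by (simp add: sym)
    qed
  qed
  have f0: "f 0 = 0" using odd[of 0] by simp
  have mono': "f u < f v" if "- (pi / 2) \<le> u" "u < v" "v \<le> pi / 2" for u v
  proof -
    consider "0 \<le> u" | "v \<le> 0" | "u < 0" "0 < v" by linarith
    then show ?thesis
    proof cases
      case 1
      then show ?thesis using mono that by simp
    next
      case 2
      then show ?thesis using mono[of "- v" "- u"] that by (simp add: odd)
    next
      case 3
      then show ?thesis using mono[of 0 "- u"] mono[of 0 v] that by (simp add: odd f0)
    qed
  qed
  have r: "- (pi / 2) \<le> arcsin (sin t)" "arcsin (sin t) \<le> pi / 2" for t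
    using arcsin_bounded[of "sin t"] by simp_all
  have "arcsin (sin s) = arcsin (sin t)"
  proof (rule ccontr)
    assume "arcsin (sin s) \<noteq> arcsin (sin t)"
    then have "f (arcsin (sin s)) \<noteq> f (arcsin (sin t))"
      using mono'[OF r(1) _ r(2), of s t] mono'[OF r(1) _ r(2), of t s] by (cases "arcsin (sin s) < arcsin (sin t)") auto
    then show False using eq by (simp add: arc)
  qed
  then have "sin (arcsin (sin s)) = sin (arcsin (sin t))" by simp
  then show ?thesis by simp
qed

text \<open>Time is rescaled so that the quarter arc takes time \<open>pi / 2\<close>. Then
  \<open>\<phi>\<close> has the symmetries of the sine, \<open>\<psi>\<close> those of the cosine,
  and the curve closes up after a full turn; \<open>\<kappa>\<close> is its constant speed.\<close>

locale closed_angles =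
  fixes m :: nat and \<kappa> :: real and \<phi> \<psi> \<alpha> :: "real \<Rightarrow> real"
  assumes \<kappa>: "0 < \<kappa>"
    and bounds: "\<bar>\<phi> t\<bar> < pi / 2" "\<bar>\<psi> t\<bar> < pi / 2"
    and \<phi>': "(\<phi> has_real_derivative \<kappa> * cos (\<alpha> t)) (at t)"
    and \<psi>': "(\<psi> has_real_derivative \<kappa> * (- 2 * sin (\<alpha> t) / cos (\<phi> t))) (at t)"
    and \<alpha>': "(\<alpha> has_real_derivative \<kappa> * ((2 * real m + 1) * tan (\<phi> t) * sin (\<alpha> t)
         + 2 * real m * tan (\<psi> t) * cos (\<alpha> t) / cos (\<phi> t))) (at t)"
    and reflect: "\<phi> (- t) = - \<phi> t" "\<psi> (- t) = \<psi> t" "\<alpha> (- t) = - \<alpha> t"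
    and reflect': "\<phi> (pi - t) = \<phi> t" "\<psi> (pi - t) = - \<psi> t" "\<alpha> (pi - t) = pi - \<alpha> t"
    and \<phi>_mono: "0 \<le> s \<Longrightarrow> s < t \<Longrightarrow> t \<le> pi / 2 \<Longrightarrow> \<phi> s < \<phi> t"
    and \<psi>_anti: "0 \<le> s \<Longrightarrow> s < t \<Longrightarrow> t \<le> pi / 2 \<Longrightarrow> \<psi> t < \<psi> s"

theorem closed_angles_exist:
  assumes m: "1 \<le> m"
  obtains \<kappa> \<phi> \<psi> \<alpha> where "closed_angles m \<kappa> \<phi> \<psi> \<alpha>"
proof -
  obtain \<Psi> a X S where Psi: "0 < \<Psi>" "\<Psi> < pi / 2" and a: "0 < a" "a < \<Psi>" and X0: "X 0 = (0, a, 0)"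
    and X: "\<And>t. (X has_vector_derivative profile_field m \<Psi> (X t)) (at t)"
    and S: "0 < S" "trajectory.inside_until \<Psi> (\<lambda>t. fst (X t)) (\<lambda>t. fst (snd (X t))) (\<lambda>t. snd (snd (X t))) S"
    and XS: "fst (snd (X S)) = 0" "snd (snd (X S)) = pi / 2"
    using shooting[OF m] by metis
  interpret trajectory m \<Psi> a "\<lambda>t. fst (X t)" "\<lambda>t. fst (snd (X t))" "\<lambda>t. snd (snd (X t))"
    by (rule trajectoryI[OF m Psi(2) a X0 X])
  note sym = profile_solution_symmetric[OF less_imp_le[OF Psi(1)] Psi(2) X X0 XS]
  define P where "P t \<longleftrightarrow> \<bar>fst (X t)\<bar> \<le> pi / 4 \<and> \<bar>fst (snd (X t))\<bar> \<le> \<Psi>" for t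
  have P: "P t" for t
  proof (rule shift_by_double_int[where c="2 * S"])
    have "P (2 * S - t) \<longleftrightarrow> P t" "P (- t) \<longleftrightarrow> P t" for t
      unfolding P_def sym by simp_all
    note * = this
    show "P (t + 2 * S) \<longleftrightarrow> P t" for t using *(1)[of "- t"] *(2)[of t] by (simp add: add.commute)
    fix t assume "\<bar>t\<bar> \<le> 2 * S / 2"
    then have "P \<bar>t\<bar>" using closed_region[OF S(2), of "\<bar>t\<bar>"] unfolding P_def by auto
    then show "P t" using *(2)[of t] by (cases "0 \<le> t") auto
  qed (use S in auto)
  \<comment> \<open>Chosen so that \<open>\<kappa> * (pi / 2) = S\<close>, the time at which the
    diagonal is met.\<close>
  define \<kappa> where "\<kappa> = 2 * S / pi"
  have \<kappa>: "0 < \<kappa>" "\<kappa> * pi = 2 * S" using S by (auto simp: \<kappa>_def)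
  have scale: "((\<lambda>t. g (\<kappa> * t)) has_real_derivative \<kappa> * d) (at t)"
    if "(g has_real_derivative d) (at (\<kappa> * t))" for g d t
    using DERIV_chain2[where f=g and g="\<lambda>t. \<kappa> * t", OF that DERIV_cmult_Id]
    by (simp only: mult.commute[of d])
  note D = profile_field_components[OF X]
  have le: "0 \<le> \<kappa> * s" "\<kappa> * s < \<kappa> * t" "\<kappa> * t \<le> S" if "0 \<le> s" "s < t" "t \<le> pi / 2" for s t
    using that \<kappa> mult_left_mono[of t "pi / 2" \<kappa>] by auto
  have "closed_angles m \<kappa> (\<lambda>t. fst (X (\<kappa> * t))) (\<lambda>t. fst (snd (X (\<kappa> * t)))) (\<lambda>t. snd (snd (X (\<kappa> * t))))"
  proof
    fix s t
    show "0 < \<kappa>" by (rule \<kappa>)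
    show "\<bar>fst (X (\<kappa> * t))\<bar> < pi / 2" "\<bar>fst (snd (X (\<kappa> * t)))\<bar> < pi / 2"
      using P[of "\<kappa> * t"] Psi unfolding P_def by auto
    show "((\<lambda>t. fst (X (\<kappa> * t))) has_real_derivative \<kappa> * cos (snd (snd (X (\<kappa> * t))))) (at t)"
      by (rule scale[OF D(1)])
    show "((\<lambda>t. fst (snd (X (\<kappa> * t)))) has_real_derivative
        \<kappa> * (- 2 * sin (snd (snd (X (\<kappa> * t)))) / cos (fst (X (\<kappa> * t))))) (at t)"
      using P[of "\<kappa> * t"] unfolding P_def by (intro scale[OF D(2)]) auto
    show "((\<lambda>t. snd (snd (X (\<kappa> * t)))) has_real_derivative
        \<kappa> * ((2 * real m + 1) * tan (fst (X (\<kappa> * t))) * sin (snd (snd (X (\<kappa> * t))))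
         + 2 * real m * tan (fst (snd (X (\<kappa> * t)))) * cos (snd (snd (X (\<kappa> * t)))) / cos (fst (X (\<kappa> * t))))) (at t)"
      using P[of "\<kappa> * t"] unfolding P_def by (intro scale[OF D(3)]) auto
    show "fst (X (\<kappa> * - t)) = - fst (X (\<kappa> * t))" "fst (snd (X (\<kappa> * - t))) = fst (snd (X (\<kappa> * t)))"
      "snd (snd (X (\<kappa> * - t))) = - snd (snd (X (\<kappa> * t)))"
      using sym(1)[of "\<kappa> * t"] by simp_all
    show "fst (X (\<kappa> * (pi - t))) = fst (X (\<kappa> * t))" "fst (snd (X (\<kappa> * (pi - t)))) = - fst (snd (X (\<kappa> * t)))"
      "snd (snd (X (\<kappa> * (pi - t)))) = pi - snd (snd (X (\<kappa> * t)))"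
      using sym(2)[of "\<kappa> * t"] \<kappa> by (simp_all add: right_diff_distrib)
    show "fst (X (\<kappa> * s)) < fst (X (\<kappa> * t))" "fst (snd (X (\<kappa> * t))) < fst (snd (X (\<kappa> * s)))"
      if "0 \<le> s" "s < t" "t \<le> pi / 2"
      using \<phi>_strict_mono[OF S(2) le[OF that]] \<psi>_strict_anti[OF S(2) le[OF that]] by simp_all
  qed
  then show ?thesis by (rule that)
qed

section \<open>Smoothness and simplicity of the closed curve\<close>

lemma Ck_on_smooth_compose:
  fixes g :: "'b::euclidean_space \<Rightarrow> 'c::real_normed_vector"
  assumes "open U" "open V" "f ` U \<subseteq> V" "Ck_on k U f" "smooth_on V g"
  shows "Ck_on k U (\<lambda>x. g (f x))"
  using Ck_on_compose[OF assms(1-4)] assms(5) unfolding smooth_on_def by blast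

context closed_angles
begin

lemma cos_pos: "0 < cos (\<phi> t)" "0 < cos (\<psi> t)"
  using bounds[of t] by (auto intro: cos_pos_of_abs_less)

text \<open>The three derivatives are smooth expressions in the three functions, because the bounds
  on \<open>\<phi>\<close> and \<open>\<psi>\<close> avoid the singularities of \<open>tan\<close>
  and \<open>1 / cos\<close>. So all three functions gain a derivative simultaneously.\<close>

lemma Ck_angles: "Ck_on k UNIV \<phi> \<and> Ck_on k UNIV \<psi> \<and> Ck_on k UNIV \<alpha>"
proof (induction k)
  case 0
  show ?case using \<phi>' \<psi>' \<alpha>'
    by (auto intro!: continuous_at_imp_continuous_on DERIV_isCont)
next
  case (Suc k)
  let ?V = "{- (pi / 2)<..<pi / 2}"
  have nz: "cos x \<noteq> 0" if "x \<in> ?V" for x :: real using that cos_gt_zero_pi[of x] by auto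
  have "smooth_on ?V cos" "smooth_on ?V sin"
    using smooth_on_subset smooth_on_cos smooth_on_sin by blast+
  then have V: "smooth_on ?V (\<lambda>x. inverse (cos x))" "smooth_on ?V tan"
    unfolding tan_def by (intro smooth_on_inverse smooth_on_divide; use nz in auto)+
  have "\<phi> t \<in> ?V" "\<psi> t \<in> ?V" for t using bounds[of t] by auto
  then have r: "\<phi> ` UNIV \<subseteq> ?V" "\<psi> ` UNIV \<subseteq> ?V" by blast+
  have [simp]: "Ck_on k UNIV \<phi>" "Ck_on k UNIV \<psi>" "Ck_on k UNIV \<alpha>" using Suc by auto
  have c: "Ck_on k UNIV (\<lambda>t. inverse (cos (\<phi> t)))" "Ck_on k UNIV (\<lambda>t. tan (\<phi> t))" "Ck_on k UNIV (\<lambda>t. tan (\<psi> t))"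
    by (rule Ck_on_smooth_compose[OF _ _ r(1) _ V(1)] Ck_on_smooth_compose[OF _ _ r(1) _ V(2)]
        Ck_on_smooth_compose[OF _ _ r(2) _ V(2)]; simp)+
  have d: "Ck_on k UNIV (\<lambda>t. sin (\<alpha> t))" "Ck_on k UNIV (\<lambda>t. cos (\<alpha> t))"
    by (rule Ck_on_smooth_compose[OF _ _ _ _ smooth_on_sin] Ck_on_smooth_compose[OF _ _ _ _ smooth_on_cos]; simp)+
  note mult = Ck_on_bounded_bilinear[OF open_UNIV bounded_bilinear_mult] and add = Ck_on_add[OF open_UNIV]
  show ?case
    by (intro conjI Ck_on_real_SucI[OF _ \<phi>'] Ck_on_real_SucI[OF _ \<psi>'[unfolded divide_inverse]]
        Ck_on_real_SucI[OF _ \<alpha>'[unfolded divide_inverse]] open_UNIV mult add Ck_on_const c d)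
qed

lemma smooth_angles: "smooth_on UNIV \<phi>" "smooth_on UNIV \<psi>" "smooth_on UNIV \<alpha>"
  using Ck_angles by (auto simp: smooth_on_def)

lemma shift_pi: "\<phi> (t + pi) = - \<phi> t" "\<psi> (t + pi) = - \<psi> t" "\<alpha> (t + pi) = \<alpha> t + pi"
  using reflect'[of "- t"] reflect[of t] by (simp_all add: add.commute)

lemma shift_2pi: "\<phi> (t + 2 * pi) = \<phi> t" "\<psi> (t + 2 * pi) = \<psi> t" "\<alpha> (t + 2 * pi) = \<alpha> t + 2 * pi"
  using shift_pi[of "t + pi"] shift_pi[of t] by (simp_all add: add.assoc)

lemma sin_eq: "\<phi> s = \<phi> t \<Longrightarrow> sin s = sin t"
  using sine_like_inj[of \<phi>] reflect reflect' \<phi>_mono by blast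

text \<open>The substitution \<open>t \<mapsto> pi / 2 - t\<close> exchanges the two symmetries of
  \<open>\<psi>\<close> and makes it increasing, so the result for functions shaped like the sine
  applies.\<close>

lemma cos_eq:
  assumes "\<psi> s = \<psi> t" shows "cos s = cos t"
proof -
  have "sin (pi / 2 - s) = sin (pi / 2 - t)"
  proof (rule sine_like_inj[of "\<lambda>t. \<psi> (pi / 2 - t)"])
    show "\<psi> (pi / 2 - - t) = - \<psi> (pi / 2 - t)" for t
      using reflect'(2)[of "pi / 2 - t"] by simp
    show "\<psi> (pi / 2 - (pi - t)) = \<psi> (pi / 2 - t)" for t
      using reflect(2)[of "pi / 2 - t"] by simp
    show "\<psi> (pi / 2 - s) < \<psi> (pi / 2 - t)" if "0 \<le> s" "s < t" "t \<le> pi / 2" for s t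
      using that by (intro \<psi>_anti) auto
  qed (use assms in simp)
  then show ?thesis by (simp add: sin_diff)
qed

end

text \<open>\<open>(x, y, z)\<close> is the profile curve and \<open>(u, v, w)\<close> its unit normal in the sphere. The last equation is
  the vanishing of \<open>\<kappa>\<^sup>2\<close> times the mean curvature.\<close>

locale closed_profile =
  fixes m :: nat and \<kappa> :: real and x y z u v w x' y' z' u' v' w' :: "real \<Rightarrow> real"
  assumes \<kappa>: "0 < \<kappa>"
    and smooth: "smooth_on UNIV x" "smooth_on UNIV y" "smooth_on UNIV z"
      "smooth_on UNIV u" "smooth_on UNIV v" "smooth_on UNIV w"
    and deriv: "(x has_real_derivative x' t) (at t)" "(y has_real_derivative y' t) (at t)"
      "(z has_real_derivative z' t) (at t)" "(u has_real_derivative u' t) (at t)"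
      "(v has_real_derivative v' t) (at t)" "(w has_real_derivative w' t) (at t)"
    and pos: "0 < x t" "0 < y t"
    and unit: "(x t)\<^sup>2 + (y t)\<^sup>2 + (z t)\<^sup>2 = 1"
    and speed: "(x' t)\<^sup>2 + (y' t)\<^sup>2 + (z' t)\<^sup>2 = \<kappa>\<^sup>2"
    and normal_unit: "(u t)\<^sup>2 + (v t)\<^sup>2 + (w t)\<^sup>2 = 1"
    and normal_pos: "u t * x t + v t * y t + w t * z t = 0"
    and normal_tan: "u t * x' t + v t * y' t + w t * z' t = 0"
    and curvature: "u' t * x' t + v' t * y' t + w' t * z' t + \<kappa>\<^sup>2 * (real m * (u t / x t) + real m * (v t / y t)) = 0"
    and periodic: "cos s = cos t \<Longrightarrow> sin s = sin t \<Longrightarrow>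
      x s = x t \<and> y s = y t \<and> z s = z t \<and> u s = u t \<and> v s = v t \<and> w s = w t"
    and simple: "x s = x t \<Longrightarrow> y s = y t \<Longrightarrow> z s = z t \<Longrightarrow> cos s = cos t \<and> sin s = sin t"

text \<open>Here \<open>c\<close>, \<open>z\<close> are cosine and sine of \<open>\<phi>\<close>,
  \<open>s\<close>, \<open>t\<close> sine and cosine of \<open>\<alpha>\<close>, and
  \<open>p\<close>, \<open>q\<close> cosine and sine of \<open>\<theta>\<close>. The first five
  identities concern position, unit velocity and normal. In the last one, with \<open>A\<close> for
  \<open>\<alpha>'\<close>, the right side is minus the geodesic curvature
  \<open>\<alpha>' - \<theta>' sin \<phi>\<close>.\<close>

lemma frame_algebra:
  fixes c z s t p q :: real
  assumes c: "c \<noteq> 0" and cz: "c\<^sup>2 + z\<^sup>2 = 1" and st: "s\<^sup>2 + t\<^sup>2 = 1" and pq: "p\<^sup>2 + q\<^sup>2 = 1"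
  shows "(c * p)\<^sup>2 + (c * q)\<^sup>2 + z\<^sup>2 = 1" (is "?e1 = _")
    and "(- z * t * p - s * q)\<^sup>2 + (- z * t * q + s * p)\<^sup>2 + (c * t)\<^sup>2 = 1" (is "?e2 = _")
    and "(s * z * p - t * q)\<^sup>2 + (s * z * q + t * p)\<^sup>2 + (- s * c)\<^sup>2 = 1" (is "?e3 = _")
    and "(s * z * p - t * q) * (c * p) + (s * z * q + t * p) * (c * q) + (- s * c) * z = 0" (is "?e4 = _")
    and "(s * z * p - t * q) * (- z * t * p - s * q) + (s * z * q + t * p) * (- z * t * q + s * p) + (- s * c) * (c * t) = 0" (is "?e5 = _")
    and "(- A * (- z * t * p - s * q) + (s * c * t * p - s * s * z * q / c - t * p * s / c)) * (- z * t * p - s * q)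
      + (- A * (- z * t * q + s * p) + (s * c * t * q + s * s * z * p / c - t * q * s / c)) * (- z * t * q + s * p)
      + (- A * (c * t) + s * z * t) * (c * t) = - A + s * z / c" (is "?e6 = _")
proof -
  have "?e1 = c\<^sup>2 * (p\<^sup>2 + q\<^sup>2) + z\<^sup>2"
    by (simp add: algebra_simps power2_eq_square)
  then show "?e1 = 1" using pq cz by simp
  have "?e2 = (z\<^sup>2 * t\<^sup>2 + s\<^sup>2) * (p\<^sup>2 + q\<^sup>2) + c\<^sup>2 * t\<^sup>2"
    by (simp add: algebra_simps power2_eq_square)
  also have "\<dots> = (c\<^sup>2 + z\<^sup>2) * t\<^sup>2 + s\<^sup>2" unfolding pq by (simp add: algebra_simps)
  finally show TT: "?e2 = 1" using cz st by simp
  have "?e3 = (s\<^sup>2 * z\<^sup>2 + t\<^sup>2) * (p\<^sup>2 + q\<^sup>2) + s\<^sup>2 * c\<^sup>2"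
    by (simp add: algebra_simps power2_eq_square)
  also have "\<dots> = s\<^sup>2 * (c\<^sup>2 + z\<^sup>2) + t\<^sup>2" unfolding pq by (simp add: algebra_simps)
  finally show "?e3 = 1" using cz st by simp
  have "?e4 = s * z * c * (p\<^sup>2 + q\<^sup>2) - s * c * z"
    by (simp add: algebra_simps power2_eq_square)
  then show "?e4 = 0" using pq by simp
  have "?e5
    = (s * t - s * t * z\<^sup>2) * (p\<^sup>2 + q\<^sup>2) - s * t * c\<^sup>2"
    by (simp add: algebra_simps power2_eq_square)
  also have "\<dots> = s * t * (1 - (c\<^sup>2 + z\<^sup>2))" unfolding pq by (simp add: algebra_simps)
  finally show "?e5 = 0"
    using cz by simp
  have "?e6
    = - A * (?e2)
      + (- (s * c * z * t\<^sup>2) + (s * z / c) * (s\<^sup>2 + t\<^sup>2)) * (p\<^sup>2 + q\<^sup>2) + s * c * z * t\<^sup>2"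
    using c by (simp add: field_simps power2_eq_square)
  also have "\<dots> = - A + s * z / c" unfolding TT pq st by simp
  finally show "?e6 = - A + s * z / c" .
qed

text \<open>The quotients are \<open>u / x\<close> and \<open>v / y\<close>, up to sign the
  principal curvatures along the two spheres, each of multiplicity \<open>M\<close>;
  \<open>T\<close> is \<open>tan \<psi> = cot (2 \<theta>)\<close>. Inserting the equation for
  \<open>\<alpha>'\<close> makes their sum equal to the geodesic curvature of the profile.\<close>

lemma principal_curvature_algebra:
  fixes c z s t p q M T :: real
  assumes "c \<noteq> 0" "p \<noteq> 0" "q \<noteq> 0" "T = (p\<^sup>2 - q\<^sup>2) / (2 * p * q)"
  shows "M * ((s * z * p - t * q) / (c * p)) + M * ((s * z * q + t * p) / (c * q))
    = ((2 * M + 1) * (z / c) * s + 2 * M * T * t / c) - s * z / c"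
  using assms(1-3) unfolding assms(4) by (simp add: field_simps power2_eq_square)

context closed_angles
begin

definition \<theta> :: "real \<Rightarrow> real" where "\<theta> t = pi / 4 - \<psi> t / 2"

lemma \<theta>_bounds: "0 < \<theta> t" "\<theta> t < pi / 2"
  using bounds(2)[of t] by (auto simp: \<theta>_def abs_less_iff)

lemma \<theta>_pos: "0 < cos (\<theta> t)" "0 < sin (\<theta> t)"
  using \<theta>_bounds[of t] by (auto intro: cos_gt_zero sin_gt_zero)

lemma \<theta>_deriv: "(\<theta> has_real_derivative \<kappa> * (sin (\<alpha> t) / cos (\<phi> t))) (at t)"
  using DERIV_diff[OF DERIV_const DERIV_cdivide[OF \<psi>'], of "pi / 4" 2] unfolding \<theta>_def[abs_def] by simp

lemma tan_\<psi>: "tan (\<psi> t) = ((cos (\<theta> t))\<^sup>2 - (sin (\<theta> t))\<^sup>2) / (2 * cos (\<theta> t) * sin (\<theta> t))"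
proof -
  have \<psi>: "\<psi> t = pi / 2 - 2 * \<theta> t" by (simp add: \<theta>_def)
  have "sin (\<psi> t) = cos (2 * \<theta> t)" "cos (\<psi> t) = sin (2 * \<theta> t)"
    unfolding \<psi> by (simp_all add: sin_diff cos_diff)
  then show ?thesis unfolding tan_def cos_double sin_double by (simp add: ac_simps)
qed

definition A :: "real \<Rightarrow> real" where
  "A t = (2 * real m + 1) * (sin (\<phi> t) / cos (\<phi> t)) * sin (\<alpha> t) + 2 * real m * tan (\<psi> t) * cos (\<alpha> t) / cos (\<phi> t)"

lemma \<alpha>_deriv: "(\<alpha> has_real_derivative \<kappa> * A t) (at t)"
  using \<alpha>'[of t] by (simp add: A_def tan_def)

lemma closed_profile_of_angles:
  "closed_profile m \<kappa> (\<lambda>t. cos (\<phi> t) * cos (\<theta> t)) (\<lambda>t. cos (\<phi> t) * sin (\<theta> t)) (\<lambda>t. sin (\<phi> t))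
    (\<lambda>t. sin (\<alpha> t) * sin (\<phi> t) * cos (\<theta> t) - cos (\<alpha> t) * sin (\<theta> t))
    (\<lambda>t. sin (\<alpha> t) * sin (\<phi> t) * sin (\<theta> t) + cos (\<alpha> t) * cos (\<theta> t)) (\<lambda>t. - sin (\<alpha> t) * cos (\<phi> t))
    (\<lambda>t. \<kappa> * (- sin (\<phi> t) * cos (\<alpha> t) * cos (\<theta> t) - sin (\<alpha> t) * sin (\<theta> t)))
    (\<lambda>t. \<kappa> * (- sin (\<phi> t) * cos (\<alpha> t) * sin (\<theta> t) + sin (\<alpha> t) * cos (\<theta> t)))
    (\<lambda>t. \<kappa> * (cos (\<phi> t) * cos (\<alpha> t)))
    (\<lambda>t. \<kappa> * (- A t * (- sin (\<phi> t) * cos (\<alpha> t) * cos (\<theta> t) - sin (\<alpha> t) * sin (\<theta> t))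
      + (sin (\<alpha> t) * cos (\<phi> t) * cos (\<alpha> t) * cos (\<theta> t)
        - sin (\<alpha> t) * sin (\<alpha> t) * sin (\<phi> t) * sin (\<theta> t) / cos (\<phi> t) - cos (\<alpha> t) * cos (\<theta> t) * sin (\<alpha> t) / cos (\<phi> t))))
    (\<lambda>t. \<kappa> * (- A t * (- sin (\<phi> t) * cos (\<alpha> t) * sin (\<theta> t) + sin (\<alpha> t) * cos (\<theta> t))
      + (sin (\<alpha> t) * cos (\<phi> t) * cos (\<alpha> t) * sin (\<theta> t)
        + sin (\<alpha> t) * sin (\<alpha> t) * sin (\<phi> t) * cos (\<theta> t) / cos (\<phi> t) - cos (\<alpha> t) * sin (\<theta> t) * sin (\<alpha> t) / cos (\<phi> t))))
    (\<lambda>t. \<kappa> * (- A t * (cos (\<phi> t) * cos (\<alpha> t)) + sin (\<alpha> t) * sin (\<phi> t) * cos (\<alpha> t)))"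
    (is "closed_profile _ _ ?x ?y ?z ?u ?v ?w ?x' ?y' ?z' ?u' ?v' ?w'")
proof
  have S: "smooth_on UNIV (\<lambda>t. sin (g t))" "smooth_on UNIV (\<lambda>t. cos (g t))" if "smooth_on UNIV g" for g :: "real \<Rightarrow> real"
    using smooth_on_compose[OF open_UNIV open_UNIV _ that smooth_on_sin] smooth_on_compose[OF open_UNIV open_UNIV _ that smooth_on_cos]
    by auto
  have sm\<theta>: "smooth_on UNIV \<theta>"
    unfolding \<theta>_def[abs_def] by (intro smooth_intros smooth_angles open_UNIV) simp
  show "smooth_on UNIV ?x" "smooth_on UNIV ?y" "smooth_on UNIV ?z" "smooth_on UNIV ?u" "smooth_on UNIV ?v" "smooth_on UNIV ?w"
    by (intro smooth_on_mult smooth_on_add smooth_on_diff smooth_on_minus S smooth_angles sm\<theta> open_UNIV)+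
  fix t
  note c = cos_pos(1)[of t]
  note D = derivative_eq_intros \<phi>' \<theta>_deriv \<alpha>_deriv refl
  show "(?x has_real_derivative ?x' t) (at t)" "(?y has_real_derivative ?y' t) (at t)" "(?z has_real_derivative ?z' t) (at t)"
    "(?u has_real_derivative ?u' t) (at t)" "(?v has_real_derivative ?v' t) (at t)" "(?w has_real_derivative ?w' t) (at t)"
    by ((rule D)+, use c in \<open>simp add: field_simps\<close>)+
  show "0 < ?x t" "0 < ?y t" using \<theta>_pos c by auto
  note frame = frame_algebra[of "cos (\<phi> t)" "sin (\<phi> t)" "sin (\<alpha> t)" "cos (\<alpha> t)" "cos (\<theta> t)" "sin (\<theta> t)"]
  have pre: "cos (\<phi> t) \<noteq> 0" "(cos (\<phi> t))\<^sup>2 + (sin (\<phi> t))\<^sup>2 = 1" "(sin (\<alpha> t))\<^sup>2 + (cos (\<alpha> t))\<^sup>2 = 1"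
    "(cos (\<theta> t))\<^sup>2 + (sin (\<theta> t))\<^sup>2 = 1" using c by simp_all
  show "(?x t)\<^sup>2 + (?y t)\<^sup>2 + (?z t)\<^sup>2 = 1" by (rule frame(1)[OF pre])
  have k: "(\<kappa> * a)\<^sup>2 + (\<kappa> * b)\<^sup>2 + (\<kappa> * d)\<^sup>2 = \<kappa>\<^sup>2 * (a\<^sup>2 + b\<^sup>2 + d\<^sup>2)" for a b d
    by (simp add: algebra_simps power_mult_distrib)
  show "(?x' t)\<^sup>2 + (?y' t)\<^sup>2 + (?z' t)\<^sup>2 = \<kappa>\<^sup>2" unfolding k frame(2)[OF pre] by simp
  show "(?u t)\<^sup>2 + (?v t)\<^sup>2 + (?w t)\<^sup>2 = 1" by (rule frame(3)[OF pre])
  show "?u t * ?x t + ?v t * ?y t + ?w t * ?z t = 0" by (rule frame(4)[OF pre])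
  have k: "a * (\<kappa> * a') + b * (\<kappa> * b') + d * (\<kappa> * d') = \<kappa> * (a * a' + b * b' + d * d')" for a b d a' b' d'
    by (simp add: algebra_simps)
  show "?u t * ?x' t + ?v t * ?y' t + ?w t * ?z' t = 0" unfolding k frame(5)[OF pre] by simp
  have k: "(\<kappa> * a) * (\<kappa> * a') + (\<kappa> * b) * (\<kappa> * b') + (\<kappa> * d) * (\<kappa> * d') = \<kappa>\<^sup>2 * (a * a' + b * b' + d * d')" for a b d a' b' d'
    by (simp add: algebra_simps power2_eq_square)
  have R: "real m * (?u t / ?x t) + real m * (?v t / ?y t) = A t - sin (\<alpha> t) * sin (\<phi> t) / cos (\<phi> t)"
    unfolding A_def
    by (rule principal_curvature_algebra) (use c \<theta>_pos[of t] in \<open>auto simp: tan_\<psi>\<close>)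
  show "?u' t * ?x' t + ?v' t * ?y' t + ?w' t * ?z' t + \<kappa>\<^sup>2 * (real m * (?u t / ?x t) + real m * (?v t / ?y t)) = 0"
    unfolding k frame(6)[OF pre] R by (simp add: algebra_simps)
next
  fix s t :: real
  show "0 < \<kappa>" by (rule \<kappa>)
  {
    assume st: "cos s = cos t" "sin s = sin t"
    have p: "\<phi> s = \<phi> t" "\<psi> s = \<psi> t" "sin (\<alpha> s) = sin (\<alpha> t)" "cos (\<alpha> s) = cos (\<alpha> t)"
      using periodic_eq_if_same_angle[of \<phi>, OF shift_2pi(1) st] periodic_eq_if_same_angle[of \<psi>, OF shift_2pi(2) st]
        periodic_eq_if_same_angle[of "\<lambda>t. sin (\<alpha> t)", OF _ st] periodic_eq_if_same_angle[of "\<lambda>t. cos (\<alpha> t)", OF _ st]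
      by (simp_all add: shift_2pi)
    then show "?x s = ?x t \<and> ?y s = ?y t \<and> ?z s = ?z t \<and> ?u s = ?u t \<and> ?v s = ?v t \<and> ?w s = ?w t"
      by (simp add: \<theta>_def)
  }
  assume eq: "?x s = ?x t" "?y s = ?y t" "?z s = ?z t"
  have \<phi>: "\<phi> s = \<phi> t"
    using eq(3) bounds(1)[of s] bounds(1)[of t] by - (rule sin_inj_pi, auto)
  then have "cos (\<theta> s) = cos (\<theta> t)" using eq(1) cos_pos(1)[of t] by simp
  then have "\<theta> s = \<theta> t"
    using \<theta>_bounds[of s] \<theta>_bounds[of t] by - (rule cos_inj_pi, auto)
  then have "\<psi> s = \<psi> t" by (simp add: \<theta>_def)
  then show "cos s = cos t \<and> sin s = sin t" using \<phi> sin_eq cos_eq by blast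
qed

end

section \<open>The hypersurface swept out by the profile curve\<close>

text \<open>A curve in \<open>M\<close> stays in \<open>V\<close> for short times, and there
  \<open>g\<close> is constant along it. This bounds tangent spaces from above, one defining
  equation at a time.\<close>

lemma tangent_space_annihilated:
  fixes g :: "'a::euclidean_space \<Rightarrow> real"
  assumes v: "v \<in> tangent_space M p" and g: "(g has_derivative L) (at p)"
    and V: "open V" "p \<in> V" and const: "\<And>q. q \<in> M \<inter> V \<Longrightarrow> g q = k"
  shows "L v = 0"
proof -
  obtain c e where e: "0 < e" and sm: "smooth_on {-e<..<e} c" and cM: "c ` {-e<..<e} \<subseteq> M" and c0: "c 0 = p"
    and c': "(c has_vector_derivative v) (at 0)"
    using v unfolding tangent_space_def by blast
  have "(g \<circ> c has_vector_derivative L v) (at 0)"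
    by (rule vector_derivative_diff_chain_within[where S=UNIV, OF c'])
      (use g c0 in \<open>auto intro: has_derivative_at_withinI\<close>)
  note gc = this
  have "(c \<longlongrightarrow> p) (at 0)"
    using has_vector_derivative_continuous[OF c'] c0 by (simp add: continuous_at)
  then have "eventually (\<lambda>s. c s \<in> V) (at 0)" using V by (rule topological_tendstoD)
  moreover have "eventually (\<lambda>s. s \<in> {-e<..<e}) (at 0)"
    using e by (intro eventually_at_in_open') auto
  ultimately have "eventually (\<lambda>s. (g \<circ> c) s = k) (at 0)"
  proof eventually_elim
    case (elim s)
    then have "c s \<in> M \<inter> V" using cM by auto
    then show ?case using const by simp
  qed
  moreover have "(g \<circ> c) 0 = k"
  proof -
    have "c 0 \<in> M \<inter> V" using cM e c0 V by auto
    then show ?thesis using const by simp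
  qed
  ultimately have "((\<lambda>s. k) has_vector_derivative L v) (at 0)"
    using has_derivative_transform_eventually[OF gc[unfolded has_vector_derivative_def], of "\<lambda>s. k"]
    unfolding has_vector_derivative_def by simp
  from vector_derivative_unique_at[OF this has_vector_derivative_const] show ?thesis .
qed

lemma derivative_along_curve:
  assumes D: "(\<nu> has_derivative D) (at p within S)" and c: "range c \<subseteq> S" "c 0 = p"
    and "(c has_vector_derivative v) (at (0::real))" "((\<lambda>s. \<nu> (c s)) has_vector_derivative w) (at 0)"
  shows "D v = w"
proof -
  have "(\<nu> has_derivative D) (at (c 0) within range c)"
    using has_derivative_subset[OF D c(1)] c(2) by simp
  with assms(4) have "(\<nu> \<circ> c has_vector_derivative D v) (at 0)"
    by (rule vector_derivative_diff_chain_within)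
  then show ?thesis unfolding o_def by (rule vector_derivative_unique_at[OF _ assms(5)])
qed

lemma has_derivative_within_of_extension:
  assumes "(g has_derivative g') (at p)" "open U" "p \<in> U" "p \<in> M" "\<And>x. x \<in> M \<inter> U \<Longrightarrow> g x = f x"
  shows "(f has_derivative g') (at p within M)"
proof -
  obtain d where d: "0 < d" "ball p d \<subseteq> U" using assms(2,3) by (meson open_contains_ball)
  show ?thesis
    by (rule has_derivative_transform_within[OF has_derivative_at_withinI[OF assms(1)] d(1)])
      (use assms d in \<open>auto simp: subset_iff dist_commute\<close>)
qed

lemma smooth_map_on_imp_differentiable:
  assumes "smooth_map_on M f" "p \<in> M"
  obtains D where "(f has_derivative D) (at p within M)"
proof -
  have "\<exists>U g. open U \<and> p \<in> U \<and> smooth_on U g \<and> (\<forall>x\<in>M \<inter> U. g x = f x)"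
    using assms unfolding smooth_map_on_def by (rule bspec)
  then obtain U g where U: "open U" "p \<in> U" "smooth_on U g" "\<And>x. x \<in> M \<inter> U \<Longrightarrow> g x = f x"
    by auto
  obtain D where "(g has_derivative D) (at p)"
    using smooth_on_differentiable[OF U(3,2)] unfolding differentiable_def by blast
  from has_derivative_within_of_extension[OF this U(1,2) assms(2) U(4)] show ?thesis by (rule that)
qed

lemma smooth_map_on_imp_continuous_on: "smooth_map_on M f \<Longrightarrow> continuous_on M f"
  unfolding continuous_on_eq_continuous_within
  by (meson has_derivative_continuous smooth_map_on_imp_differentiable)

lemma smooth_on_real_derivative:
  fixes f :: "real \<Rightarrow> real"
  assumes "open U" "smooth_on U f" "\<And>t. t \<in> U \<Longrightarrow> (f has_real_derivative f' t) (at t)"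
  shows "smooth_on U f'"
proof -
  have "frechet_derivative f (at t) 1 = f' t" if "t \<in> U" for t
    using frechet_derivative_at[OF has_field_derivative_imp_has_derivative[OF assms(3)[OF that]]]
    by (metis mult.right_neutral)
  moreover have "smooth_on U (\<lambda>t. frechet_derivative f (at t) 1)"
    using assms(2) unfolding smooth_on_def by (metis Ck_on.simps(2))
  ultimately show ?thesis by (rule smooth_on_cong[OF assms(1)])
qed

text \<open>The image is open by invariance of domain. The inverse satisfies
  \<open>j' = 1 / k' (j)\<close>, an autonomous equation with smooth right-hand side, and is smooth
  for this reason.\<close>

lemma smooth_local_inverse:
  fixes k :: "real \<Rightarrow> real"
  assumes I: "open I" "convex I" and k: "smooth_on I k"
    and k': "\<And>t. t \<in> I \<Longrightarrow> (k has_real_derivative k' t) (at t)" "\<And>t. t \<in> I \<Longrightarrow> 0 < k' t"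
  obtains j where "open (k ` I)" "smooth_on (k ` I) j" "\<And>t. t \<in> I \<Longrightarrow> j (k t) = t"
proof -
  have less: "k s < k t" if "s \<in> I" "t \<in> I" "s < t" for s t
  proof (rule pos_deriv_strict_mono_on[OF that(3)])
    have "{s..t} \<subseteq> I" using that I(2) by (metis closed_segment_eq_real_ivl1 convex_contains_segment less_imp_le)
    then show "(k has_real_derivative k' x) (at x)" if "s \<le> x" "x \<le> t" for x
      using that k'(1) by auto
    show "0 < k' x" if "s < x" "x < t" for x
      using that k'(2)[of x] subsetD[OF \<open>{s..t} \<subseteq> I\<close>, of x] by simp
  qed
  have inj: "inj_on k I"
    by (rule inj_onI) (metis less less_irrefl linorder_less_linear)
  have cont: "continuous_on I k" by (rule smooth_on_imp_continuous_on[OF k])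
  have op: "open (k ` I)" by (rule invariance_of_domain[OF cont I(1) inj])
  define j where "j = inv_into I k"
  have j: "j (k t) = t" if "t \<in> I" for t using that inj by (simp add: j_def)
  have "smooth_on (k ` I) j"
  proof (rule smooth_on_autonomous[OF op I(1)])
    show "j ` k ` I \<subseteq> I" using j by auto
    show "smooth_on I (\<lambda>t. inverse (k' t))"
      using k'(2) by (intro smooth_on_inverse smooth_on_real_derivative[OF I(1) k k'(1)] I(1)) force+
    fix y assume "y \<in> k ` I"
    then obtain t where t: "t \<in> I" "y = k t" by blast
    have "(j has_real_derivative inverse (k' t)) (at (k t))"
      unfolding has_field_derivative_def
      by (rule has_derivative_inverse_strong[OF I(1) t(1) cont j
            has_field_derivative_imp_has_derivative[OF k'(1)[OF t(1)]]])
        (use k'(2)[OF t(1)] in \<open>auto simp: fun_eq_iff\<close>)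
    then show "(j has_real_derivative inverse (k' (j y))) (at y)" using t j by simp
  qed
  then show ?thesis using that op j by blast
qed

section \<open>Angles on the circle and great circles\<close>

definition circ :: "real \<Rightarrow> real ^ 2" where "circ t = vector [cos t, sin t]"

lemma circ_nth [simp]: "circ t $ 1 = cos t" "circ t $ 2 = sin t"
  by (simp_all add: circ_def)

lemma norm_sq_vec2: "(norm (w :: real ^ 2))\<^sup>2 = (w $ 1)\<^sup>2 + (w $ 2)\<^sup>2"
  unfolding power2_norm_eq_inner by (simp add: inner_vec_def sum_2 power2_eq_square)

lemma norm_circ [simp]: "norm (circ t) = 1"
  using norm_sq_vec2[of "circ t"] norm_ge_zero[of "circ t"] by (auto simp: power2_eq_1_iff)

lemma circ_eq_iff: "circ s = circ t \<longleftrightarrow> cos s = cos t \<and> sin s = sin t"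
  by (auto simp: vec_eq_iff forall_2)

lemma circ_exhaust:
  assumes "norm (w :: real ^ 2) = 1"
  obtains t where "w = circ t"
proof -
  have "(w $ 1)\<^sup>2 + (w $ 2)\<^sup>2 = 1" using assms norm_sq_vec2[of w] by simp
  then obtain t where "w $ 1 = cos t" "w $ 2 = sin t" using sincos_total_2pi by metis
  then have "w = circ t" by (simp add: vec_eq_iff forall_2)
  then show ?thesis by (rule that)
qed

lemma cos_sin_arctan_tan:
  assumes "0 < cos d"
  shows "cos (arctan (tan d)) = cos d" "sin (arctan (tan d)) = sin d"
proof -
  have "1 + (tan d)\<^sup>2 = (1 / cos d)\<^sup>2"
    using assms sin_cos_squared_add[of d] by (simp add: tan_def field_simps)
  then have "sqrt (1 + (tan d)\<^sup>2) = 1 / cos d"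
    using assms by (simp add: real_sqrt_unique)
  then show "cos (arctan (tan d)) = cos d" "sin (arctan (tan d)) = sin d"
    unfolding cos_arctan sin_arctan using assms by (simp_all add: tan_def)
qed

text \<open>A branch of the angle around \<open>t0\<close>: at \<open>circ t\<close> the quotient is
  \<open>tan (t - t0)\<close>. The formula is smooth on an open half-plane and not only on the
  circle, as smoothness by local extension requires.\<close>

definition angle_near :: "real \<Rightarrow> real ^ 2 \<Rightarrow> real" where
  "angle_near t0 w = t0 + arctan ((w $ 2 * cos t0 - w $ 1 * sin t0) / (w $ 1 * cos t0 + w $ 2 * sin t0))"

lemma circ_angle_near:
  assumes "0 < cos (t - t0)"
  shows "circ (angle_near t0 (circ t)) = circ t" "\<bar>angle_near t0 (circ t) - t0\<bar> < pi / 2"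
    "cos (angle_near t0 (circ t) - t0) = cos (t - t0)"
proof -
  have eq: "angle_near t0 (circ t) = t0 + arctan (tan (t - t0))"
    unfolding angle_near_def tan_def by (simp add: sin_diff cos_diff mult.commute)
  note c = cos_sin_arctan_tan[OF assms]
  have "cos (t0 + arctan (tan (t - t0))) = cos (t0 + (t - t0))" "sin (t0 + arctan (tan (t - t0))) = sin (t0 + (t - t0))"
    unfolding cos_add[of t0] sin_add[of t0] c by simp_all
  then show "circ (angle_near t0 (circ t)) = circ t" unfolding eq circ_eq_iff by simp
  show "\<bar>angle_near t0 (circ t) - t0\<bar> < pi / 2"
    unfolding eq using arctan[of "tan (t - t0)"] by auto
  show "cos (angle_near t0 (circ t) - t0) = cos (t - t0)" unfolding eq using c by simp
qed

lemma open_halfplane: "open {w :: real ^ 2. 0 < w $ 1 * cos t0 + w $ 2 * sin t0}"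
  by (intro open_Collect_less continuous_intros)

lemma smooth_angle_near: "smooth_on {w. 0 < w $ 1 * cos t0 + w $ 2 * sin t0} (angle_near t0)" (is "smooth_on ?U _")
proof -
  have nth: "smooth_on ?U (\<lambda>w :: real ^ 2. w $ i)" for i
    by (rule smooth_on_bounded_linear[OF open_halfplane bounded_linear_vec_nth smooth_on_id[OF open_halfplane]])
  have "smooth_on ?U (\<lambda>w. (w $ 2 * cos t0 - w $ 1 * sin t0) / (w $ 1 * cos t0 + w $ 2 * sin t0))"
    by (intro smooth_on_divide smooth_on_diff smooth_on_add smooth_on_mult smooth_on_const nth open_halfplane) auto
  then show ?thesis
    unfolding angle_near_def[abs_def]
    by (intro smooth_on_add smooth_on_const open_halfplane smooth_on_compose[OF open_halfplane open_UNIV _ _ smooth_on_arctan]) auto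
qed

lemma angle_near_deriv:
  "(angle_near t0 has_derivative (\<lambda>h. h $ 2 * cos t0 - h $ 1 * sin t0)) (at (circ t0))"
proof -
  have [simp]: "cos t0 * cos t0 + sin t0 * sin t0 = 1"
    using sin_cos_squared_add2[of t0] by (simp add: power2_eq_square add.commute)
  have nth: "((\<lambda>w :: real ^ 2. w $ i) has_derivative (\<lambda>h. h $ i)) (at w)" for i w
    by (rule bounded_linear_imp_has_derivative[OF bounded_linear_vec_nth])
  have q: "((\<lambda>w :: real ^ 2. (w $ 2 * cos t0 - w $ 1 * sin t0) / (w $ 1 * cos t0 + w $ 2 * sin t0))
      has_derivative (\<lambda>h. h $ 2 * cos t0 - h $ 1 * sin t0)) (at (circ t0))"
    by (rule has_derivative_eq_rhs, rule has_derivative_divide'[OF has_derivative_diff[OF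
          has_derivative_mult_left[OF nth] has_derivative_mult_left[OF nth]]
          has_derivative_add[OF has_derivative_mult_left[OF nth] has_derivative_mult_left[OF nth]]])
      (auto simp: fun_eq_iff)
  have "(arctan has_derivative (\<lambda>h. h * 1)) (at 0)"
    by (rule has_derivative_eq_rhs[OF has_field_derivative_imp_has_derivative[OF DERIV_arctan]])
      (simp add: fun_eq_iff)
  then have "(arctan has_derivative (\<lambda>h. h * 1))
      (at ((circ t0 $ 2 * cos t0 - circ t0 $ 1 * sin t0) / (circ t0 $ 1 * cos t0 + circ t0 $ 2 * sin t0)))"
    by (simp add: mult.commute)
  from has_derivative_compose[OF q this] show ?thesis
    unfolding angle_near_def[abs_def] using has_derivative_add_const[where c=t0] by (simp add: add.commute)
qed

text \<open>For \<open>\<alpha> = 0\<close> the curve is constant since \<open>sgn 0 = 0\<close>.\<close>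

definition great_circle :: "'a::real_inner \<Rightarrow> 'a \<Rightarrow> real \<Rightarrow> 'a" where
  "great_circle a \<alpha> s = cos (norm \<alpha> * s) *\<^sub>R a + sin (norm \<alpha> * s) *\<^sub>R sgn \<alpha>"

lemma great_circle:
  fixes a :: "'a::euclidean_space"
  assumes "norm a = 1" "a \<bullet> \<alpha> = 0"
  shows "norm (great_circle a \<alpha> s) = 1" "great_circle a \<alpha> 0 = a"
    "(great_circle a \<alpha> has_vector_derivative \<alpha>) (at 0)" "smooth_on UNIV (great_circle a \<alpha>)"
proof -
  have "(norm (great_circle a \<alpha> s))\<^sup>2 = 1"
  proof (cases "\<alpha> = 0")
    case False
    then have "sgn \<alpha> \<bullet> sgn \<alpha> = 1" by (simp add: dot_square_norm norm_sgn)
    moreover have "a \<bullet> a = 1" "a \<bullet> sgn \<alpha> = 0" "sgn \<alpha> \<bullet> a = 0"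
      using assms by (simp_all add: dot_square_norm sgn_div_norm inner_commute)
    ultimately show ?thesis
      unfolding power2_norm_eq_inner great_circle_def
      by (simp add: inner_add_left inner_add_right power2_eq_square[symmetric])
  qed (use assms in \<open>simp add: great_circle_def\<close>)
  then show "norm (great_circle a \<alpha> s) = 1"
    by (metis norm_ge_zero one_power2 power2_eq_imp_eq zero_le_one)
  show "great_circle a \<alpha> 0 = a" by (simp add: great_circle_def)
  have s: "norm \<alpha> *\<^sub>R sgn \<alpha> = \<alpha>" by (cases "\<alpha> = 0") (simp_all add: sgn_div_norm)
  have "((\<lambda>s. cos (norm \<alpha> * s) *\<^sub>R a + sin (norm \<alpha> * s) *\<^sub>R sgn \<alpha>) has_vector_derivative 0 *\<^sub>R a + norm \<alpha> *\<^sub>R sgn \<alpha>) (at 0)"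
    by (rule derivative_eq_intros refl | simp)+
  then show "(great_circle a \<alpha> has_vector_derivative \<alpha>) (at 0)"
    unfolding great_circle_def[abs_def] s by simp
  have m: "smooth_on UNIV (\<lambda>s. norm \<alpha> * s)" by (intro smooth_on_mult smooth_on_const smooth_on_id open_UNIV)
  show "smooth_on UNIV (great_circle a \<alpha>)"
    unfolding great_circle_def[abs_def]
    by (intro smooth_on_add smooth_on_scaleR smooth_on_const open_UNIV
        smooth_on_compose[OF open_UNIV open_UNIV _ m smooth_on_cos] smooth_on_compose[OF open_UNIV open_UNIV _ m smooth_on_sin]) auto
qed

lemma mem_tangent_sphere:
  fixes p :: "'a::euclidean_space"
  assumes "norm p = 1" "p \<bullet> v = 0"
  shows "v \<in> tangent_space (sphere 0 1) p"
  unfolding tangent_space_def mem_Collect_eq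
  by (rule exI[of _ "great_circle p v"], rule exI[of _ 1])
    (use great_circle[OF assms] in \<open>auto intro: smooth_on_subset[OF _ subset_UNIV]\<close>)

abbreviation torus :: "('a::euclidean_space \<times> 'a \<times> (real ^ 2)) set" where
  "torus \<equiv> sphere 0 1 \<times> sphere 0 1 \<times> sphere 0 1"

lemma torus_cases:
  assumes "p \<in> torus"
  obtains a b t where "p = (a, b, circ t)" "norm a = 1" "norm b = 1"
proof -
  obtain a b w where "p = (a, b, w)" by (metis prod_cases3)
  with assms that show ?thesis by (auto elim: circ_exhaust)
qed

section \<open>The embedding and its unit normal\<close>

context closed_profile
begin

definition emb :: "real \<Rightarrow> 'a::euclidean_space \<times> 'a \<times> 'b \<Rightarrow> 'a \<times> 'a \<times> real" where
  "emb t p = (x t *\<^sub>R fst p, y t *\<^sub>R fst (snd p), z t)"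

definition nrm :: "real \<Rightarrow> 'a::euclidean_space \<times> 'a \<times> 'b \<Rightarrow> 'a \<times> 'a \<times> real" where
  "nrm t p = (u t *\<^sub>R fst p, v t *\<^sub>R fst (snd p), w t)"

text \<open>A point of the circle determines its parameter only up to full turns; by
  \<open>periodic\<close> the choice does not affect the value.\<close>

definition F :: "'a::euclidean_space \<times> 'a \<times> (real ^ 2) \<Rightarrow> 'a \<times> 'a \<times> real" where
  "F p = emb (SOME t. snd (snd p) = circ t) p"

definition N :: "'a::euclidean_space \<times> 'a \<times> (real ^ 2) \<Rightarrow> 'a \<times> 'a \<times> real" where
  "N p = nrm (SOME t. snd (snd p) = circ t) p"

lemma F_circ: "F (a, b, circ t) = (x t *\<^sub>R a, y t *\<^sub>R b, z t)"
  and N_circ: "N (a, b, circ t) = (u t *\<^sub>R a, v t *\<^sub>R b, w t)"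
proof -
  have "circ t = circ (SOME s. circ t = circ s)" by (rule someI) simp
  then have "cos (SOME s. circ t = circ s) = cos t" "sin (SOME s. circ t = circ s) = sin t"
    by (simp_all add: circ_eq_iff)
  from periodic[OF this]
  show "F (a, b, circ t) = (x t *\<^sub>R a, y t *\<^sub>R b, z t)" "N (a, b, circ t) = (u t *\<^sub>R a, v t *\<^sub>R b, w t)"
    by (simp_all add: F_def N_def emb_def nrm_def)
qed

lemma norm_emb:
  assumes "norm a = 1" "norm b = 1"
  shows "norm (x t *\<^sub>R a, y t *\<^sub>R b, z t) = 1" "norm (u t *\<^sub>R a, v t *\<^sub>R b, w t) = 1"
    "(u t *\<^sub>R a, v t *\<^sub>R b, w t) \<bullet> (x t *\<^sub>R a, y t *\<^sub>R b, z t) = 0"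
proof -
  have ab: "a \<bullet> a = 1" "b \<bullet> b = 1" using assms by (simp_all add: dot_square_norm)
  show "norm (x t *\<^sub>R a, y t *\<^sub>R b, z t) = 1" "norm (u t *\<^sub>R a, v t *\<^sub>R b, w t) = 1"
    unfolding norm_eq_sqrt_inner using unit[of t] normal_unit[of t] by (simp_all add: ab power2_eq_square algebra_simps)
  show "(u t *\<^sub>R a, v t *\<^sub>R b, w t) \<bullet> (x t *\<^sub>R a, y t *\<^sub>R b, z t) = 0"
    using normal_pos[of t] by (simp add: ab algebra_simps)
qed

text \<open>Since \<open>x\<close> and \<open>y\<close> are positive, they are the norms of the
  first two components of the image. With \<open>z\<close> they determine the point of the circle by
  \<open>simple\<close>, and division recovers the points of the spheres.\<close>

lemma F_inj: "inj_on F torus"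
proof (rule inj_onI)
  fix p q :: "'a \<times> 'a \<times> (real ^ 2)" assume p: "p \<in> torus" and q: "q \<in> torus" and eq: "F p = F q"
  obtain a b t where a: "p = (a, b, circ t)" "norm a = 1" "norm b = 1" using torus_cases[OF p] .
  obtain c d s where c: "q = (c, d, circ s)" "norm c = 1" "norm d = 1" using torus_cases[OF q] .
  have e: "x t *\<^sub>R a = x s *\<^sub>R c" "y t *\<^sub>R b = y s *\<^sub>R d" "z t = z s"
    using eq unfolding a c F_circ by simp_all
  have "x t = x s" "y t = y s"
    using arg_cong[OF e(1), of norm] arg_cong[OF e(2), of norm] a c pos[of t] pos[of s] by simp_all
  with simple[of t s] e pos[of s] show "p = q" unfolding a c by (simp add: circ_eq_iff)
qed

text \<open>A local smooth extension of \<open>F\<close> to an open set, with the angle branch in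
  place of the chosen parameter.\<close>

definition ext :: "real \<Rightarrow> 'a::euclidean_space \<times> 'a \<times> (real ^ 2) \<Rightarrow> 'a \<times> 'a \<times> real" where
  "ext t0 p = emb (angle_near t0 (snd (snd p))) p"

definition chart :: "real \<Rightarrow> ('a::euclidean_space \<times> 'a \<times> (real ^ 2)) set" where
  "chart t0 = {p. 0 < snd (snd p) $ 1 * cos t0 + snd (snd p) $ 2 * sin t0}"

lemma open_chart: "open (chart t0)"
  unfolding chart_def by (intro open_Collect_less continuous_intros)

lemma circ_mem_chart: "(a, b, circ t) \<in> chart t0 \<longleftrightarrow> 0 < cos (t - t0)"
  by (simp add: chart_def cos_diff)

lemma ext_eq_F:
  assumes "p \<in> torus \<inter> chart t0" shows "ext t0 p = F p"
proof -
  have p: "p \<in> torus" "p \<in> chart t0" using assms by auto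
  obtain a b t where a: "p = (a, b, circ t)" using torus_cases[OF p(1)] by blast
  then have "0 < cos (t - t0)" using p(2) by (simp add: circ_mem_chart)
  from circ_angle_near(1)[OF this]
  show ?thesis using F_circ[of a b "angle_near t0 (circ t)"] unfolding a by (simp add: ext_def emb_def)
qed

lemma smooth_ext: "smooth_on (chart t0) (ext t0)"
proof -
  have ang: "smooth_on (chart t0) (\<lambda>p. angle_near t0 (snd (snd p)))"
    by (rule smooth_on_compose[OF open_chart open_halfplane _ _ smooth_angle_near])
      (auto simp: chart_def intro!: smooth_on_snd smooth_on_id open_chart[unfolded chart_def])
  have c: "smooth_on (chart t0) (\<lambda>p. f (angle_near t0 (snd (snd p))))" if "smooth_on UNIV f" for f :: "real \<Rightarrow> real"
    by (rule smooth_on_compose[OF open_chart open_UNIV _ ang that]) simp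
  show ?thesis
    unfolding ext_def[abs_def] emb_def
    by (intro smooth_on_Pair smooth_on_scaleR c smooth smooth_on_fst smooth_on_snd smooth_on_id open_chart)
qed

lemma smooth_map_F: "smooth_map_on torus F"
  unfolding smooth_map_on_def
proof
  fix p :: "'a \<times> 'a \<times> (real ^ 2)" assume "p \<in> torus"
  then obtain a b t where p: "p = (a, b, circ t)" by (rule torus_cases)
  then have "p \<in> chart t" by (simp add: circ_mem_chart)
  then show "\<exists>U g. open U \<and> p \<in> U \<and> smooth_on U g \<and> (\<forall>q\<in>torus \<inter> U. g q = F q)"
    using ext_eq_F by (intro exI[of _ "chart t"] exI[of _ "ext t"] conjI open_chart smooth_ext) auto
qed

lemma ext_deriv:
  "(ext t has_derivative (\<lambda>h. let l = snd (snd h) $ 2 * cos t - snd (snd h) $ 1 * sin t in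
      ((l * x' t) *\<^sub>R a + x t *\<^sub>R fst h, (l * y' t) *\<^sub>R b + y t *\<^sub>R fst (snd h), l * z' t))) (at (a, b, circ t))"
proof -
  have [simp]: "angle_near t (circ t) = t" by (simp add: angle_near_def)
  have ang: "((\<lambda>p :: 'a \<times> 'a \<times> (real ^ 2). angle_near t (snd (snd p))) has_derivative
      (\<lambda>h. snd (snd h) $ 2 * cos t - snd (snd h) $ 1 * sin t)) (at (a, b, circ t))"
    by (rule has_derivative_compose[where f="\<lambda>p. snd (snd p)" and f'="\<lambda>p. snd (snd p)" and s=UNIV])
      (auto intro!: angle_near_deriv derivative_eq_intros)
  have c: "((\<lambda>p :: 'a \<times> 'a \<times> (real ^ 2). f (angle_near t (snd (snd p)))) has_derivative
      (\<lambda>h. (snd (snd h) $ 2 * cos t - snd (snd h) $ 1 * sin t) * f')) (at (a, b, circ t))"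
    if "(f has_real_derivative f') (at t)" for f f'
  proof -
    have "(f has_derivative (\<lambda>h. h * f')) (at (angle_near t (snd (snd (a, b, circ t)))))"
      using that by (simp add: has_field_derivative_def mult_commute_abs)
    from has_derivative_compose[OF ang this] show ?thesis .
  qed
  show ?thesis
    unfolding ext_def[abs_def] emb_def Let_def
    by (rule has_derivative_eq_rhs, rule has_derivative_Pair[OF has_derivative_scaleR[OF c[OF deriv(1)]]
          has_derivative_Pair[OF has_derivative_scaleR[OF c[OF deriv(2)]] c[OF deriv(3)]]])
      (auto intro!: derivative_eq_intros simp: fun_eq_iff)
qed

lemma tangent_torus:
  assumes v: "h \<in> tangent_space torus (a, b, c)" and p: "(a, b, c) \<in> torus"
  shows "a \<bullet> fst h = 0" "b \<bullet> fst (snd h) = 0" "c \<bullet> snd (snd h) = 0"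
proof -
  have "((\<lambda>p. fst p \<bullet> fst p) has_derivative (\<lambda>h. a \<bullet> fst h + fst h \<bullet> a)) (at (a, b, c))"
    "((\<lambda>p. fst (snd p) \<bullet> fst (snd p)) has_derivative (\<lambda>h. b \<bullet> fst (snd h) + fst (snd h) \<bullet> b)) (at (a, b, c))"
    "((\<lambda>p. snd (snd p) \<bullet> snd (snd p)) has_derivative (\<lambda>h. c \<bullet> snd (snd h) + snd (snd h) \<bullet> c)) (at (a, b, c))"
    by (rule derivative_eq_intros refl | simp)+
  note d = this
  have "a \<bullet> fst h + fst h \<bullet> a = 0" "b \<bullet> fst (snd h) + fst (snd h) \<bullet> b = 0" "c \<bullet> snd (snd h) + snd (snd h) \<bullet> c = 0"
    by (rule tangent_space_annihilated[OF v d(1), of UNIV 1] tangent_space_annihilated[OF v d(2), of UNIV 1]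
        tangent_space_annihilated[OF v d(3), of UNIV 1]; auto simp: dot_square_norm)+
  then show "a \<bullet> fst h = 0" "b \<bullet> fst (snd h) = 0" "c \<bullet> snd (snd h) = 0"
    by (simp_all add: inner_commute)
qed

lemma immersion_F: "immersion_on torus F"
  unfolding immersion_on_def
proof (intro conjI smooth_map_F ballI)
  fix p :: "'a \<times> 'a \<times> (real ^ 2)" assume p: "p \<in> torus"
  obtain a b t where abt: "p = (a, b, circ t)" "norm a = 1" "norm b = 1" using torus_cases[OF p] .
  let ?l = "\<lambda>h :: 'a \<times> 'a \<times> (real ^ 2). snd (snd h) $ 2 * cos t - snd (snd h) $ 1 * sin t"
  let ?D = "\<lambda>h. let l = ?l h in
      ((l * x' t) *\<^sub>R a + x t *\<^sub>R fst h, (l * y' t) *\<^sub>R b + y t *\<^sub>R fst (snd h), l * z' t)"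
  have D: "(F has_derivative ?D) (at p within torus)"
    unfolding abt(1)
    by (rule has_derivative_within_of_extension[OF ext_deriv open_chart[of t]])
      (use p abt in \<open>auto simp: circ_mem_chart intro!: ext_eq_F\<close>)
  have "inj_on ?D (tangent_space torus p)"
  proof (rule inj_onI)
    fix h k assume h: "h \<in> tangent_space torus p" and k: "k \<in> tangent_space torus p" and eq: "?D h = ?D k"
    note th = tangent_torus[OF h[unfolded abt(1)] p[unfolded abt(1)]]
    note tk = tangent_torus[OF k[unfolded abt(1)] p[unfolded abt(1)]]
    have ab: "a \<bullet> a = 1" "b \<bullet> b = 1" using abt by (simp_all add: dot_square_norm)
    have e: "(?l h * x' t) *\<^sub>R a + x t *\<^sub>R fst h = (?l k * x' t) *\<^sub>R a + x t *\<^sub>R fst k"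
      "(?l h * y' t) *\<^sub>R b + y t *\<^sub>R fst (snd h) = (?l k * y' t) *\<^sub>R b + y t *\<^sub>R fst (snd k)"
      "?l h * z' t = ?l k * z' t"
      using eq by (simp_all add: Let_def)
    \<comment> \<open>Pairing with \<open>a\<close> and \<open>b\<close> removes the parts tangent
      to the spheres; as the profile curve has nonzero speed, the circle components then
      agree.\<close>
    have "?l h * x' t = ?l k * x' t" "?l h * y' t = ?l k * y' t"
      using arg_cong[OF e(1), of "\<lambda>v. a \<bullet> v"] arg_cong[OF e(2), of "\<lambda>v. b \<bullet> v"]
      by (simp_all add: inner_add_right ab th tk)
    moreover have "x' t \<noteq> 0 \<or> y' t \<noteq> 0 \<or> z' t \<noteq> 0" using speed[of t] \<kappa> by auto
    ultimately have l: "?l h = ?l k" using e(3) by auto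
    have "fst h = fst k" "fst (snd h) = fst (snd k)" using e(1,2) pos[of t] unfolding l by simp_all
    moreover have "snd (snd h) = snd (snd k)"
    proof -
      \<comment> \<open>Tangency to the circle kills the radial part of \<open>r\<close>, and
        equality of the values of \<open>?l\<close> its tangential part.\<close>
      define r where "r = snd (snd h) - snd (snd k)"
      have r: "r $ 2 * cos t - r $ 1 * sin t = 0" "r $ 1 * cos t + r $ 2 * sin t = 0"
        using l th(3) tk(3) by (simp_all add: r_def inner_vec_def sum_2 algebra_simps)
      have rot: "r1 * (c\<^sup>2 + s\<^sup>2) = (r1 * c + r2 * s) * c - (r2 * c - r1 * s) * s"
        "r2 * (c\<^sup>2 + s\<^sup>2) = (r1 * c + r2 * s) * s + (r2 * c - r1 * s) * c" for r1 r2 c s :: real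
        by (simp_all add: algebra_simps power2_eq_square)
      have "r $ 1 = 0" "r $ 2 = 0"
        using rot(1)[of "r $ 1" "cos t" "sin t" "r $ 2"] rot(2)[of "r $ 2" "cos t" "sin t" "r $ 1"] unfolding r
        by simp_all
      then have "r = 0" by (simp add: vec_eq_iff forall_2)
      then show ?thesis by (simp add: r_def)
    qed
    ultimately show "h = k" by (simp add: prod_eq_iff)
  qed
  with D show "\<exists>f'. (F has_derivative f') (at p within torus) \<and> inj_on f' (tangent_space torus p)" by blast
qed

lemma smooth_embedding_F:
  "smooth_embedding (torus :: ('a::euclidean_space \<times> 'a \<times> (real ^ 2)) set) (sphere 0 1) F"
  unfolding smooth_embedding_def
proof (intro conjI immersion_F)
  show "F ` (torus :: ('a \<times> 'a \<times> (real ^ 2)) set) \<subseteq> sphere 0 1"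
  proof
    fix q assume "q \<in> F ` (torus :: ('a \<times> 'a \<times> (real ^ 2)) set)"
    then obtain p where p: "p \<in> torus" "q = F p" by blast
    obtain a b t where "p = (a, b, circ t)" "norm a = 1" "norm b = 1" using torus_cases[OF p(1)] .
    then show "q \<in> sphere 0 1" using p(2) by (simp add: F_circ norm_emb)
  qed
  have "compact (torus :: ('a \<times> 'a \<times> (real ^ 2)) set)" by (intro compact_Times compact_sphere)
  then show "\<exists>g. homeomorphism (torus :: ('a \<times> 'a \<times> (real ^ 2)) set) (F ` torus) F g"
    using homeomorphism_compact[OF _ smooth_map_on_imp_continuous_on[OF smooth_map_F] refl F_inj] by blast
qed

text \<open>The normal as a function of the point of the hypersurface. An inverse of
  \<open>F\<close> enters, so its smoothness has to come from a smooth local parameter on the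
  hypersurface.\<close>

definition \<nu> :: "'a::euclidean_space \<times> 'a \<times> real \<Rightarrow> 'a \<times> 'a \<times> real" where
  "\<nu> q = N (inv_into torus F q)"

lemma circ_mem_torus: "norm a = 1 \<Longrightarrow> norm b = 1 \<Longrightarrow> (a, b, circ t) \<in> torus"
  by simp

lemma point_mem_surface: "norm a = 1 \<Longrightarrow> norm b = 1 \<Longrightarrow> (x t *\<^sub>R a, y t *\<^sub>R b, z t) \<in> F ` torus"
  using imageI[OF circ_mem_torus, of a b F t] unfolding F_circ .

lemma \<nu>_eq:
  assumes "norm a = 1" "norm b = 1"
  shows "\<nu> (x t *\<^sub>R a, y t *\<^sub>R b, z t) = (u t *\<^sub>R a, v t *\<^sub>R b, w t)"
  using inv_into_f_f[OF F_inj circ_mem_torus[OF assms], of t] by (simp add: \<nu>_def F_circ N_circ)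

lemma surface_cases:
  assumes "q \<in> F ` torus"
  obtains a b t where "q = (x t *\<^sub>R a, y t *\<^sub>R b, z t)" "norm a = 1" "norm b = 1"
proof -
  obtain p where "p \<in> torus" "q = F p" using assms by blast
  then show ?thesis using that by (metis torus_cases F_circ)
qed

text \<open>The parameter of the profile curve is, locally on the hypersurface, a smooth function of the point.
  It is read off the projection of the profile curve to its tangent line at \<open>t0\<close>.\<close>

lemma local_parameter:
  fixes a b :: "'a::euclidean_space"
  assumes ab: "norm a = 1" "norm b = 1"
  obtains V \<sigma> where "open V" "(x t0 *\<^sub>R a, y t0 *\<^sub>R b, z t0) \<in> V" "smooth_on V \<sigma>"
    "\<sigma> (x t0 *\<^sub>R a, y t0 *\<^sub>R b, z t0) = t0"
    "\<And>q. q \<in> F ` (torus :: ('a \<times> 'a \<times> (real ^ 2)) set) \<inter> V \<Longrightarrow>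
       \<exists>c d. norm c = 1 \<and> norm d = 1 \<and> q = (x (\<sigma> q) *\<^sub>R c, y (\<sigma> q) *\<^sub>R d, z (\<sigma> q))"
proof -
  define k where "k t = x t * x' t0 + y t * y' t0 + z t * z' t0" for t
  define k' where "k' t = x' t * x' t0 + y' t * y' t0 + z' t * z' t0" for t
  have k: "smooth_on UNIV k"
    unfolding k_def[abs_def] by (intro smooth_on_add smooth_on_mult smooth_on_const smooth open_UNIV)
  have kd: "(k has_real_derivative k' t) (at t)" for t
    unfolding k_def[abs_def] k'_def by (rule derivative_eq_intros deriv refl)+ simp
  have "isCont k' t0"
    using smooth_on_imp_continuous_on[OF smooth_on_real_derivative[OF open_UNIV k kd]]
    by (simp add: continuous_on_eq_continuous_at)
  moreover have "0 < k' t0"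
    using speed[of t0] \<kappa> by (simp add: k'_def power2_eq_square[symmetric])
  ultimately have "eventually (\<lambda>t. 0 < k' t) (at t0)" unfolding isCont_def by (rule order_tendstoD(1))
  then obtain d where d: "d > 0" "\<And>t. t \<noteq> t0 \<Longrightarrow> \<bar>t - t0\<bar> < d \<Longrightarrow> 0 < k' t"
    unfolding eventually_at by (auto simp: dist_real_def)
  define \<delta> where "\<delta> = min d (pi / 2)"
  have \<delta>: "0 < \<delta>" "\<delta> \<le> pi / 2" using d(1) by (auto simp: \<delta>_def)
  define I where "I = {t0 - \<delta><..<t0 + \<delta>}"
  have pos': "0 < k' t" if "t \<in> I" for t
    using that d(2)[of t] \<open>0 < k' t0\<close> by (cases "t = t0") (auto simp: I_def \<delta>_def)
  obtain j where j: "open (k ` I)" "smooth_on (k ` I) j" "\<And>t. t \<in> I \<Longrightarrow> j (k t) = t"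
    by (rule smooth_local_inverse[of I k k']) (use smooth_on_subset[OF k] kd pos' in \<open>auto simp: I_def\<close>)
  \<comment> \<open>The norms of the first two components recover \<open>x\<close> and
    \<open>y\<close> because these are positive, so \<open>pr\<close> expresses the projection
    \<open>k\<close> through the point alone.\<close>
  define pr where "pr q = norm (fst q) * x' t0 + norm (fst (snd q)) * y' t0 + snd (snd q) * z' t0"
    for q :: "'a \<times> 'a \<times> real"
  have pr: "pr (x t *\<^sub>R c, y t *\<^sub>R d, z t) = k t" if "norm c = 1" "norm d = 1" for c d t
    using that pos[of t] by (simp add: pr_def k_def)
  \<comment> \<open>These are the points whose circle parameter is at least \<open>\<delta>\<close>
    away from \<open>t0\<close>. Their image is compact and, by injectivity, misses the given point;
    removing it excludes other arcs of the profile with the same projection.\<close>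
  define K where "K = (torus :: ('a \<times> 'a \<times> (real ^ 2)) set) \<inter>
    {p. snd (snd p) $ 1 * cos t0 + snd (snd p) $ 2 * sin t0 \<le> cos \<delta>}"
  have "compact K"
    unfolding K_def by (intro compact_Int_closed compact_Times compact_sphere closed_Collect_le continuous_intros)
  then have "compact (F ` K)"
    by (rule compact_continuous_image[rotated])
      (rule continuous_on_subset[OF smooth_map_on_imp_continuous_on[OF smooth_map_F]], simp add: K_def)
  then have clK: "closed (F ` K)" by (rule compact_imp_closed)
  define V where "V = {q. fst q \<noteq> 0} \<inter> {q. fst (snd q) \<noteq> 0} \<inter> pr -` (k ` I) \<inter> - F ` K"
  have "open V"
    unfolding V_def pr_def[abs_def] using clK
    by (intro open_Int open_Collect_neq open_vimage j(1) continuous_intros) auto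
  define \<sigma> where "\<sigma> q = j (pr q)" for q
  have smooth_pr: "smooth_on V pr"
    unfolding pr_def[abs_def]
    by (intro smooth_on_add smooth_on_mult smooth_on_const smooth_on_norm smooth_on_fst smooth_on_snd smooth_on_id \<open>open V\<close>)
      (auto simp: V_def)
  have "smooth_on V \<sigma>"
    unfolding \<sigma>_def[abs_def] by (rule smooth_on_compose[OF \<open>open V\<close> j(1) _ smooth_pr j(2)]) (auto simp: V_def)
  have t0I: "t0 \<in> I" using \<delta> by (simp add: I_def)
  have "F (a, b, circ t0) \<notin> F ` K"
  proof
    assume "F (a, b, circ t0) \<in> F ` K"
    then obtain p where p: "p \<in> K" "F (a, b, circ t0) = F p" by blast
    then have "p = (a, b, circ t0)"
      using inj_onD[OF F_inj p(2)[symmetric]] circ_mem_torus[OF ab] by (auto simp: K_def)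
    then have "cos t0 * cos t0 + sin t0 * sin t0 \<le> cos \<delta>" using p(1) by (simp add: K_def)
    moreover have "cos \<delta> < cos 0" using \<delta> by (intro cos_monotone_0_pi) auto
    ultimately show False using sin_cos_squared_add3[of t0] by simp
  qed
  then have q0: "(x t0 *\<^sub>R a, y t0 *\<^sub>R b, z t0) \<in> V"
    using ab pos[of t0] t0I unfolding V_def F_circ by (auto simp: pr)
  have \<sigma>0: "\<sigma> (x t0 *\<^sub>R a, y t0 *\<^sub>R b, z t0) = t0"
    using t0I j(3) by (simp add: \<sigma>_def pr ab)
  have "\<exists>c d. norm c = 1 \<and> norm d = 1 \<and> q = (x (\<sigma> q) *\<^sub>R c, y (\<sigma> q) *\<^sub>R d, z (\<sigma> q))"
    if q: "q \<in> F ` torus \<inter> V" for q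
  proof -
    obtain p where p: "p \<in> torus" "q = F p" using q by blast
    obtain c d t where cd: "p = (c, d, circ t)" "norm c = 1" "norm d = 1" using torus_cases[OF p(1)] .
    have "p \<notin> K" using q p by (auto simp: V_def)
    then have cos: "cos \<delta> < cos (t - t0)" using p(1) unfolding K_def cd(1) by (simp add: cos_diff not_le)
    moreover have "0 \<le> cos \<delta>" using \<delta> by (intro cos_ge_zero) auto
    ultimately have "0 < cos (t - t0)" by simp
    note near = circ_angle_near[OF this]
    define r where "r = angle_near t0 (circ t)"
    have "\<bar>r - t0\<bar> < \<delta>"
    proof (rule ccontr)
      assume "\<not> \<bar>r - t0\<bar> < \<delta>"
      then have "cos \<bar>r - t0\<bar> \<le> cos \<delta>"
        using \<delta> near(2) by (intro cos_monotone_0_pi_le) (auto simp: r_def)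
      then show False using cos near(3) by (simp add: r_def)
    qed
    then have "r \<in> I" by (auto simp: I_def)
    have qr: "q = (x r *\<^sub>R c, y r *\<^sub>R d, z r)"
      using F_circ[of c d r] near(1) unfolding p(2) cd(1) r_def by simp
    then have "\<sigma> q = r" using j(3)[OF \<open>r \<in> I\<close>] by (simp add: \<sigma>_def pr cd)
    then show ?thesis using qr cd by blast
  qed
  with \<open>open V\<close> q0 \<open>smooth_on V \<sigma>\<close> \<sigma>0 show ?thesis by (rule that)
qed

lemma smooth_map_\<nu>: "smooth_map_on (F ` torus) \<nu>"
  unfolding smooth_map_on_def
proof
  fix q0 :: "'a \<times> 'a \<times> real" assume "q0 \<in> F ` torus"
  then obtain a b t0 where ab: "q0 = (x t0 *\<^sub>R a, y t0 *\<^sub>R b, z t0)" "norm a = 1" "norm b = 1"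
    by (rule surface_cases)
  obtain V \<sigma> where V: "open V" "q0 \<in> V" "smooth_on V \<sigma>"
    and \<sigma>: "\<And>q. q \<in> F ` (torus :: ('a \<times> 'a \<times> (real ^ 2)) set) \<inter> V \<Longrightarrow>
       \<exists>c d. norm c = 1 \<and> norm d = 1 \<and> q = (x (\<sigma> q) *\<^sub>R c, y (\<sigma> q) *\<^sub>R d, z (\<sigma> q))"
    using local_parameter[OF ab(2,3), of t0] unfolding ab(1) by metis
  \<comment> \<open>On the hypersurface the points of the spheres are \<open>fst q\<close> and
    \<open>fst (snd q)\<close> divided by \<open>x\<close> and \<open>y\<close>; in this form the
    normal extends to all of \<open>V\<close>.\<close>
  define g where "g q = ((u (\<sigma> q) / x (\<sigma> q)) *\<^sub>R fst q, (v (\<sigma> q) / y (\<sigma> q)) *\<^sub>R fst (snd q), w (\<sigma> q))" for q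
  have c: "smooth_on V (\<lambda>q. f (\<sigma> q))" if "smooth_on UNIV f" for f :: "real \<Rightarrow> real"
    by (rule smooth_on_compose[OF V(1) open_UNIV _ V(3) that]) simp
  have nz: "x s \<noteq> 0" "y s \<noteq> 0" for s using pos[of s] by auto
  have "smooth_on V g"
    unfolding g_def[abs_def]
    by (intro smooth_on_Pair smooth_on_scaleR smooth_on_divide c smooth smooth_on_fst smooth_on_snd smooth_on_id V(1) nz)
  moreover have "g q = \<nu> q" if q: "q \<in> F ` torus \<inter> V" for q
  proof -
    obtain c d where cd: "norm c = 1" "norm d = 1" "q = (x (\<sigma> q) *\<^sub>R c, y (\<sigma> q) *\<^sub>R d, z (\<sigma> q))"
      using \<sigma>[OF q] by blast
    have "\<nu> q = (u (\<sigma> q) *\<^sub>R c, v (\<sigma> q) *\<^sub>R d, w (\<sigma> q))"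
      by (subst cd(3)) (rule \<nu>_eq[OF cd(1,2)])
    moreover have "fst q = x (\<sigma> q) *\<^sub>R c" "fst (snd q) = y (\<sigma> q) *\<^sub>R d"
      by (subst cd(3), simp)+
    ultimately show ?thesis using nz by (simp add: g_def)
  qed
  ultimately show "\<exists>U g. open U \<and> q0 \<in> U \<and> smooth_on U g \<and> (\<forall>q\<in>F ` torus \<inter> U. g q = \<nu> q)"
    using V by blast
qed

text \<open>Test curves on the hypersurface with prescribed velocity: the profile parameter moves at
  rate \<open>l\<close>, the points of the spheres along great circles. Dividing by
  \<open>x t\<close> and \<open>y t\<close> compensates the radii, so that these motions contribute
  exactly \<open>\<alpha>\<close> and \<open>\<beta>\<close>.\<close>

definition curve :: "'a::euclidean_space \<Rightarrow> 'a \<Rightarrow> real \<Rightarrow> real \<Rightarrow> 'a \<Rightarrow> 'a \<Rightarrow> real \<Rightarrow> 'a \<times> 'a \<times> real" where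
  "curve a b t l \<alpha> \<beta> s = (x (t + l * s) *\<^sub>R great_circle a ((1 / x t) *\<^sub>R \<alpha>) s,
     y (t + l * s) *\<^sub>R great_circle b ((1 / y t) *\<^sub>R \<beta>) s, z (t + l * s))"

lemma curve:
  fixes a b :: "'a::euclidean_space"
  assumes ab: "norm a = 1" "norm b = 1" and perp: "a \<bullet> \<alpha> = 0" "b \<bullet> \<beta> = 0"
  shows "range (curve a b t l \<alpha> \<beta>) \<subseteq> F ` torus" "curve a b t l \<alpha> \<beta> 0 = (x t *\<^sub>R a, y t *\<^sub>R b, z t)"
    "smooth_on UNIV (curve a b t l \<alpha> \<beta>)"
    "(curve a b t l \<alpha> \<beta> has_vector_derivative ((l * x' t) *\<^sub>R a + \<alpha>, (l * y' t) *\<^sub>R b + \<beta>, l * z' t)) (at 0)"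
    "((\<lambda>s. \<nu> (curve a b t l \<alpha> \<beta> s)) has_vector_derivative
       ((l * u' t) *\<^sub>R a + (u t / x t) *\<^sub>R \<alpha>, (l * v' t) *\<^sub>R b + (v t / y t) *\<^sub>R \<beta>, l * w' t)) (at 0)"
proof -
  have p: "a \<bullet> ((1 / x t) *\<^sub>R \<alpha>) = 0" "b \<bullet> ((1 / y t) *\<^sub>R \<beta>) = 0" using perp by simp_all
  note ga = great_circle[OF ab(1) p(1)] and gb = great_circle[OF ab(2) p(2)]
  show "range (curve a b t l \<alpha> \<beta>) \<subseteq> F ` torus"
    unfolding curve_def using point_mem_surface[OF ga(1) gb(1)] by blast
  show "curve a b t l \<alpha> \<beta> 0 = (x t *\<^sub>R a, y t *\<^sub>R b, z t)" by (simp add: curve_def ga gb)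
  have lin: "smooth_on UNIV (\<lambda>s. t + l * s)" by (intro smooth_on_add smooth_on_mult smooth_on_const smooth_on_id open_UNIV)
  have c: "smooth_on UNIV (\<lambda>s. f (t + l * s))" if "smooth_on UNIV f" for f :: "real \<Rightarrow> real"
    by (rule smooth_on_compose[OF open_UNIV open_UNIV _ lin that]) simp
  show "smooth_on UNIV (curve a b t l \<alpha> \<beta>)"
    unfolding curve_def[abs_def] by (intro smooth_on_Pair smooth_on_scaleR c smooth ga(4) gb(4) open_UNIV)
  have d: "((\<lambda>s. f (t + l * s)) has_real_derivative l * f') (at 0)" if "(f has_real_derivative f') (at t)" for f f'
  proof -
    have "((\<lambda>s. t + l * s) has_real_derivative l) (at 0)" by (auto intro!: derivative_eq_intros)
    from DERIV_chain2[OF _ this, of f f'] that show ?thesis by (simp add: mult.commute)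
  qed
  have nz: "x t \<noteq> 0" "y t \<noteq> 0" using pos[of t] by auto
  note S = has_vector_derivative_scaleR[OF d ga(3)] has_vector_derivative_scaleR[OF d gb(3)]
  have vd: "((\<lambda>s. f (t + l * s)) has_vector_derivative l * f') (at 0)" if "(f has_real_derivative f') (at t)" for f f'
    using d[OF that] by (simp add: has_real_derivative_iff_has_vector_derivative)
  have gen: "((\<lambda>s. (f1 (t + l * s) *\<^sub>R great_circle a ((1 / x t) *\<^sub>R \<alpha>) s,
     f2 (t + l * s) *\<^sub>R great_circle b ((1 / y t) *\<^sub>R \<beta>) s, f3 (t + l * s))) has_vector_derivative
     ((l * d1) *\<^sub>R a + (f1 t / x t) *\<^sub>R \<alpha>, (l * d2) *\<^sub>R b + (f2 t / y t) *\<^sub>R \<beta>, l * d3)) (at 0)"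
    if "(f1 has_real_derivative d1) (at t)" "(f2 has_real_derivative d2) (at t)" "(f3 has_real_derivative d3) (at t)"
    for f1 f2 f3 d1 d2 d3
    using has_vector_derivative_Pair[OF S(1)[OF that(1)] has_vector_derivative_Pair[OF S(2)[OF that(2)] vd[OF that(3)]]]
    by (simp add: ga gb add.commute)
  show "(curve a b t l \<alpha> \<beta> has_vector_derivative ((l * x' t) *\<^sub>R a + \<alpha>, (l * y' t) *\<^sub>R b + \<beta>, l * z' t)) (at 0)"
    using gen[OF deriv(1-3)] nz unfolding curve_def[abs_def] by simp
  have "\<nu> (curve a b t l \<alpha> \<beta> s) = (u (t + l * s) *\<^sub>R great_circle a ((1 / x t) *\<^sub>R \<alpha>) s,
     v (t + l * s) *\<^sub>R great_circle b ((1 / y t) *\<^sub>R \<beta>) s, w (t + l * s))" for s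
    unfolding curve_def by (rule \<nu>_eq[OF ga(1) gb(1)])
  then show "((\<lambda>s. \<nu> (curve a b t l \<alpha> \<beta> s)) has_vector_derivative
       ((l * u' t) *\<^sub>R a + (u t / x t) *\<^sub>R \<alpha>, (l * v' t) *\<^sub>R b + (v t / y t) *\<^sub>R \<beta>, l * w' t)) (at 0)"
    using gen[OF deriv(4-6)] by simp
qed

text \<open>From above: near the point the hypersurface lies in the zero sets of three functions
  built from the local parameter, whose differential supplies \<open>l\<close>. From below: every
  vector of the given form is the velocity of a test curve.\<close>

lemma tangent_space_surface:
  fixes a b :: "'a::euclidean_space"
  assumes ab: "norm a = 1" "norm b = 1"
  shows "tangent_space (F ` torus) (x t *\<^sub>R a, y t *\<^sub>R b, z t) =
    {((l * x' t) *\<^sub>R a + \<alpha>, (l * y' t) *\<^sub>R b + \<beta>, l * z' t) | l \<alpha> \<beta>. a \<bullet> \<alpha> = 0 \<and> b \<bullet> \<beta> = 0}" (is "?L = ?R")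
proof
  let ?q = "(x t *\<^sub>R a, y t *\<^sub>R b, z t)"
  have aa: "a \<bullet> a = 1" "b \<bullet> b = 1" using ab by (simp_all add: dot_square_norm)
  obtain V \<sigma> where V: "open V" "?q \<in> V" "smooth_on V \<sigma>" and \<sigma>q: "\<sigma> ?q = t"
    and \<sigma>: "\<And>q. q \<in> F ` (torus :: ('a \<times> 'a \<times> (real ^ 2)) set) \<inter> V \<Longrightarrow>
       \<exists>c d. norm c = 1 \<and> norm d = 1 \<and> q = (x (\<sigma> q) *\<^sub>R c, y (\<sigma> q) *\<^sub>R d, z (\<sigma> q))"
    using local_parameter[OF ab, of t] by metis
  obtain \<sigma>' where \<sigma>': "(\<sigma> has_derivative \<sigma>') (at ?q)"
    using smooth_on_differentiable[OF V(3,2)] unfolding differentiable_def by blast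
  have c: "((\<lambda>q. f (\<sigma> q)) has_derivative (\<lambda>h. \<sigma>' h * f')) (at ?q)" if "(f has_real_derivative f') (at t)" for f f'
  proof -
    have "(f has_derivative (\<lambda>h. h * f')) (at (\<sigma> ?q))"
      using that by (simp add: \<sigma>q has_field_derivative_def mult_commute_abs)
    from has_derivative_compose[OF \<sigma>' this] show ?thesis .
  qed
  have dx: "((\<lambda>q. fst q \<bullet> fst q - x (\<sigma> q) * x (\<sigma> q)) has_derivative
      (\<lambda>h. 2 * x t * (a \<bullet> fst h - \<sigma>' h * x' t))) (at ?q)"
    by (rule derivative_eq_intros c[OF deriv(1)] refl)+ (simp add: fun_eq_iff \<sigma>q inner_commute algebra_simps)
  have dy: "((\<lambda>q. fst (snd q) \<bullet> fst (snd q) - y (\<sigma> q) * y (\<sigma> q)) has_derivative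
      (\<lambda>h. 2 * y t * (b \<bullet> fst (snd h) - \<sigma>' h * y' t))) (at ?q)"
    by (rule derivative_eq_intros c[OF deriv(2)] refl)+ (simp add: fun_eq_iff \<sigma>q inner_commute algebra_simps)
  have dz: "((\<lambda>q. snd (snd q) - z (\<sigma> q)) has_derivative (\<lambda>h. snd (snd h) - \<sigma>' h * z' t)) (at ?q)"
    by (rule derivative_eq_intros c[OF deriv(3)] refl)+
  show "?L \<subseteq> ?R"
  proof
    fix h assume h: "h \<in> ?L"
    have on: "fst q \<bullet> fst q - x (\<sigma> q) * x (\<sigma> q) = 0" "fst (snd q) \<bullet> fst (snd q) - y (\<sigma> q) * y (\<sigma> q) = 0"
      "snd (snd q) - z (\<sigma> q) = 0" if q: "q \<in> F ` torus \<inter> V" for q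
    proof -
      obtain c d where cd: "norm c = 1" "norm d = 1" "q = (x (\<sigma> q) *\<^sub>R c, y (\<sigma> q) *\<^sub>R d, z (\<sigma> q))"
        using \<sigma>[OF q] by blast
      have "fst q = x (\<sigma> q) *\<^sub>R c" "fst (snd q) = y (\<sigma> q) *\<^sub>R d" "snd (snd q) = z (\<sigma> q)"
        by (subst cd(3), simp)+
      then show "fst q \<bullet> fst q - x (\<sigma> q) * x (\<sigma> q) = 0" "fst (snd q) \<bullet> fst (snd q) - y (\<sigma> q) * y (\<sigma> q) = 0"
        "snd (snd q) - z (\<sigma> q) = 0" using cd by (simp_all add: dot_square_norm power2_eq_square)
    qed
    have "2 * x t * (a \<bullet> fst h - \<sigma>' h * x' t) = 0" "2 * y t * (b \<bullet> fst (snd h) - \<sigma>' h * y' t) = 0"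
      "snd (snd h) - \<sigma>' h * z' t = 0"
      using tangent_space_annihilated[OF h dx V(1,2) on(1)] tangent_space_annihilated[OF h dy V(1,2) on(2)]
        tangent_space_annihilated[OF h dz V(1,2) on(3)] by blast+
    then have e: "a \<bullet> fst h = \<sigma>' h * x' t" "b \<bullet> fst (snd h) = \<sigma>' h * y' t" "snd (snd h) = \<sigma>' h * z' t"
      using pos[of t] by auto
    then have "h = ((\<sigma>' h * x' t) *\<^sub>R a + (fst h - (a \<bullet> fst h) *\<^sub>R a),
        (\<sigma>' h * y' t) *\<^sub>R b + (fst (snd h) - (b \<bullet> fst (snd h)) *\<^sub>R b), \<sigma>' h * z' t)"
      by (simp add: prod_eq_iff)
    moreover have "a \<bullet> (fst h - (a \<bullet> fst h) *\<^sub>R a) = 0" "b \<bullet> (fst (snd h) - (b \<bullet> fst (snd h)) *\<^sub>R b) = 0"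
      by (simp_all add: inner_diff_right aa)
    ultimately show "h \<in> ?R" by blast
  qed
  show "?R \<subseteq> ?L"
  proof
    fix h assume "h \<in> ?R"
    then obtain l \<alpha> \<beta> where h: "h = ((l * x' t) *\<^sub>R a + \<alpha>, (l * y' t) *\<^sub>R b + \<beta>, l * z' t)"
      and p: "a \<bullet> \<alpha> = 0" "b \<bullet> \<beta> = 0" by blast
    note cv = curve[OF ab p, of t l]
    show "h \<in> ?L"
      unfolding tangent_space_def mem_Collect_eq h
      by (rule exI[of _ "curve a b t l \<alpha> \<beta>"], rule exI[of _ 1])
        (use cv(1-4) smooth_on_subset[OF cv(3) subset_UNIV] in auto)
  qed
qed

lemma unit_normal_\<nu>: "unit_normal_field (sphere 0 1) (F ` torus) UNIV \<nu>"
  unfolding unit_normal_field_def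
proof (intro conjI ballI)
  show "smooth_map_on (F ` torus \<inter> UNIV) \<nu>" using smooth_map_\<nu> by simp
  fix q :: "'a \<times> 'a \<times> real" assume "q \<in> F ` torus \<inter> UNIV"
  then have "q \<in> F ` torus" by simp
  then obtain a b t where q: "q = (x t *\<^sub>R a, y t *\<^sub>R b, z t)" and ab: "norm a = 1" "norm b = 1"
    by (rule surface_cases)
  have aa: "a \<bullet> a = 1" "b \<bullet> b = 1" using ab by (simp_all add: dot_square_norm)
  note \<nu> = \<nu>_eq[OF ab, of t, folded q]
  show "\<nu> q \<in> tangent_space (sphere 0 1) q"
    using norm_emb(1,3)[OF ab, of t, folded q] by (intro mem_tangent_sphere) (simp_all add: \<nu> inner_commute[of q])
  show "norm (\<nu> q) = 1" unfolding \<nu> by (rule norm_emb[OF ab])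
  fix h assume "h \<in> tangent_space (F ` torus) q"
  then obtain l \<alpha> \<beta> where h: "h = ((l * x' t) *\<^sub>R a + \<alpha>, (l * y' t) *\<^sub>R b + \<beta>, l * z' t)"
    and p: "a \<bullet> \<alpha> = 0" "b \<bullet> \<beta> = 0" unfolding q tangent_space_surface[OF ab] by blast
  have "\<nu> q \<bullet> h = l * (u t * x' t + v t * y' t + w t * z' t)"
    unfolding \<nu> h by (simp add: inner_add_right aa p algebra_simps)
  then show "\<nu> q \<bullet> h = 0" by (simp add: normal_tan)
qed

section \<open>Mean curvature in an orthonormal frame\<close>

lemma orthonormal_complement:
  fixes a :: "'a::euclidean_space"
  assumes "norm a = 1"
  obtains B where "B \<subseteq> {v. a \<bullet> v = 0}" "pairwise orthogonal B" "\<And>b. b \<in> B \<Longrightarrow> norm b = 1"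
    "finite B" "card B = DIM('a) - 1" "span B = {v. a \<bullet> v = 0}"
proof -
  have sub: "subspace {v. a \<bullet> v = 0}" by (rule subspace_hyperplane)
  obtain B where B: "B \<subseteq> {v. a \<bullet> v = 0}" "pairwise orthogonal B" "\<And>b. b \<in> B \<Longrightarrow> norm b = 1"
    "independent B" "card B = dim {v. a \<bullet> v = 0}" "span B = {v. a \<bullet> v = 0}"
    using orthonormal_basis_subspace[OF sub] by metis
  have "a \<noteq> 0" using assms by auto
  then show ?thesis using that B independent_imp_finite by (metis dim_hyperplane)
qed

text \<open>The frame consists of the normalized profile direction and orthonormal bases of the
  tangent spaces of the two spheres. The derivative of the normal scales the sphere directions by
  \<open>u / x\<close> and \<open>v / y\<close>, \<open>m\<close> of each; with the contribution of
  the profile direction the trace becomes the left side of \<open>curvature\<close>, up to sign and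
  the factor \<open>\<kappa>\<^sup>2\<close>.\<close>

lemma mean_curvature_zero:
  assumes dim: "DIM('a::euclidean_space) = m + 1" and q: "q \<in> F ` (torus :: ('a \<times> 'a \<times> (real ^ 2)) set)"
  shows "has_mean_curvature (F ` torus) \<nu> q 0"
proof -
  obtain a b t where qe: "q = (x t *\<^sub>R a, y t *\<^sub>R b, z t)" and ab: "norm a = 1" "norm b = 1"
    using surface_cases[OF q] .
  have aa: "a \<bullet> a = 1" "b \<bullet> b = 1" using ab by (simp_all add: dot_square_norm)
  obtain D where D: "(\<nu> has_derivative D) (at q within F ` torus)"
    using smooth_map_on_imp_differentiable[OF smooth_map_\<nu> q] .
  \<comment> \<open>\<open>D\<close> comes only from differentiability; its values on tangent
    vectors are read off along the test curves.\<close>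
  have Dv: "D ((l * x' t) *\<^sub>R a + \<alpha>, (l * y' t) *\<^sub>R b + \<beta>, l * z' t) =
      ((l * u' t) *\<^sub>R a + (u t / x t) *\<^sub>R \<alpha>, (l * v' t) *\<^sub>R b + (v t / y t) *\<^sub>R \<beta>, l * w' t)"
    if "a \<bullet> \<alpha> = 0" "b \<bullet> \<beta> = 0" for l \<alpha> \<beta>
    using derivative_along_curve[OF D curve(1,2,4,5)[OF ab that, of t l, folded qe]] .
  obtain A where A: "A \<subseteq> {v. a \<bullet> v = 0}" "pairwise orthogonal A" "\<And>b. b \<in> A \<Longrightarrow> norm b = 1"
    "finite A" "card A = m" "span A = {v. a \<bullet> v = 0}"
    using orthonormal_complement[OF ab(1)] dim by auto
  obtain B where B: "B \<subseteq> {v. b \<bullet> v = 0}" "pairwise orthogonal B" "\<And>b. b \<in> B \<Longrightarrow> norm b = 1"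
    "finite B" "card B = m" "span B = {v. b \<bullet> v = 0}"
    using orthonormal_complement[OF ab(2)] dim by auto
  define l where "l = 1 / \<kappa>"
  define e where "e = ((l * x' t) *\<^sub>R a, (l * y' t) *\<^sub>R b, l * z' t)"
  define A' where "A' = (\<lambda>\<alpha>. (\<alpha>, 0 :: 'a, 0 :: real)) ` A"
  define B' where "B' = (\<lambda>\<beta>. (0 :: 'a, \<beta>, 0 :: real)) ` B"
  have l2: "l * l * ((x' t)\<^sup>2 + (y' t)\<^sup>2 + (z' t)\<^sup>2) = 1"
    using speed[of t] \<kappa> by (simp add: l_def power2_eq_square)
  have ee: "e \<bullet> e = 1"
    using l2 by (simp add: e_def aa power2_eq_square algebra_simps)
  have norms: "\<forall>b\<in>insert e (A' \<union> B'). norm b = 1"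
    using ee A(3) B(3) by (auto simp: A'_def B'_def norm_Pair) (simp add: norm_eq_sqrt_inner)
  have orth: "pairwise orthogonal (insert e (A' \<union> B'))"
    using A(1,2) B(1,2) unfolding pairwise_def orthogonal_def A'_def B'_def e_def
    by (auto simp: inner_commute subset_iff) blast+
  have span: "span (insert e (A' \<union> B')) = tangent_space (F ` torus) q"
  proof
    have sub: "subspace (tangent_space (F ` torus) q)"
    proof -
      \<comment> \<open>With the parts tangent to the spheres eliminated, closure under sums and
        multiples amounts to adding and scaling \<open>l\<close>.\<close>
      have "tangent_space (F ` torus) q = {h. \<exists>l. a \<bullet> fst h = l * x' t \<and> b \<bullet> fst (snd h) = l * y' t \<and> snd (snd h) = l * z' t}"
        (is "_ = ?T")
      proof (intro equalityI subsetI)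
        fix h assume "h \<in> tangent_space (F ` torus) q"
        then show "h \<in> ?T" unfolding qe tangent_space_surface[OF ab] by (auto simp: inner_add_right aa)
      next
        fix h assume "h \<in> ?T"
        then obtain l where "a \<bullet> fst h = l * x' t" "b \<bullet> fst (snd h) = l * y' t" "snd (snd h) = l * z' t" by blast
        then have "h = ((l * x' t) *\<^sub>R a + (fst h - (a \<bullet> fst h) *\<^sub>R a),
            (l * y' t) *\<^sub>R b + (fst (snd h) - (b \<bullet> fst (snd h)) *\<^sub>R b), l * z' t)"
          by (simp add: prod_eq_iff)
        moreover have "a \<bullet> (fst h - (a \<bullet> fst h) *\<^sub>R a) = 0" "b \<bullet> (fst (snd h) - (b \<bullet> fst (snd h)) *\<^sub>R b) = 0"
          by (simp_all add: inner_diff_right aa)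
        ultimately show "h \<in> tangent_space (F ` torus) q"
          unfolding qe tangent_space_surface[OF ab] by blast
      qed
      moreover have "subspace ?T"
      proof (rule subspaceI)
        show "0 \<in> ?T" by (auto intro!: exI[of _ 0])
        fix h k assume "h \<in> ?T" "k \<in> ?T"
        then obtain r s where "a \<bullet> fst h = r * x' t" "b \<bullet> fst (snd h) = r * y' t" "snd (snd h) = r * z' t"
          "a \<bullet> fst k = s * x' t" "b \<bullet> fst (snd k) = s * y' t" "snd (snd k) = s * z' t" by blast
        then show "h + k \<in> ?T" by (auto intro!: exI[of _ "r + s"] simp: inner_add_right algebra_simps)
      next
        fix c h assume "h \<in> ?T"
        then obtain r where "a \<bullet> fst h = r * x' t" "b \<bullet> fst (snd h) = r * y' t" "snd (snd h) = r * z' t" by blast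
        then show "c *\<^sub>R h \<in> ?T" by (auto intro!: exI[of _ "c * r"])
      qed
      ultimately show ?thesis by simp
    qed
    have mem: "((r * x' t) *\<^sub>R a + \<alpha>, (r * y' t) *\<^sub>R b + \<beta>, r * z' t) \<in> tangent_space (F ` torus) q"
      if "a \<bullet> \<alpha> = 0" "b \<bullet> \<beta> = 0" for r \<alpha> \<beta>
      unfolding qe tangent_space_surface[OF ab] using that by blast
    have "insert e (A' \<union> B') \<subseteq> tangent_space (F ` torus) q"
      using mem[of 0 0 l] mem[of _ 0 0] mem[of 0 _ 0] A(1) B(1) by (auto simp: e_def A'_def B'_def)
    then show "span (insert e (A' \<union> B')) \<subseteq> tangent_space (F ` torus) q"
      using sub by (rule span_minimal)
    have inA: "(\<alpha>, 0, 0) \<in> span A'" if "a \<bullet> \<alpha> = 0" for \<alpha>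
    proof -
      have "linear (\<lambda>\<alpha>. (\<alpha>, 0 :: 'a, 0 :: real))" by (intro linearI) auto
      from linear_span_image[OF this, of A] show ?thesis using that by (auto simp: A(6) A'_def)
    qed
    have inB: "(0, \<beta>, 0) \<in> span B'" if "b \<bullet> \<beta> = 0" for \<beta>
    proof -
      have "linear (\<lambda>\<beta>. (0 :: 'a, \<beta>, 0 :: real))" by (intro linearI) auto
      from linear_span_image[OF this, of B] show ?thesis using that by (auto simp: B(6) B'_def)
    qed
    show "tangent_space (F ` torus) q \<subseteq> span (insert e (A' \<union> B'))"
    proof
      fix h assume "h \<in> tangent_space (F ` torus) q"
      then obtain r \<alpha> \<beta> where h: "h = ((r * x' t) *\<^sub>R a + \<alpha>, (r * y' t) *\<^sub>R b + \<beta>, r * z' t)"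
        and p: "a \<bullet> \<alpha> = 0" "b \<bullet> \<beta> = 0" unfolding qe tangent_space_surface[OF ab] by blast
      have "h = (r * \<kappa>) *\<^sub>R e + ((\<alpha>, 0, 0) + (0, \<beta>, 0))"
        using \<kappa> by (simp add: h e_def l_def)
      also have "\<dots> \<in> span (insert e (A' \<union> B'))"
        using subsetD[OF span_mono inA[OF p(1)], of "insert e (A' \<union> B')"]
          subsetD[OF span_mono inB[OF p(2)], of "insert e (A' \<union> B')"]
        by (intro span_add span_scale[OF span_base]) auto
      finally show "h \<in> span (insert e (A' \<union> B'))" .
    qed
  qed
  have DA: "- D (\<alpha>, 0, 0) \<bullet> (\<alpha>, 0, 0) = - (u t / x t)" if "\<alpha> \<in> A" for \<alpha>
    using Dv[of \<alpha> 0 0] A(1,3) that by (auto simp: dot_square_norm)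
  have DB: "- D (0, \<beta>, 0) \<bullet> (0, \<beta>, 0) = - (v t / y t)" if "\<beta> \<in> B" for \<beta>
    using Dv[of 0 \<beta> 0] B(1,3) that by (auto simp: dot_square_norm)
  have De: "- D e \<bullet> e = - (l * l * (u' t * x' t + v' t * y' t + w' t * z' t))"
    using Dv[of 0 0 l] by (simp add: e_def aa algebra_simps)
  have "A' \<inter> B' = {}" "e \<notin> A' \<union> B'"
  proof -
    have "0 \<notin> A" "0 \<notin> B" using A(3)[of 0] B(3)[of 0] by auto
    then show "A' \<inter> B' = {}" by (auto simp: A'_def B'_def)
    show "e \<notin> A' \<union> B'"
    proof
      assume "e \<in> A' \<union> B'"
      moreover have "e \<bullet> g = 0" if "g \<in> A' \<union> B'" for g
        using that A(1) B(1) unfolding A'_def B'_def e_def by auto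
      ultimately show False using ee by fastforce
    qed
  qed
  then have "(\<Sum>b\<in>insert e (A' \<union> B'). - D b \<bullet> b) = - D e \<bullet> e + ((\<Sum>b\<in>A'. - D b \<bullet> b) + (\<Sum>b\<in>B'. - D b \<bullet> b))"
    using A(4) B(4) by (simp add: A'_def B'_def sum.union_disjoint)
  also have "(\<Sum>b\<in>A'. - D b \<bullet> b) = - (real m * (u t / x t))"
  proof -
    have "(\<Sum>b\<in>A'. - D b \<bullet> b) = (\<Sum>\<alpha>\<in>A. - D (\<alpha>, 0, 0) \<bullet> (\<alpha>, 0, 0))"
      unfolding A'_def by (subst sum.reindex) (auto simp: inj_on_def)
    also have "\<dots> = (\<Sum>\<alpha>\<in>A. - (u t / x t))" by (rule sum.cong[OF refl DA])
    finally show ?thesis by (simp add: A(5))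
  qed
  also have "(\<Sum>b\<in>B'. - D b \<bullet> b) = - (real m * (v t / y t))"
  proof -
    have "(\<Sum>b\<in>B'. - D b \<bullet> b) = (\<Sum>\<beta>\<in>B. - D (0, \<beta>, 0) \<bullet> (0, \<beta>, 0))"
      unfolding B'_def by (subst sum.reindex) (auto simp: inj_on_def)
    also have "\<dots> = (\<Sum>\<beta>\<in>B. - (v t / y t))" by (rule sum.cong[OF refl DB])
    finally show ?thesis by (simp add: B(5))
  qed
  also have "- D e \<bullet> e + (- (real m * (u t / x t)) + - (real m * (v t / y t))) = 0"
  proof -
    have "u' t * x' t + v' t * y' t + w' t * z' t = - \<kappa>\<^sup>2 * (real m * (u t / x t) + real m * (v t / y t))"
      using curvature[of t] by simp
    then have "l * l * (u' t * x' t + v' t * y' t + w' t * z' t) = - (real m * (u t / x t) + real m * (v t / y t))"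
      using \<kappa> by (simp add: l_def power2_eq_square)
    then show ?thesis unfolding De by simp
  qed
  finally have "(\<Sum>b\<in>insert e (A' \<union> B'). - D b \<bullet> b) = 0" .
  then show ?thesis
    unfolding has_mean_curvature_def using D norms orth span
    by (intro exI[of _ D] exI[of _ "insert e (A' \<union> B')"]) auto
qed

theorem minimal_embedding_F:
  assumes "DIM('a::euclidean_space) = m + 1"
  shows "minimal_embedding (torus :: ('a \<times> 'a \<times> (real ^ 2)) set) (sphere 0 1) F"
  unfolding minimal_embedding_def vanishing_mean_curvature_def
  using smooth_embedding_F unit_normal_\<nu> mean_curvature_zero[OF assms] open_UNIV UNIV_I by blast

end

section \<open>Transport along a linear isometry\<close>

lemma tangent_space_linear_image:
  assumes J: "bounded_linear J" and v: "v \<in> tangent_space S p"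
  shows "J v \<in> tangent_space (J ` S) (J p)"
proof -
  obtain c e where c: "0 < e" "smooth_on {-e<..<e} c" "c ` {-e<..<e} \<subseteq> S" "c 0 = p"
    "(c has_vector_derivative v) (at 0)"
    using v unfolding tangent_space_def by blast
  have "smooth_on {-e<..<e} (\<lambda>s. J (c s))" by (rule smooth_on_bounded_linear[OF _ J c(2)]) simp
  moreover have "((\<lambda>s. J (c s)) has_vector_derivative J v) (at 0)"
    by (rule bounded_linear.has_vector_derivative[OF J c(5)])
  ultimately show ?thesis
    unfolding tangent_space_def mem_Collect_eq
    using c by (intro exI[of _ "\<lambda>s. J (c s)"] exI[of _ e]) auto
qed

locale linear_isometry =
  fixes J :: "'b::euclidean_space \<Rightarrow> 'c::euclidean_space" and G :: "'c \<Rightarrow> 'b"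
  assumes linear: "linear J" "linear G" and norm_J: "norm (J p) = norm p"
    and inv: "G (J p) = p" "J (G q) = q"
begin

lemma bounded: "bounded_linear J" "bounded_linear G"
  using linear by (simp_all add: linear_conv_bounded_linear)

lemma inner_J: "J p \<bullet> J q = p \<bullet> q"
  by (simp add: dot_norm norm_J linear_add[OF linear(1), symmetric])

lemma inj_J: "inj_on J S"
  by (rule inj_on_inverseI[of _ G]) (rule inv)

lemma image_G_J: "G ` J ` S = S"
  by (force simp: inv image_image)

lemma image_sphere: "J ` sphere 0 1 = sphere 0 1"
proof
  show "J ` sphere 0 1 \<subseteq> sphere 0 1" by (auto simp: norm_J)
  show "sphere 0 1 \<subseteq> J ` sphere 0 1"
  proof
    fix q assume "q \<in> sphere (0 :: 'c) 1"
    then have "q = J (G q)" "G q \<in> sphere 0 1" using norm_J[of "G q"] by (simp_all add: inv)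
    then show "q \<in> J ` sphere 0 1" by blast
  qed
qed

lemma tangent_space_image: "tangent_space (J ` S) (J p) = J ` tangent_space S p"
proof
  show "J ` tangent_space S p \<subseteq> tangent_space (J ` S) (J p)"
    using tangent_space_linear_image[OF bounded(1)] by blast
  show "tangent_space (J ` S) (J p) \<subseteq> J ` tangent_space S p"
  proof
    fix w assume "w \<in> tangent_space (J ` S) (J p)"
    from tangent_space_linear_image[OF bounded(2) this] have "G w \<in> tangent_space S p"
      by (simp add: image_G_J inv)
    moreover have "w = J (G w)" by (simp add: inv)
    ultimately show "w \<in> J ` tangent_space S p" by blast
  qed
qed

lemma smooth_map_on_conj:
  assumes "smooth_map_on S f"
  shows "smooth_map_on (J ` S) (\<lambda>q. J (f (G q)))"
  unfolding smooth_map_on_def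
proof
  fix q assume "q \<in> J ` S"
  then obtain p where p: "p \<in> S" "q = J p" by blast
  have "\<exists>U g. open U \<and> p \<in> U \<and> smooth_on U g \<and> (\<forall>x\<in>S \<inter> U. g x = f x)"
    using assms p(1) unfolding smooth_map_on_def by (rule bspec)
  then obtain U g where U: "open U" "p \<in> U" "smooth_on U g" "\<forall>x\<in>S \<inter> U. g x = f x" by blast
  have op: "open (G -` U)"
    by (intro open_vimage U(1) linear_continuous_on bounded)
  have "smooth_on (G -` U) (\<lambda>q. J (g (G q)))"
    by (intro smooth_on_bounded_linear[OF op bounded(1)] smooth_on_compose[OF op U(1) _ _ U(3)]
        smooth_on_bounded_linear[OF op bounded(2)] smooth_on_id[OF op]) auto
  then show "\<exists>U g. open U \<and> q \<in> U \<and> smooth_on U g \<and> (\<forall>x\<in>J ` S \<inter> U. g x = J (f (G x)))"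
    using op U(2,4) p(2) by (intro exI[of _ "G -` U"] exI[of _ "\<lambda>q. J (g (G q))"]) (auto simp: inv)
qed

lemma smooth_map_on_comp:
  assumes "smooth_map_on S f"
  shows "smooth_map_on S (\<lambda>p. J (f p))"
  unfolding smooth_map_on_def
proof
  fix p assume "p \<in> S"
  with assms have "\<exists>U g. open U \<and> p \<in> U \<and> smooth_on U g \<and> (\<forall>x\<in>S \<inter> U. g x = f x)"
    unfolding smooth_map_on_def by (rule bspec)
  then obtain U g where U: "open U" "p \<in> U" "smooth_on U g" "\<forall>x\<in>S \<inter> U. g x = f x" by blast
  then show "\<exists>U g. open U \<and> p \<in> U \<and> smooth_on U g \<and> (\<forall>x\<in>S \<inter> U. g x = J (f x))"
    by (intro exI[of _ U] exI[of _ "\<lambda>q. J (g q)"]) (auto intro: smooth_on_bounded_linear bounded)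
qed

lemma smooth_embedding_comp:
  assumes "smooth_embedding M (sphere 0 1) f"
  shows "smooth_embedding M (sphere 0 1) (\<lambda>p. J (f p))"
proof -
  have f: "f ` M \<subseteq> sphere 0 1" "smooth_map_on M f"
    "\<And>p. p \<in> M \<Longrightarrow> \<exists>f'. (f has_derivative f') (at p within M) \<and> inj_on f' (tangent_space M p)"
    "\<exists>g. homeomorphism M (f ` M) f g"
    using assms unfolding smooth_embedding_def immersion_on_def by blast+
  have "\<exists>h. ((\<lambda>p. J (f p)) has_derivative h) (at p within M) \<and> inj_on h (tangent_space M p)" if p: "p \<in> M" for p
  proof -
    obtain f' where f': "(f has_derivative f') (at p within M)" "inj_on f' (tangent_space M p)"
      using f(3)[OF p] by blast
    show ?thesis
      using bounded_linear.has_derivative[OF bounded(1) f'(1)] comp_inj_on[OF f'(2) inj_J]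
      by (auto simp: o_def)
  qed
  moreover have "\<exists>g. homeomorphism M ((\<lambda>p. J (f p)) ` M) (\<lambda>p. J (f p)) g"
  proof -
    obtain g where g: "homeomorphism M (f ` M) f g" using f(4) by blast
    have "homeomorphism (f ` M) (J ` f ` M) J G"
      by (intro homeomorphismI linear_continuous_on bounded) (auto simp: inv)
    from homeomorphism_compose[OF g this] show ?thesis by (auto simp: o_def image_image)
  qed
  ultimately show ?thesis
    using f(1) smooth_map_on_comp[OF f(2)] unfolding smooth_embedding_def immersion_on_def
    by (auto simp: norm_J image_subset_iff)
qed

text \<open>Conjugation by \<open>J\<close> carries the normal field and its derivative along. Since
  \<open>J\<close> preserves inner products, the unit sphere and tangent spaces, the trace over the
  image of an orthonormal basis is unchanged.\<close>

lemma vanishing_mean_curvature_image: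
  assumes "vanishing_mean_curvature (sphere 0 1) S"
  shows "vanishing_mean_curvature (sphere 0 1) (J ` S)"
  unfolding vanishing_mean_curvature_def
proof
  fix q assume "q \<in> J ` S"
  then obtain p where p: "p \<in> S" "q = J p" by blast
  then obtain U \<nu> where U: "open U" "p \<in> U" and \<nu>: "unit_normal_field (sphere 0 1) S U \<nu>"
    and H: "has_mean_curvature S \<nu> p 0"
    using assms unfolding vanishing_mean_curvature_def by blast
  define \<mu> where "\<mu> q = J (\<nu> (G q))" for q
  have SU: "J ` S \<inter> G -` U = J ` (S \<inter> U)" by (auto simp: inv)
  have "open (G -` U)" by (intro open_vimage U(1) linear_continuous_on bounded)
  moreover have "q \<in> G -` U" using p U(2) by (simp add: inv)
  moreover have "unit_normal_field (sphere 0 1) (J ` S) (G -` U) \<mu>"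
    unfolding unit_normal_field_def SU
  proof (intro conjI ballI)
    show "smooth_map_on (J ` (S \<inter> U)) \<mu>"
      using \<nu> smooth_map_on_conj unfolding unit_normal_field_def \<mu>_def by blast
    fix r assume "r \<in> J ` (S \<inter> U)"
    then obtain s where s: "s \<in> S \<inter> U" "r = J s" by blast
    have n: "\<nu> s \<in> tangent_space (sphere 0 1) s" "norm (\<nu> s) = 1" "\<And>v. v \<in> tangent_space S s \<Longrightarrow> \<nu> s \<bullet> v = 0"
      using \<nu> s(1) unfolding unit_normal_field_def by blast+
    have \<mu>: "\<mu> r = J (\<nu> s)" by (simp add: \<mu>_def s inv)
    show "\<mu> r \<in> tangent_space (sphere 0 1) r"
      using tangent_space_image[of "sphere 0 1" s] n(1)
      unfolding \<mu> unfolding s(2) image_sphere by simp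
    show "norm (\<mu> r) = 1" by (simp add: \<mu> norm_J n)
    fix v assume "v \<in> tangent_space (J ` S) r"
    then show "\<mu> r \<bullet> v = 0" unfolding s(2) tangent_space_image \<mu>[unfolded s(2)] using n(3) by (auto simp: inner_J)
  qed
  moreover have "has_mean_curvature (J ` S) \<mu> q 0"
  proof -
    obtain D B where D: "(\<nu> has_derivative D) (at p within S)" and B: "pairwise orthogonal B"
      "\<forall>b\<in>B. norm b = 1" "span B = tangent_space S p" and sum: "0 = (\<Sum>b\<in>B. - D b \<bullet> b)"
      using H unfolding has_mean_curvature_def by blast
    have "(\<nu> has_derivative D) (at (G q) within G ` J ` S)"
      using D by (simp add: image_G_J p inv)
    from has_derivative_in_compose[OF bounded_linear_imp_has_derivative[OF bounded(2)] this]
    have "(\<mu> has_derivative (\<lambda>v. J (D (G v)))) (at q within J ` S)"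
      unfolding \<mu>_def[abs_def] by (rule bounded_linear.has_derivative[OF bounded(1)])
    moreover have "pairwise orthogonal (J ` B)"
      using B(1) unfolding pairwise_def orthogonal_def by (auto simp: inner_J)
    moreover have "\<forall>b\<in>J ` B. norm b = 1" using B(2) by (simp add: norm_J)
    moreover have "span (J ` B) = tangent_space (J ` S) q"
      unfolding p(2) tangent_space_image B(3)[symmetric] by (rule linear_span_image[OF linear(1)])
    moreover have "(\<Sum>b\<in>J ` B. - J (D (G b)) \<bullet> b) = (\<Sum>b\<in>B. - D b \<bullet> b)"
      by (subst sum.reindex[OF inj_J]) (simp add: inv inner_J)
    ultimately show ?thesis
      unfolding has_mean_curvature_def using sum
      by (intro exI[of _ "\<lambda>v. J (D (G v))"] exI[of _ "J ` B"]) simp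
  qed
  ultimately show "\<exists>U \<nu>. open U \<and> q \<in> U \<and> unit_normal_field (sphere 0 1) (J ` S) U \<nu> \<and>
      has_mean_curvature (J ` S) \<nu> q 0" by blast
qed

lemma minimal_embedding_comp:
  assumes "minimal_embedding M (sphere 0 1) f"
  shows "minimal_embedding M (sphere 0 1) (\<lambda>p. J (f p))"
  using assms smooth_embedding_comp[of M f] vanishing_mean_curvature_image[of "f ` M"]
  unfolding minimal_embedding_def by (simp add: image_image)

end

theorem theorem1p1:
  fixes n :: nat
  assumes "n \<ge> 2"
    and "CARD('n::finite) = n"
    and "CARD('m::finite) = 2 * n + 1"
  shows "\<exists>F :: (real ^ 'n) \<times> (real ^ 'n) \<times> (real ^ 2) \<Rightarrow> real ^ 'm.
           minimal_embedding
             (sphere (0 :: real ^ 'n) 1 \<times> sphere (0 :: real ^ 'n) 1 \<times> sphere (0 :: real ^ 2) 1)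
             (sphere (0 :: real ^ 'm) 1) F"
proof -
  define m where "m = n - 1"
  have m: "1 \<le> m" "DIM(real ^ 'n) = m + 1" using assms by (simp_all add: m_def)
  obtain \<kappa> \<phi> \<psi> \<alpha> where "closed_angles m \<kappa> \<phi> \<psi> \<alpha>" using closed_angles_exist[OF m(1)] .
  from closed_profile.minimal_embedding_F[OF closed_angles.closed_profile_of_angles[OF this] m(2)]
  obtain f :: "(real ^ 'n) \<times> (real ^ 'n) \<times> (real ^ 2) \<Rightarrow> (real ^ 'n) \<times> (real ^ 'n) \<times> real"
    where f: "minimal_embedding torus (sphere 0 1) f" by blast
  have dim: "DIM((real ^ 'n) \<times> (real ^ 'n) \<times> real) = DIM(real ^ 'm)" using assms by simp
  obtain J :: "(real ^ 'n) \<times> (real ^ 'n) \<times> real \<Rightarrow> real ^ 'm" and G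
    where "linear J" "linear G" "\<And>p. norm (J p) = norm p" "\<And>q. norm (G q) = norm q" "\<And>p. G (J p) = p" "\<And>q. J (G q) = q"
    by (rule isomorphisms_UNIV_UNIV[OF dim]) (rule that)
  then interpret linear_isometry J G by (simp add: linear_isometry_def)
  show ?thesis using minimal_embedding_comp[OF f] by blast
qed

end
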